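(* Let $\mathcal S$ be a semispray on $\mathcal M$, let $\mathcal J$ be the almost tangent structure on $\mathbf T\mathcal M$ associated with $\mathcal S$, and let $\Omega$ be an almost cotangent structure on $\mathbf T\mathcal M$ compatible with $\mathcal J$. Let $g=g_\Omega$ be the associated pseudo-Riemannian metric on $\mathbf V\mathcal M$. (i) There exists a unique nonlinear connection $\mathcal N$ on $\mathbf T\mathcal M$ which is Lagrangian (relative to $\Omega$) and $g_\Omega$-metric (relative to $\mathcal S$). It is characterized by the relation $$\mathcal N=\mathcal N_{\mathcal S}-2(g^2)^{-1}\big[D_{\mathcal N_{\mathcal S}}g+\Omega(\mathcal H_{\mathcal S}\cdot,\mathcal H_{\mathcal S}\cdot)\big]\circ\mathcal J .$$ In an adapted canonical basis $\{\mathcal X_\alpha,\mathcal V_\beta\}$ of $\mathbf T\mathcal M$, the local coefficients $\mathcal N_\alpha^\beta$ of $\mathcal N$ are characterized by $$g_{\beta\gamma}\mathcal N_\alpha^\gamma=-\frac12\Big[\omega_{\alpha\beta}+\mathcal L^{\mathcal P}_{\mathcal S}(g_{\alpha\beta})+g_{\alpha\gamma}\frac{\partial \mathcal S^\gamma}{\partial y^\beta}+g_{\beta\gamma}\frac{\partial \mathcal S^\gamma}{\partial y^\alpha}\Big].$$ (ii) The canonical connection $\mathcal N_{\mathcal S}$ is Lagrangian (relative to $\Omega$) and $g_\Omega$-metric (relative to $\mathcal S$) if and only if, in an adapted canonical basis associated with a coordinate system compatible with the locally linear fibration structure associated with $\mathcal C=\mathcal J\mathcal S$, the semispray $\mathcal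 S$ satisfies $$\omega_{\alpha\beta}+\mathcal L^{\mathcal P}_{\mathcal S}(g_{\alpha\beta})+g_{\alpha\delta}\frac{\partial \mathcal S^\delta}{\partial y^\beta}+g_{\beta\delta}C_{\alpha\mu}^\delta y^\mu=0 .$$ In this case $\mathcal N_{\mathcal S}$ is the unique nonlinear connection which is Lagrangian and $g_\Omega$-metric.
   Context: Prolongation. $M$ is a connected paracompact smooth manifold of dimension $n$; $\tau:\mathcal A\to M$ is a rank $k$ vector bundle with anchor $\rho:\mathcal A\to TM$ (bundle morphism over the identity) and an almost Lie bracket $[\,,\,]_{\mathcal A}$ (antisymmetric, $\mathbb R$-bilinear, $[X,fY]_{\mathcal A}=f[X,Y]_{\mathcal A}+df(\rho X)Y$) with $\rho[X,Y]_{\mathcal A}=[\rho X,\rho Y]$ (a pre-Lie algebroid; no Jacobi identity). $\pi:\mathcal M\to M$ is a fibered manifold with connected typical fiber of dimension $k$. $\mathbf T\mathcal M\to\mathcal M$ is the vector bundle with fiber $\{(b,v)\in\mathcal A_{\pi(m)}\times T_m\mathcal M:\rho(b)=T\pi(v)\}$ at $m$, with anchor $\hat\rho(m,b,v)=v$; $\mathbf V\mathcal M=\{(m,0,v)\}$ is the vertical subbundle. Given coordinates $(x^i,y^\alpha)$ on $\mathcal M$ compatible with $\pi$ and a local frame $(e_\alpha)$ of $\mathcal A$ with $\rho(e_\alpha)=\rho_\alpha^i\partial_{x^i}$, $[e_\alpha,e_\beta]_{\mathcal A}=C_{\alpha\beta}^\gamma e_\gamma$, the canonical basis is $\mathcal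 X_\alpha=(e_\alpha,\rho_\alpha^i\partial_{x^i})$, $\mathcal V_\alpha=(0,\partial_{y^\alpha})$. The almost Lie bracket $[\,,\,]_{\mathcal P}$ on $(\mathbf T\mathcal M,\mathcal M,\hat\rho)$ is determined by $[\mathcal X_\alpha,\mathcal X_\beta]_{\mathcal P}=C_{\alpha\beta}^\gamma\mathcal X_\gamma$, $[\mathcal X_\alpha,\mathcal V_\beta]_{\mathcal P}=0$, $[\mathcal V_\alpha,\mathcal V_\beta]_{\mathcal P}=0$. $\mathcal L^{\mathcal P}_{\mathcal X}f=\hat\rho(\mathcal X)(f)$, and for an endomorphism $I$, $(\mathcal L^{\mathcal P}_{\mathcal S}I)(\mathcal X)=[\mathcal S,I\mathcal X]_{\mathcal P}-I[\mathcal S,\mathcal X]_{\mathcal P}$. Structures. An almost tangent structure is an endomorphism $\mathcal J$ of $\mathbf T\mathcal M$ with $\operatorname{im}\mathcal J=\ker\mathcal J=\mathbf V\mathcal M$. An almost cotangent structure is a nondegenerate $2$-form $\Omega$ on $\mathbf T\mathcal M$ for which each $\mathbf V_m\mathcal M$ is Lagrangian. They are compatible if $\Omega(\mathcal J\mathcal X,\mathcal Y)+\Omega(\mathcal X,\mathcal J\mathcal Y)=0$; then $g_\Omega(\mathcal J\mathcal Z,\mathcal Y)=\Omega(\mathcal Z,\mathcal Y)$ ($\mathcal Y$ vertical) defines a pseudo-Riemannian metric $g_\Omega$ on $\mathbf V\mathcal M$. A semispray is a global section $\mathcal S$ of $\mathbf T\mathcal M$ such that for local frames $(\mathcal V_\alpha)$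 of $\mathbf V\mathcal M$ the $\mathcal V_\alpha$ and $[\mathcal S,\mathcal V_\alpha]_{\mathcal P}$ together span $\mathbf T\mathcal M$; there is a unique almost tangent structure $\mathcal J$ associated (compatible) with $\mathcal S$, i.e. with $\mathcal J[\mathcal S,\mathcal V]_{\mathcal P}=-\mathcal V$ for all vertical $\mathcal V$. An adapted canonical basis is a canonical basis with $\mathcal J\mathcal X_\alpha=\mathcal V_\alpha$, $\mathcal S=y^\alpha\mathcal X_\alpha+\mathcal S^\beta\mathcal V_\beta$ (so $\mathcal C=\mathcal J\mathcal S=y^\alpha\mathcal V_\alpha$); such bases exist around every point. The locally linear fibration structure associated with $\mathcal C$ is the atlas of $\pi$-compatible charts $(x^i,y^\alpha)$ in which $\mathcal C=y^\alpha\mathcal V_\alpha$. In an adapted canonical basis write $\omega_{\alpha\beta}=\Omega(\mathcal X_\alpha,\mathcal X_\beta)$, $g_{\alpha\beta}=\Omega(\mathcal X_\alpha,\mathcal V_\beta)=g_\Omega(\mathcal V_\alpha,\mathcal V_\beta)$. Connections. A nonlinear connection is an endomorphism $\mathcal N$ of $\mathbf T\mathcal M$ with $\mathcal N^2=\mathrm{Id}$ and $\ker(\mathrm{Id}+\mathcal N)=\mathbf V\mathcal M$; horizontal bundle $\ker(\mathrm{Id}-\mathcal N)$, projectors $h_{\mathcal N}=\frac12(\mathrm{Id}+\mathcal N)$, $v_{\mathcal N}=\frac12(\mathrm{Id}-\mathcal N)$. In a basis with $\mathcal J\mathcal X_\alpha=\mathcal V_\alpha$ its coefficients are defined by $h_{\mathcal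 N}(\mathcal X_\alpha)=\mathcal X_\alpha-\mathcal N_\alpha^\beta\mathcal V_\beta$. $\mathcal N_{\mathcal S}=-\mathcal L^{\mathcal P}_{\mathcal S}\mathcal J$ is a nonlinear connection; $\mathcal H_{\mathcal S}$ is the isomorphism from $\mathbf V\mathcal M$ onto the horizontal bundle of $\mathcal N_{\mathcal S}$ inverse to the restriction of $\mathcal J$. $\mathcal N$ is Lagrangian if its horizontal bundle is Lagrangian for $\Omega$. The dynamical derivation is $D_{\mathcal N}(\mathcal X)=v_{\mathcal N}[\mathcal S,\mathcal X]_{\mathcal P}$ for vertical sections $\mathcal X$, and $D_{\mathcal N}g(\mathcal X,\mathcal X')=\mathcal L^{\mathcal P}_{\mathcal S}(g(\mathcal X,\mathcal X'))-g(D_{\mathcal N}\mathcal X,\mathcal X')-g(\mathcal X,D_{\mathcal N}\mathcal X')$. $\mathcal N$ is $g$-metric (relative to $\mathcal S$) if $D_{\mathcal N}g=0$. $g^2$ is the isomorphism sending an endomorphism $\Delta$ of $\mathbf V\mathcal M$ to the bilinear form $g^2(\Delta)(\mathcal X,\mathcal X')=g(\Delta\mathcal X,\mathcal X')$.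
   Formalization: The factor -2 in the global relation is false with the given definitions (it contradicts the local formula) and is replaced by +1: N = N_S + (g^2)^{-1}[D_{N_S}g + Omega(H_S.,H_S.)] o J; the dimensions n and k are taken to be at least 1. *)

theory Defs
  imports "HOL-Analysis.Analysis" "HOL-Library.Function_Algebras"
begin

section \<open>Smooth manifolds\<close>

text \<open>Pointwise scalar multiplication on functions, so that spaces of functionals are
  real vector spaces.\<close>

instantiation "fun" :: (type, real_vector) real_vector
begin
definition scaleR_fun :: "real \<Rightarrow> ('a \<Rightarrow> 'b) \<Rightarrow> 'a \<Rightarrow> 'b"
  where "scaleR_fun r f = (\<lambda>x. r *\<^sub>R f x)"
instance
  by standard (simp_all add: scaleR_fun_def fun_eq_iff scaleR_add_right scaleR_add_left)
end

text \<open>Differentiability of class \<open>C\<^sup>k\<close> is only used on open subsets of Euclidean spaces.\<close>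

fun ck_on :: "nat \<Rightarrow> 'a::real_normed_vector set \<Rightarrow> ('a \<Rightarrow> 'b::real_normed_vector) \<Rightarrow> bool" where
  "ck_on 0 S f = continuous_on S f"
| "ck_on (Suc k) S f =
     ((\<forall>x\<in>S. f differentiable (at x)) \<and> (\<forall>v. ck_on k S (\<lambda>x. frechet_derivative f (at x) v)))"

definition smooth_on :: "'a::real_normed_vector set \<Rightarrow> ('a \<Rightarrow> 'b::real_normed_vector) \<Rightarrow> bool"
  where "smooth_on S f \<longleftrightarrow> (\<forall>k. ck_on k S f)"

text \<open>A chart is a pair of its domain and a map whose values outside the domain are irrelevant.\<close>

type_synonym ('a, 'e) chart = "'a set \<times> ('a \<Rightarrow> 'e)"

abbreviation chart_inv :: "('a, 'e) chart \<Rightarrow> 'e \<Rightarrow> 'a"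
  where "chart_inv c \<equiv> the_inv_into (fst c) (snd c)"

definition is_chart :: "('a::topological_space, 'e::euclidean_space) chart \<Rightarrow> bool" where
  "is_chart c \<longleftrightarrow> open (fst c) \<and> open (snd c ` fst c) \<and> inj_on (snd c) (fst c) \<and>
     homeomorphism (fst c) (snd c ` fst c) (snd c) (chart_inv c)"

definition smooth_transition ::
    "('a, 'e::euclidean_space) chart \<Rightarrow> ('a, 'e) chart \<Rightarrow> bool" where
  "smooth_transition c d \<longleftrightarrow> smooth_on (snd c ` (fst c \<inter> fst d)) (snd d \<circ> chart_inv c)"

text \<open>A smooth structure is a maximal atlas, so the charts of a manifold are exactly the
  members of the atlas. The Hausdorff property is the type class \<open>t2_space\<close>.\<close>

definition smooth_manifold :: "('a::t2_space, 'e::euclidean_space) chart set \<Rightarrow> bool" where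
  "smooth_manifold A \<longleftrightarrow>
     (\<forall>c\<in>A. is_chart c) \<and> (\<Union>c\<in>A. fst c) = UNIV \<and>
     (\<forall>c\<in>A. \<forall>d\<in>A. smooth_transition c d) \<and>
     (\<forall>c. is_chart c \<and> (\<forall>d\<in>A. smooth_transition c d \<and> smooth_transition d c) \<longrightarrow> c \<in> A)"

definition paracompact_type :: "'a::topological_space itself \<Rightarrow> bool" where
  "paracompact_type TYPE('a) \<longleftrightarrow>
     (\<forall>\<C> :: 'a set set. (\<forall>U\<in>\<C>. open U) \<and> \<Union>\<C> = UNIV \<longrightarrow>
        (\<exists>\<D>. (\<forall>V\<in>\<D>. open V \<and> (\<exists>U\<in>\<C>. V \<subseteq> U)) \<and> \<Union>\<D> = UNIV \<and>
             (\<forall>x. \<exists>W. open W \<and> x \<in> W \<and> finite {V \<in> \<D>. V \<inter> W \<noteq> {}})))"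

definition smooth_map ::
    "('a::topological_space, 'e::euclidean_space) chart set \<Rightarrow>
     ('b::topological_space, 'd::euclidean_space) chart set \<Rightarrow> 'a set \<Rightarrow> ('a \<Rightarrow> 'b) \<Rightarrow> bool" where
  "smooth_map A B S f \<longleftrightarrow> open S \<and> continuous_on S f \<and>
     (\<forall>c\<in>A. \<forall>d\<in>B. smooth_on (snd c ` (fst c \<inter> S \<inter> f -` fst d)) (snd d \<circ> f \<circ> chart_inv c))"

definition diffeo ::
    "('a::topological_space, 'e::euclidean_space) chart set \<Rightarrow>
     ('b::topological_space, 'd::euclidean_space) chart set \<Rightarrow>
     'a set \<Rightarrow> 'b set \<Rightarrow> ('a \<Rightarrow> 'b) \<Rightarrow> bool" where
  "diffeo A B S T f \<longleftrightarrow>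
     bij_betw f S T \<and> smooth_map A B S f \<and> smooth_map B A T (the_inv_into S f)"

definition smooth_fun ::
    "('a::topological_space, 'e::euclidean_space) chart set \<Rightarrow> 'a set \<Rightarrow> ('a \<Rightarrow> real) \<Rightarrow> bool" where
  "smooth_fun A U f \<longleftrightarrow> open U \<and> (\<forall>c\<in>A. smooth_on (snd c ` (fst c \<inter> U)) (f \<circ> chart_inv c))"

definition smooth_near ::
    "('a::topological_space, 'e::euclidean_space) chart set \<Rightarrow> 'a \<Rightarrow> ('a \<Rightarrow> real) \<Rightarrow> bool" where
  "smooth_near A p f \<longleftrightarrow> (\<exists>U. p \<in> U \<and> smooth_fun A U f)"

definition prod_charts ::
    "('a, 'e) chart set \<Rightarrow> ('b, 'd) chart set \<Rightarrow> ('a \<times> 'b, 'e \<times> 'd) chart set" where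
  "prod_charts A B = {(fst c \<times> fst d, map_prod (snd c) (snd d)) | c d. c \<in> A \<and> d \<in> B}"

text \<open>A locally trivial fibration, hence in particular a surjective submersion.\<close>

definition fibration ::
    "('m::topological_space, 'e::euclidean_space) chart set \<Rightarrow>
     ('p::topological_space, 'e \<times> 'd) chart set \<Rightarrow>
     ('f::topological_space, 'd::euclidean_space) chart set \<Rightarrow> ('p \<Rightarrow> 'm) \<Rightarrow> bool" where
  "fibration AM AP AF \<pi> \<longleftrightarrow> smooth_map AP AM UNIV \<pi> \<and>
     (\<forall>x. \<exists>U \<psi>. open U \<and> x \<in> U \<and>
        diffeo AP (prod_charts AM AF) (\<pi> -` U) (U \<times> UNIV) (\<lambda>m. (\<pi> m, \<psi> m)))"

section \<open>Tangent vectors\<close>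

text \<open>A tangent vector at \<open>p\<close> is a directional derivative acting on functions that are smooth
  near \<open>p\<close>; it is extended by \<open>0\<close> to all other functions, which makes it independent of the
  chart used to represent it.\<close>

type_synonym 'a tangent = "('a \<Rightarrow> real) \<Rightarrow> real"

definition germwise ::
    "('a::topological_space, 'e::euclidean_space) chart set \<Rightarrow> 'a \<Rightarrow> 'a tangent \<Rightarrow> 'a tangent" where
  "germwise A p v = (\<lambda>f. if smooth_near A p f then v f else 0)"

definition tvec ::
    "('a::topological_space, 'e::euclidean_space) chart set \<Rightarrow> ('a, 'e) chart \<Rightarrow> 'a \<Rightarrow> 'e \<Rightarrow> 'a tangent"
  where
  "tvec A c p u =
     germwise A p (\<lambda>f. frechet_derivative (f \<circ> chart_inv c) (at (snd c p)) u)"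

definition tangent_space ::
    "('a::topological_space, 'e::euclidean_space) chart set \<Rightarrow> 'a \<Rightarrow> 'a tangent set" where
  "tangent_space A p = {tvec A c p u | c u. c \<in> A \<and> p \<in> fst c}"

definition pushforward ::
    "('b::topological_space, 'd::euclidean_space) chart set \<Rightarrow> ('a \<Rightarrow> 'b) \<Rightarrow> 'a \<Rightarrow>
     'a tangent \<Rightarrow> 'b tangent" where
  "pushforward B f p v = germwise B (f p) (\<lambda>h. v (h \<circ> f))"

definition lie_bracket ::
    "('a::topological_space, 'e::euclidean_space) chart set \<Rightarrow>
     ('a \<Rightarrow> 'a tangent) \<Rightarrow> ('a \<Rightarrow> 'a tangent) \<Rightarrow> 'a \<Rightarrow> 'a tangent" where
  "lie_bracket A X Y p = germwise A p (\<lambda>f. X p (\<lambda>q. Y q f) - Y p (\<lambda>q. X q f))"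

section \<open>Vector bundles and almost Lie brackets\<close>

text \<open>The fibres of a vector bundle are subspaces of one ambient real vector space, and its
  smooth structure is given by a covering family of local frames indexed by \<open>'i\<close>.
  Local sections are total functions whose values off their domain are irrelevant.\<close>

record ('b, 'v, 'i) vbundle =
  fibre :: "'b \<Rightarrow> 'v set"
  frames :: "('b set \<times> ('i \<Rightarrow> 'b \<Rightarrow> 'v)) set"

definition basis_of :: "'v::real_vector set \<Rightarrow> ('i \<Rightarrow> 'v) \<Rightarrow> bool" where
  "basis_of F e \<longleftrightarrow> inj e \<and> independent (range e) \<and> span (range e) = F"

definition frame_coeff :: "('i \<Rightarrow> 'b \<Rightarrow> 'v::real_vector) \<Rightarrow> 'b \<Rightarrow> 'v \<Rightarrow> 'i \<Rightarrow> real" where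
  "frame_coeff e x v i = representation (range (\<lambda>j. e j x)) v (e i x)"

definition smooth_section ::
    "('b::topological_space, 'e::euclidean_space) chart set \<Rightarrow>
     ('b, 'v::real_vector, 'i::finite) vbundle \<Rightarrow> 'b set \<Rightarrow> ('b \<Rightarrow> 'v) \<Rightarrow> bool" where
  "smooth_section A E U s \<longleftrightarrow> open U \<and> (\<forall>x\<in>U. s x \<in> fibre E x) \<and>
     (\<forall>(W, e) \<in> frames E. \<forall>i. smooth_fun A (U \<inter> W) (\<lambda>x. frame_coeff e x (s x) i))"

definition local_frame ::
    "('b::topological_space, 'e::euclidean_space) chart set \<Rightarrow>
     ('b, 'v::real_vector, 'i::finite) vbundle \<Rightarrow> 'b set \<Rightarrow> ('i \<Rightarrow> 'b \<Rightarrow> 'v) \<Rightarrow> bool" where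
  "local_frame A E U e \<longleftrightarrow> (\<forall>i. smooth_section A E U (e i)) \<and>
     (\<forall>x\<in>U. basis_of (fibre E x) (\<lambda>i. e i x))"

definition vector_bundle ::
    "('b::topological_space, 'e::euclidean_space) chart set \<Rightarrow>
     ('b, 'v::real_vector, 'i::finite) vbundle \<Rightarrow> bool" where
  "vector_bundle A E \<longleftrightarrow> (\<Union>(W, e) \<in> frames E. W) = UNIV \<and>
     (\<forall>(W, e) \<in> frames E. open W \<and> local_frame A E W e)"

definition tangent_bundle ::
    "('a::topological_space, real^'n) chart set \<Rightarrow> ('a, 'a tangent, 'n::finite) vbundle" where
  "tangent_bundle A =
     \<lparr>fibre = tangent_space A,
      frames = {(fst c, \<lambda>i p. tvec A c p (axis i 1)) | c. c \<in> A}\<rparr>"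

definition bundle_morphism ::
    "('b::topological_space, 'e::euclidean_space) chart set \<Rightarrow>
     ('b, 'v::real_vector, 'i::finite) vbundle \<Rightarrow> ('b, 'w::real_vector, 'j::finite) vbundle \<Rightarrow>
     ('b \<Rightarrow> 'v \<Rightarrow> 'w) \<Rightarrow> bool" where
  "bundle_morphism A E F h \<longleftrightarrow>
     (\<forall>x. \<forall>u\<in>fibre E x. h x u \<in> fibre F x \<and>
        (\<forall>u'\<in>fibre E x. h x (u + u') = h x u + h x u') \<and>
        (\<forall>r. h x (r *\<^sub>R u) = r *\<^sub>R h x u)) \<and>
     (\<forall>U s. smooth_section A E U s \<longrightarrow> smooth_section A F U (\<lambda>x. h x (s x)))"

text \<open>Endomorphisms are extensional (undefined off the fibres), so that HOL equality of
  endomorphisms is equality on the bundle.\<close>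

definition endomorphisms ::
    "('b::topological_space, 'e::euclidean_space) chart set \<Rightarrow>
     ('b, 'v::real_vector, 'i::finite) vbundle \<Rightarrow> ('b \<Rightarrow> 'v \<Rightarrow> 'v) set" where
  "endomorphisms A E =
     {I. bundle_morphism A E E I \<and> (\<forall>x. I x \<in> extensional (fibre E x))}"

definition bilinear_form ::
    "('b::topological_space, 'e::euclidean_space) chart set \<Rightarrow>
     ('b, 'v::real_vector, 'i::finite) vbundle \<Rightarrow> ('b \<Rightarrow> 'v \<Rightarrow> 'v \<Rightarrow> real) \<Rightarrow> bool" where
  "bilinear_form A E B \<longleftrightarrow>
     (\<forall>x. \<forall>u\<in>fibre E x. \<forall>u'\<in>fibre E x. \<forall>w\<in>fibre E x. \<forall>r.
        B x (u + u') w = B x u w + B x u' w \<and> B x w (u + u') = B x w u + B x w u' \<and>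
        B x (r *\<^sub>R u) w = r * B x u w \<and> B x w (r *\<^sub>R u) = r * B x w u) \<and>
     (\<forall>U s t. smooth_section A E U s \<and> smooth_section A E U t \<longrightarrow>
        smooth_fun A U (\<lambda>x. B x (s x) (t x)))"

text \<open>Almost Lie brackets are brackets of local sections: a single function that is a bracket
  over every open set and is compatible with restriction. By the Leibniz rule a bracket of
  global sections determines such a bracket of local ones.\<close>

definition almost_lie_bracket ::
    "('b::topological_space, 'e::euclidean_space) chart set \<Rightarrow>
     ('b, 'v::real_vector, 'i::finite) vbundle \<Rightarrow> ('b \<Rightarrow> 'v \<Rightarrow> 'b tangent) \<Rightarrow>
     (('b \<Rightarrow> 'v) \<Rightarrow> ('b \<Rightarrow> 'v) \<Rightarrow> 'b \<Rightarrow> 'v) \<Rightarrow> bool" where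
  "almost_lie_bracket A E \<rho> br \<longleftrightarrow>
     (\<forall>U X Y. smooth_section A E U X \<and> smooth_section A E U Y \<longrightarrow>
        smooth_section A E U (br X Y) \<and>
        (\<forall>x\<in>U. br X Y x = - br Y X x) \<and>
        (\<forall>Y'. smooth_section A E U Y' \<longrightarrow>
           (\<forall>a b. \<forall>x\<in>U. br X (\<lambda>q. a *\<^sub>R Y q + b *\<^sub>R Y' q) x = a *\<^sub>R br X Y x + b *\<^sub>R br X Y' x) \<and>
           ((\<forall>x\<in>U. Y' x = Y x) \<longrightarrow> (\<forall>x\<in>U. br X Y' x = br X Y x))) \<and>
        (\<forall>f. smooth_fun A U f \<longrightarrow>
           (\<forall>x\<in>U. br X (\<lambda>q. f q *\<^sub>R Y q) x = f x *\<^sub>R br X Y x + \<rho> x (X x) f *\<^sub>R Y x)))"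

definition pre_lie_algebroid ::
    "('b::topological_space, real^'n) chart set \<Rightarrow>
     ('b, 'v::real_vector, 'i::finite) vbundle \<Rightarrow> ('b \<Rightarrow> 'v \<Rightarrow> 'b tangent) \<Rightarrow>
     (('b \<Rightarrow> 'v) \<Rightarrow> ('b \<Rightarrow> 'v) \<Rightarrow> 'b \<Rightarrow> 'v) \<Rightarrow> bool" where
  "pre_lie_algebroid A E \<rho> br \<longleftrightarrow> vector_bundle A E \<and>
     bundle_morphism A E (tangent_bundle A) \<rho> \<and> almost_lie_bracket A E \<rho> br \<and>
     (\<forall>U X Y. smooth_section A E U X \<and> smooth_section A E U Y \<longrightarrow>
        (\<forall>x\<in>U. \<rho> x (br X Y x) = lie_bracket A (\<lambda>q. \<rho> q (X q)) (\<lambda>q. \<rho> q (Y q)) x))"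

text \<open>The tensor (endomorphism, bilinear form) induced by an operator on local sections whose
  value at a point depends only on the values of its arguments at that point.\<close>

definition endo_of_operator ::
    "('b::topological_space, 'e::euclidean_space) chart set \<Rightarrow>
     ('b, 'v::real_vector, 'i::finite) vbundle \<Rightarrow> (('b \<Rightarrow> 'v) \<Rightarrow> 'b \<Rightarrow> 'v) \<Rightarrow> 'b \<Rightarrow> 'v \<Rightarrow> 'v" where
  "endo_of_operator A E D = (\<lambda>x. \<lambda>w\<in>fibre E x.
     THE z. \<exists>U X. x \<in> U \<and> smooth_section A E U X \<and> X x = w \<and> z = D X x)"

definition form_of_operator ::
    "('b::topological_space, 'e::euclidean_space) chart set \<Rightarrow>
     ('b, 'v::real_vector, 'i::finite) vbundle \<Rightarrow> (('b \<Rightarrow> 'v) \<Rightarrow> ('b \<Rightarrow> 'v) \<Rightarrow> 'b \<Rightarrow> real) \<Rightarrow>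
     'b \<Rightarrow> 'v \<Rightarrow> 'v \<Rightarrow> real" where
  "form_of_operator A E D = (\<lambda>x. \<lambda>w\<in>fibre E x. \<lambda>w'\<in>fibre E x.
     THE r. \<exists>U X X'. x \<in> U \<and> smooth_section A E U X \<and> smooth_section A E U X' \<and>
                    X x = w \<and> X' x = w' \<and> r = D X X' x)"

section \<open>The prolongation\<close>

record ('m, 'p, 'v, 'n, 'k) fibred_algebroid =
  base_atlas :: "('m, real^'n::finite) chart set"
  total_atlas :: "('p, (real^'n::finite) \<times> (real^'k::finite)) chart set"
  proj :: "'p \<Rightarrow> 'm"
  alg :: "('m, 'v, 'k::finite) vbundle"
  anchor :: "'m \<Rightarrow> 'v \<Rightarrow> 'm tangent"
  bracket :: "('m \<Rightarrow> 'v) \<Rightarrow> ('m \<Rightarrow> 'v) \<Rightarrow> 'm \<Rightarrow> 'v"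

definition fibred_pre_lie_algebroid ::
    "('m::t2_space, 'p::t2_space, 'v::real_vector, 'n::finite, 'k::finite) fibred_algebroid \<Rightarrow>
     ('f::t2_space, real^'k) chart set \<Rightarrow> bool" where
  "fibred_pre_lie_algebroid K AF \<longleftrightarrow>
     smooth_manifold (base_atlas K) \<and> connected (UNIV :: 'm set) \<and> paracompact_type TYPE('m) \<and>
     pre_lie_algebroid (base_atlas K) (alg K) (anchor K) (bracket K) \<and>
     smooth_manifold (total_atlas K) \<and>
     smooth_manifold AF \<and> connected (UNIV :: 'f set) \<and>
     fibration (base_atlas K) (total_atlas K) AF (proj K)"

type_synonym ('p, 'v) pvec = "'v \<times> 'p tangent"

definition prol_fibre ::
    "('m::topological_space, 'p::topological_space, 'v, 'n::finite, 'k::finite) fibred_algebroid \<Rightarrow>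
     'p \<Rightarrow> ('p, 'v) pvec set" where
  "prol_fibre K m =
     {(b, v). b \<in> fibre (alg K) (proj K m) \<and> v \<in> tangent_space (total_atlas K) m \<and>
              anchor K (proj K m) b = pushforward (base_atlas K) (proj K) m v}"

text \<open>The data of a canonical basis: a chart of the total space, the chart of the base it lies
  over, and a local frame.\<close>

record ('m, 'p, 'v, 'n, 'k) canon =
  tchart :: "('p, (real^'n::finite) \<times> (real^'k::finite)) chart"
  bchart :: "('m, real^'n::finite) chart"
  aframe :: "'k::finite \<Rightarrow> 'm \<Rightarrow> 'v"

abbreviation cdom :: "('m, 'p, 'v, 'n::finite, 'k::finite) canon \<Rightarrow> 'p set"
  where "cdom b \<equiv> fst (tchart b)"

definition fibred_chart ::
    "('m::topological_space, 'p::topological_space, 'v, 'n::finite, 'k::finite) fibred_algebroid \<Rightarrow>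
     ('p, (real^'n) \<times> (real^'k)) chart \<Rightarrow> ('m, real^'n) chart \<Rightarrow> bool" where
  "fibred_chart K c c0 \<longleftrightarrow> c \<in> total_atlas K \<and> c0 \<in> base_atlas K \<and>
     (\<forall>m\<in>fst c. proj K m \<in> fst c0 \<and> fst (snd c m) = snd c0 (proj K m))"

definition canonical ::
    "('m::topological_space, 'p::topological_space, 'v::real_vector, 'n::finite, 'k::finite) fibred_algebroid \<Rightarrow>
     ('m, 'p, 'v, 'n, 'k) canon \<Rightarrow> bool" where
  "canonical K b \<longleftrightarrow> fibred_chart K (tchart b) (bchart b) \<and>
     (\<exists>W. local_frame (base_atlas K) (alg K) W (aframe b) \<and> proj K ` cdom b \<subseteq> W)"

definition ycoord :: "('p, (real^'n::finite) \<times> (real^'k::finite)) chart \<Rightarrow> 'k \<Rightarrow> 'p \<Rightarrow> real"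
  where "ycoord c \<alpha> m = snd (snd c m) $ \<alpha>"

definition anchor_coeff ::
    "('m, 'p, 'v, 'n::finite, 'k::finite) fibred_algebroid \<Rightarrow>
     ('m, 'p, 'v, 'n, 'k) canon \<Rightarrow> 'k \<Rightarrow> 'n \<Rightarrow> 'm \<Rightarrow> real" where
  "anchor_coeff K b \<alpha> i x = anchor K x (aframe b \<alpha> x) (\<lambda>q. snd (bchart b) q $ i)"

definition struct_coeff ::
    "('m, 'p, 'v::real_vector, 'n::finite, 'k::finite) fibred_algebroid \<Rightarrow>
     ('m, 'p, 'v, 'n, 'k) canon \<Rightarrow> 'k \<Rightarrow> 'k \<Rightarrow> 'k \<Rightarrow> 'm \<Rightarrow> real" where
  "struct_coeff K b \<alpha> \<beta> \<gamma> x =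
     frame_coeff (aframe b) x (bracket K (aframe b \<alpha>) (aframe b \<beta>) x) \<gamma>"

text \<open>\<open>Xc K b \<alpha>\<close> and \<open>Vc K c \<alpha>\<close> are the sections \<open>(e\<^sub>\<alpha>, \<rho>\<^sub>\<alpha>\<^sup>i \<partial>/\<partial>x\<^sup>i)\<close> and
  \<open>(0, \<partial>/\<partial>y\<^sup>\<alpha>)\<close> of the canonical basis.\<close>

definition Xc ::
    "('m, 'p::topological_space, 'v::real_vector, 'n::finite, 'k::finite) fibred_algebroid \<Rightarrow>
     ('m, 'p, 'v, 'n, 'k) canon \<Rightarrow> 'k \<Rightarrow> 'p \<Rightarrow> ('p, 'v) pvec" where
  "Xc K b \<alpha> m =
     (aframe b \<alpha> (proj K m),
      \<Sum>i\<in>UNIV. anchor_coeff K b \<alpha> i (proj K m) *\<^sub>R tvec (total_atlas K) (tchart b) m (axis i 1, 0))"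

definition Vc ::
    "('m, 'p::topological_space, 'v::real_vector, 'n::finite, 'k::finite) fibred_algebroid \<Rightarrow>
     ('p, (real^'n) \<times> (real^'k)) chart \<Rightarrow> 'k \<Rightarrow> 'p \<Rightarrow> ('p, 'v) pvec" where
  "Vc K c \<alpha> m = (0, tvec (total_atlas K) c m (0, axis \<alpha> 1))"

definition prol ::
    "('m::topological_space, 'p::topological_space, 'v::real_vector, 'n::finite, 'k::finite) fibred_algebroid \<Rightarrow>
     ('p, ('p, 'v) pvec, 'k + 'k) vbundle" where
  "prol K =
     \<lparr>fibre = prol_fibre K,
      frames = {(cdom b, case_sum (Xc K b) (Vc K (tchart b))) | b. canonical K b}\<rparr>"

definition vert ::
    "('m::topological_space, 'p::topological_space, 'v::real_vector, 'n::finite, 'k::finite) fibred_algebroid \<Rightarrow>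
     ('p, ('p, 'v) pvec, 'k) vbundle" where
  "vert K =
     \<lparr>fibre = (\<lambda>m. {w \<in> prol_fibre K m. fst w = 0}),
      frames = {(cdom b, Vc K (tchart b)) | b. canonical K b}\<rparr>"

abbreviation TT where "TT K \<equiv> fibre (prol K)"
abbreviation VV where "VV K \<equiv> fibre (vert K)"

type_synonym ('p, 'v) psection = "'p \<Rightarrow> ('p, 'v) pvec"
type_synonym ('p, 'v) pendo = "'p \<Rightarrow> ('p, 'v) pvec \<Rightarrow> ('p, 'v) pvec"
type_synonym ('p, 'v) pform = "'p \<Rightarrow> ('p, 'v) pvec \<Rightarrow> ('p, 'v) pvec \<Rightarrow> real"
type_synonym ('p, 'v) pbracket =
  "('p, 'v) psection \<Rightarrow> ('p, 'v) psection \<Rightarrow> ('p, 'v) psection"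

text \<open>The anchor of the prolongation is the second projection. The bracket is uniquely
  determined on local sections by the following conditions.\<close>

definition prolongation_bracket ::
    "('m::topological_space, 'p::topological_space, 'v::real_vector, 'n::finite, 'k::finite) fibred_algebroid \<Rightarrow>
     ('p, 'v) pbracket \<Rightarrow> bool" where
  "prolongation_bracket K P \<longleftrightarrow>
     almost_lie_bracket (total_atlas K) (prol K) (\<lambda>m w. snd w) P \<and>
     (\<forall>b. canonical K b \<longrightarrow> (\<forall>m\<in>cdom b. \<forall>\<alpha> \<beta>.
        P (Xc K b \<alpha>) (Xc K b \<beta>) m =
          (\<Sum>\<gamma>\<in>UNIV. struct_coeff K b \<alpha> \<beta> \<gamma> (proj K m) *\<^sub>R Xc K b \<gamma> m) \<and>
        P (Xc K b \<alpha>) (Vc K (tchart b) \<beta>) m = 0 \<and>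
        P (Vc K (tchart b) \<alpha>) (Vc K (tchart b) \<beta>) m = 0))"

definition lie_deriv_fun :: "('p, 'v) psection \<Rightarrow> ('p \<Rightarrow> real) \<Rightarrow> 'p \<Rightarrow> real" where
  "lie_deriv_fun X f m = snd (X m) f"

definition lie_deriv_endo ::
    "('p, 'v::real_vector) pbracket \<Rightarrow> ('p, 'v) psection \<Rightarrow> ('p, 'v) pendo \<Rightarrow>
     ('p, 'v) psection \<Rightarrow> ('p, 'v) psection" where
  "lie_deriv_endo P S I X m = P S (\<lambda>q. I q (X q)) m - I m (P S X m)"

section \<open>Almost tangent and almost cotangent structures, semisprays\<close>

definition almost_tangent ::
    "('m::topological_space, 'p::topological_space, 'v::real_vector, 'n::finite, 'k::finite) fibred_algebroid \<Rightarrow>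
     ('p, 'v) pendo \<Rightarrow> bool" where
  "almost_tangent K J \<longleftrightarrow> J \<in> endomorphisms (total_atlas K) (prol K) \<and>
     (\<forall>m. J m ` TT K m = VV K m \<and> {w \<in> TT K m. J m w = 0} = VV K m)"

definition lagrangian_subspace :: "'w set \<Rightarrow> ('w \<Rightarrow> 'w \<Rightarrow> real) \<Rightarrow> 'w set \<Rightarrow> bool" where
  "lagrangian_subspace T \<omega> L \<longleftrightarrow> L = {w \<in> T. \<forall>u\<in>L. \<omega> w u = 0}"

definition almost_cotangent ::
    "('m::topological_space, 'p::topological_space, 'v::real_vector, 'n::finite, 'k::finite) fibred_algebroid \<Rightarrow>
     ('p, 'v) pform \<Rightarrow> bool" where
  "almost_cotangent K \<Omega> \<longleftrightarrow> bilinear_form (total_atlas K) (prol K) \<Omega> \<and>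
     (\<forall>m. \<forall>w\<in>TT K m. \<forall>w'\<in>TT K m. \<Omega> m w w' = - \<Omega> m w' w) \<and>
     (\<forall>m. \<forall>w\<in>TT K m. (\<forall>w'\<in>TT K m. \<Omega> m w w' = 0) \<longrightarrow> w = 0) \<and>
     (\<forall>m. lagrangian_subspace (TT K m) (\<Omega> m) (VV K m))"

definition compatible ::
    "('m::topological_space, 'p::topological_space, 'v::real_vector, 'n::finite, 'k::finite) fibred_algebroid \<Rightarrow>
     ('p, 'v) pendo \<Rightarrow> ('p, 'v) pform \<Rightarrow> bool" where
  "compatible K J \<Omega> \<longleftrightarrow>
     (\<forall>m. \<forall>w\<in>TT K m. \<forall>w'\<in>TT K m. \<Omega> m (J m w) w' + \<Omega> m w (J m w') = 0)"

text \<open>The metric \<open>g\<close> on the vertical bundle with \<open>g (J Z, Y) = \<Omega> (Z, Y)\<close>.\<close>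

definition vertical_metric ::
    "('m::topological_space, 'p::topological_space, 'v::real_vector, 'n::finite, 'k::finite) fibred_algebroid \<Rightarrow>
     ('p, 'v) pendo \<Rightarrow> ('p, 'v) pform \<Rightarrow> ('p, 'v) pform" where
  "vertical_metric K J \<Omega> = (\<lambda>m. \<lambda>u\<in>VV K m. \<lambda>y\<in>VV K m.
     THE r. \<exists>z\<in>TT K m. J m z = u \<and> r = \<Omega> m z y)"

definition semispray ::
    "('m::topological_space, 'p::topological_space, 'v::real_vector, 'n::finite, 'k::finite) fibred_algebroid \<Rightarrow>
     ('p, 'v) pbracket \<Rightarrow> ('p, 'v) psection \<Rightarrow> bool" where
  "semispray K P S \<longleftrightarrow> smooth_section (total_atlas K) (prol K) UNIV S \<and>
     (\<forall>U V. local_frame (total_atlas K) (vert K) U V \<longrightarrow>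
        (\<forall>m\<in>U. span (range (\<lambda>\<alpha>. V \<alpha> m) \<union> range (\<lambda>\<alpha>. P S (V \<alpha>) m)) = TT K m))"

definition associated_tangent ::
    "('m::topological_space, 'p::topological_space, 'v::real_vector, 'n::finite, 'k::finite) fibred_algebroid \<Rightarrow>
     ('p, 'v) pbracket \<Rightarrow> ('p, 'v) psection \<Rightarrow> ('p, 'v) pendo \<Rightarrow> bool" where
  "associated_tangent K P S J \<longleftrightarrow> almost_tangent K J \<and>
     (\<forall>U V. smooth_section (total_atlas K) (vert K) U V \<longrightarrow> (\<forall>m\<in>U. J m (P S V m) = - V m))"

text \<open>The coefficient of \<open>S\<close> along \<open>Vc\<close>, that is \<open>S\<^sup>\<beta>\<close> in \<open>S = y\<^sup>\<alpha> X\<^sub>\<alpha> + S\<^sup>\<beta> V\<^sub>\<beta>\<close>.\<close>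

definition spray_coeff ::
    "('m, 'p::topological_space, 'v::real_vector, 'n::finite, 'k::finite) fibred_algebroid \<Rightarrow>
     ('p, 'v) psection \<Rightarrow> ('m, 'p, 'v, 'n, 'k) canon \<Rightarrow> 'k \<Rightarrow> 'p \<Rightarrow> real" where
  "spray_coeff K S b \<beta> m =
     frame_coeff (case_sum (Xc K b) (Vc K (tchart b))) m (S m) (Inr \<beta>)"

definition adapted ::
    "('m::topological_space, 'p::topological_space, 'v::real_vector, 'n::finite, 'k::finite) fibred_algebroid \<Rightarrow>
     ('p, 'v) psection \<Rightarrow> ('p, 'v) pendo \<Rightarrow> ('m, 'p, 'v, 'n, 'k) canon \<Rightarrow> bool" where
  "adapted K S J b \<longleftrightarrow> canonical K b \<and>
     (\<forall>m\<in>cdom b.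
        (\<forall>\<alpha>. J m (Xc K b \<alpha> m) = Vc K (tchart b) \<alpha> m) \<and>
        S m = (\<Sum>\<alpha>\<in>UNIV. ycoord (tchart b) \<alpha> m *\<^sub>R Xc K b \<alpha> m) +
              (\<Sum>\<beta>\<in>UNIV. spray_coeff K S b \<beta> m *\<^sub>R Vc K (tchart b) \<beta> m))"

definition linear_fibration_atlas ::
    "('m::topological_space, 'p::topological_space, 'v::real_vector, 'n::finite, 'k::finite) fibred_algebroid \<Rightarrow>
     ('p, 'v) psection \<Rightarrow> ('p, (real^'n) \<times> (real^'k)) chart set" where
  "linear_fibration_atlas K C =
     {c. (\<exists>c0. fibred_chart K c c0) \<and>
         (\<forall>m\<in>fst c. C m = (\<Sum>\<alpha>\<in>UNIV. ycoord c \<alpha> m *\<^sub>R Vc K c \<alpha> m))}"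

definition omega_coeff ::
    "('m, 'p::topological_space, 'v::real_vector, 'n::finite, 'k::finite) fibred_algebroid \<Rightarrow>
     ('p, 'v) pform \<Rightarrow> ('m, 'p, 'v, 'n, 'k) canon \<Rightarrow> 'k \<Rightarrow> 'k \<Rightarrow> 'p \<Rightarrow> real" where
  "omega_coeff K \<Omega> b \<alpha> \<beta> m = \<Omega> m (Xc K b \<alpha> m) (Xc K b \<beta> m)"

definition metric_coeff ::
    "('m, 'p::topological_space, 'v::real_vector, 'n::finite, 'k::finite) fibred_algebroid \<Rightarrow>
     ('p, 'v) pform \<Rightarrow> ('m, 'p, 'v, 'n, 'k) canon \<Rightarrow> 'k \<Rightarrow> 'k \<Rightarrow> 'p \<Rightarrow> real" where
  "metric_coeff K \<Omega> b \<alpha> \<beta> m = \<Omega> m (Xc K b \<alpha> m) (Vc K (tchart b) \<beta> m)"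

section \<open>Nonlinear connections\<close>

definition nonlinear_connection ::
    "('m::topological_space, 'p::topological_space, 'v::real_vector, 'n::finite, 'k::finite) fibred_algebroid \<Rightarrow>
     ('p, 'v) pendo \<Rightarrow> bool" where
  "nonlinear_connection K N \<longleftrightarrow> N \<in> endomorphisms (total_atlas K) (prol K) \<and>
     (\<forall>m. (\<forall>w\<in>TT K m. N m (N m w) = w) \<and> {w \<in> TT K m. w + N m w = 0} = VV K m)"

definition horizontal ::
    "('m::topological_space, 'p::topological_space, 'v::real_vector, 'n::finite, 'k::finite) fibred_algebroid \<Rightarrow>
     ('p, 'v) pendo \<Rightarrow> 'p \<Rightarrow> ('p, 'v) pvec set" where
  "horizontal K N m = {w \<in> TT K m. w - N m w = 0}"

definition hproj :: "('p, 'v::real_vector) pendo \<Rightarrow> ('p, 'v) pendo"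
  where "hproj N m w = (1/2) *\<^sub>R (w + N m w)"

definition vproj :: "('p, 'v::real_vector) pendo \<Rightarrow> ('p, 'v) pendo"
  where "vproj N m w = (1/2) *\<^sub>R (w - N m w)"

text \<open>The coefficients in \<open>h (X\<^sub>\<alpha>) = X\<^sub>\<alpha> - N\<^sub>\<alpha>\<^sup>\<beta> V\<^sub>\<beta>\<close>.\<close>

definition conn_coeff ::
    "('m, 'p::topological_space, 'v::real_vector, 'n::finite, 'k::finite) fibred_algebroid \<Rightarrow>
     ('p, 'v) pendo \<Rightarrow> ('m, 'p, 'v, 'n, 'k) canon \<Rightarrow> 'k \<Rightarrow> 'k \<Rightarrow> 'p \<Rightarrow> real" where
  "conn_coeff K N b \<alpha> \<beta> m =
     frame_coeff (case_sum (Xc K b) (Vc K (tchart b))) m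
       (Xc K b \<alpha> m - hproj N m (Xc K b \<alpha> m)) (Inr \<beta>)"

definition canonical_connection ::
    "('m::topological_space, 'p::topological_space, 'v::real_vector, 'n::finite, 'k::finite) fibred_algebroid \<Rightarrow>
     ('p, 'v) pbracket \<Rightarrow> ('p, 'v) psection \<Rightarrow> ('p, 'v) pendo \<Rightarrow> ('p, 'v) pendo" where
  "canonical_connection K P S J =
     endo_of_operator (total_atlas K) (prol K) (\<lambda>X m. - lie_deriv_endo P S J X m)"

definition horizontal_lift ::
    "('m::topological_space, 'p::topological_space, 'v::real_vector, 'n::finite, 'k::finite) fibred_algebroid \<Rightarrow>
     ('p, 'v) pbracket \<Rightarrow> ('p, 'v) psection \<Rightarrow> ('p, 'v) pendo \<Rightarrow> ('p, 'v) pendo" where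
  "horizontal_lift K P S J m =
     the_inv_into (horizontal K (canonical_connection K P S J) m) (J m)"

definition lagrangian_connection ::
    "('m::topological_space, 'p::topological_space, 'v::real_vector, 'n::finite, 'k::finite) fibred_algebroid \<Rightarrow>
     ('p, 'v) pform \<Rightarrow> ('p, 'v) pendo \<Rightarrow> bool" where
  "lagrangian_connection K \<Omega> N \<longleftrightarrow>
     (\<forall>m. lagrangian_subspace (TT K m) (\<Omega> m) (horizontal K N m))"

definition dyn_deriv ::
    "('p, 'v::real_vector) pbracket \<Rightarrow> ('p, 'v) psection \<Rightarrow> ('p, 'v) pendo \<Rightarrow>
     ('p, 'v) psection \<Rightarrow> ('p, 'v) psection" where
  "dyn_deriv P S N X m = vproj N m (P S X m)"

definition dyn_deriv_metric ::
    "('p, 'v::real_vector) pbracket \<Rightarrow> ('p, 'v) psection \<Rightarrow> ('p, 'v) pendo \<Rightarrow> ('p, 'v) pform \<Rightarrow>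
     ('p, 'v) psection \<Rightarrow> ('p, 'v) psection \<Rightarrow> 'p \<Rightarrow> real" where
  "dyn_deriv_metric P S N g X X' m =
     lie_deriv_fun S (\<lambda>q. g q (X q) (X' q)) m
     - g m (dyn_deriv P S N X m) (X' m) - g m (X m) (dyn_deriv P S N X' m)"

definition metric_connection ::
    "('m::topological_space, 'p::topological_space, 'v::real_vector, 'n::finite, 'k::finite) fibred_algebroid \<Rightarrow>
     ('p, 'v) pbracket \<Rightarrow> ('p, 'v) psection \<Rightarrow> ('p, 'v) pform \<Rightarrow> ('p, 'v) pendo \<Rightarrow> bool" where
  "metric_connection K P S g N \<longleftrightarrow>
     (\<forall>U X X'. smooth_section (total_atlas K) (vert K) U X \<and>
               smooth_section (total_atlas K) (vert K) U X' \<longrightarrow>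
        (\<forall>m\<in>U. dyn_deriv_metric P S N g X X' m = 0))"

definition g2 ::
    "('m::topological_space, 'p::topological_space, 'v::real_vector, 'n::finite, 'k::finite) fibred_algebroid \<Rightarrow>
     ('p, 'v) pform \<Rightarrow> ('p, 'v) pendo \<Rightarrow> ('p, 'v) pform" where
  "g2 K g \<Delta> = (\<lambda>m. \<lambda>u\<in>VV K m. \<lambda>u'\<in>VV K m. g m (\<Delta> m u) u')"

definition g2_inv ::
    "('m::topological_space, 'p::topological_space, 'v::real_vector, 'n::finite, 'k::finite) fibred_algebroid \<Rightarrow>
     ('p, 'v) pform \<Rightarrow> ('p, 'v) pform \<Rightarrow> ('p, 'v) pendo" where
  "g2_inv K g = the_inv_into (endomorphisms (total_atlas K) (vert K)) (g2 K g)"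

text \<open>The form \<open>D g + \<Omega>(H \<cdot>, H \<cdot>)\<close> on the vertical bundle, where \<open>D\<close> and \<open>H\<close> are the dynamical
  derivation and the horizontal lift of the canonical connection \<open>N\<^sub>S\<close>. If \<open>N\<close> is Lagrangian and
  metric, its components in an adapted basis are \<open>2 g\<^sub>\<beta>\<^sub>\<gamma> ((N\<^sub>S)\<^sub>\<alpha>\<^sup>\<gamma> - N\<^sub>\<alpha>\<^sup>\<gamma>)\<close>. As
  \<open>N X\<^sub>\<alpha> - N\<^sub>S X\<^sub>\<alpha> = 2 ((N\<^sub>S)\<^sub>\<alpha>\<^sup>\<gamma> - N\<^sub>\<alpha>\<^sup>\<gamma>) V\<^sub>\<gamma>\<close>, this gives
  \<open>N = N\<^sub>S + (g\<^sup>2)\<^sup>-\<^sup>1 [D g + \<Omega>(H \<cdot>, H \<cdot>)] \<circ> J\<close>; the factor \<open>-2\<close> in front of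
  \<open>(g\<^sup>2)\<^sup>-\<^sup>1\<close> that also appears in the literature is not compatible with these conventions.\<close>

definition defect_form ::
    "('m::topological_space, 'p::topological_space, 'v::real_vector, 'n::finite, 'k::finite) fibred_algebroid \<Rightarrow>
     ('p, 'v) pbracket \<Rightarrow> ('p, 'v) psection \<Rightarrow> ('p, 'v) pendo \<Rightarrow> ('p, 'v) pform \<Rightarrow> ('p, 'v) pform" where
  "defect_form K P S J \<Omega> =
     form_of_operator (total_atlas K) (vert K)
       (\<lambda>X X' m.
          dyn_deriv_metric P S (canonical_connection K P S J) (vertical_metric K J \<Omega>) X X' m
          + \<Omega> m (horizontal_lift K P S J m (X m)) (horizontal_lift K P S J m (X' m)))"

end

theory Submission
  imports Defs
begin

text \<open>In an adapted canonical basis write \<open>G\<^sub>\<alpha>\<^sub>\<beta> = g\<^sub>\<beta>\<^sub>\<gamma> N\<^sub>\<alpha>\<^sup>\<gamma>\<close>. Then \<open>N\<close> is Lagrangian iff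
  \<open>\<omega>\<^sub>\<alpha>\<^sub>\<beta> + G\<^sub>\<alpha>\<^sub>\<beta> - G\<^sub>\<beta>\<^sub>\<alpha> = 0\<close>, which prescribes the skew part of \<open>G\<close>, and metric iff
  \<open>S(g\<^sub>\<alpha>\<^sub>\<beta>) + G\<^sub>\<alpha>\<^sub>\<beta> + G\<^sub>\<beta>\<^sub>\<alpha> + g\<^sub>\<beta>\<^sub>\<gamma> \<partial>S\<^sup>\<gamma>/\<partial>y\<^sup>\<alpha> + g\<^sub>\<alpha>\<^sub>\<gamma> \<partial>S\<^sup>\<gamma>/\<partial>y\<^sup>\<beta> = 0\<close>, which prescribes its symmetric
  part; as \<open>g\<close> is nondegenerate, the two conditions together determine \<open>N\<close>. For
  \<open>N\<^sub>S\<close>, where \<open>N\<^sub>\<alpha>\<^sup>\<gamma> = -(1/2) (\<partial>S\<^sup>\<gamma>/\<partial>y\<^sup>\<alpha> - y\<^sup>\<mu> C\<^sub>\<alpha>\<^sub>\<mu>\<^sup>\<gamma>)\<close>, the sum of the two left-hand sides is the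
  defect form, so that correcting \<open>N\<^sub>S\<close> by it gives the solution globally.\<close>

section \<open>Smooth maps between Euclidean spaces\<close>

text \<open>The coefficient 1 of the correction comes from two factors 2 that cancel. Since N = 2h -
  Id, N X_\<alpha> = X_\<alpha> - 2 N_\<alpha>^\<gamma> V_\<gamma>, so adding E o J with E vertical
  lowers G by half of g(E V_\<alpha>, V_\<beta>). For N_S the two left-hand sides add up to 2 (G -
  R), with R the right-hand side of the coefficient formula. Two obstacles shape the development.
  The fibre coordinates of an adapted basis must be components of S itself, so around each point a
  new chart has to be built, with smooth inverse, and recognised as a member of the maximal atlas.
  Moreover N_S and the defect form are definite descriptions over all local sections through given
  vectors. Sections with constant coefficients in an adapted basis show that a value exists; a local
  formula in which the derivatives of the components cancel shows that it is unique. Whatever solves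
  a pointwise linear system (derivatives of inverse maps, coefficients in a new frame, the
  correction) is smooth by Cramer's rule.\<close>

lemma frechet_derivative_cong_open:
  assumes "open S" "x \<in> S" "\<And>y. y \<in> S \<Longrightarrow> f y = g y"
  shows "frechet_derivative f (at x) = frechet_derivative g (at x)"
proof -
  \<comment> \<open>\<open>frechet_derivative\<close> is a choice among derivatives, so it suffices
    that both maps have the same candidates. This covers non-differentiable maps too.\<close>
  have "(f has_derivative f') (at x) \<longleftrightarrow> (g has_derivative f') (at x)" for f'
    using assms has_derivative_transform_within_open[of f f' x UNIV S g]
      has_derivative_transform_within_open[of g f' x UNIV S f] by auto
  then show ?thesis by (simp add: frechet_derivative_def)
qed

lemma differentiable_cong_open:
  assumes "open S" "x \<in> S" "\<And>y. y \<in> S \<Longrightarrow> f y = g y" "f differentiable (at x)"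
  shows "g differentiable (at x)"
  using assms has_derivative_transform_within_open[of f _ x UNIV S g]
  unfolding differentiable_def by blast

lemma ck_on_cong:
  assumes "open S" "\<And>x. x \<in> S \<Longrightarrow> f x = g x" "ck_on k S f"
  shows "ck_on k S g"
  using assms(2,3)
proof (induction k arbitrary: f g)
  case 0
  then show ?case by (simp cong: continuous_on_cong)
next
  case (Suc k)
  have *: "frechet_derivative f (at x) = frechet_derivative g (at x)" if "x \<in> S" for x
    using frechet_derivative_cong_open[OF assms(1) that] Suc.prems(1) by blast
  have "ck_on k S (\<lambda>x. frechet_derivative g (at x) v)" for v
    using Suc.IH[of "\<lambda>x. frechet_derivative f (at x) v"] Suc.prems(2) * by simp
  moreover have "g differentiable (at x)" if "x \<in> S" for x
    using differentiable_cong_open[OF assms(1) that, of f g] Suc.prems that by auto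
  ultimately show ?case by simp
qed

text \<open>Lets the derivative be given by any convenient formula \<open>f'\<close>; uniqueness of
  derivatives identifies it with \<open>frechet_derivative\<close> on the open set.\<close>

lemma ck_on_SucI:
  assumes "open S" "\<And>x. x \<in> S \<Longrightarrow> (f has_derivative f' x) (at x)"
    "\<And>v. ck_on k S (\<lambda>x. f' x v)"
  shows "ck_on (Suc k) S f"
proof -
  have "f' x = frechet_derivative f (at x)" if "x \<in> S" for x
    using assms(2)[OF that] by (rule frechet_derivative_at)
  then have "ck_on k S (\<lambda>x. frechet_derivative f (at x) v)" for v
    using ck_on_cong[OF assms(1) _ assms(3)[of v], of "\<lambda>x. frechet_derivative f (at x) v"] by simp
  then show ?thesis using assms(2) by (auto simp: differentiable_def)
qed

lemma ck_on_SucD: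
  assumes "ck_on (Suc k) S f" "x \<in> S"
  shows "(f has_derivative frechet_derivative f (at x)) (at x)"
  using assms frechet_derivative_works by (metis ck_on.simps(2))

lemma ck_on_decr: "ck_on (Suc k) S f \<Longrightarrow> ck_on k S f"
proof (induction k arbitrary: f)
  case 0
  then show ?case
    by (simp add: continuous_at_imp_continuous_on differentiable_imp_continuous_within)
next
  case (Suc k)
  have "ck_on k S (\<lambda>x. frechet_derivative f (at x) v)" for v
    using Suc.IH Suc.prems by (metis ck_on.simps(2))
  then show ?case using Suc.prems by simp
qed

lemma ck_on_continuous: "ck_on k S f \<Longrightarrow> continuous_on S f"
proof (induction k arbitrary: f)
  case (Suc k)
  then show ?case using ck_on_decr by blast
qed simp

lemma ck_on_subset: "ck_on k S f \<Longrightarrow> T \<subseteq> S \<Longrightarrow> ck_on k T f"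
  by (induction k arbitrary: f) (auto intro: continuous_on_subset)

lemma ck_on_local:
  assumes "\<And>x. x \<in> S \<Longrightarrow> \<exists>T. open T \<and> x \<in> T \<and> ck_on k T f"
  shows "ck_on k S f"
  using assms
proof (induction k arbitrary: f)
  case 0
  have "continuous (at x) f" if "x \<in> S" for x
    using 0[OF that] by (auto simp: continuous_on_eq_continuous_at)
  then show ?case by (simp add: continuous_at_imp_continuous_on)
next
  case (Suc k)
  have "f differentiable (at x)" if "x \<in> S" for x using Suc.prems[OF that] by auto
  moreover have "ck_on k S (\<lambda>x. frechet_derivative f (at x) v)" for v
    using Suc.IH[of "\<lambda>x. frechet_derivative f (at x) v"] Suc.prems by fastforce
  ultimately show ?case by simp
qed

lemma ck_on_const: "open S \<Longrightarrow> ck_on k S (\<lambda>x. c)"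
proof (induction k arbitrary: c)
  case (Suc k)
  show ?case by (rule ck_on_SucI[OF Suc.prems has_derivative_const]) (simp add: Suc)
qed simp

lemma ck_on_bounded_linear:
  assumes "bounded_linear L" "open S" "ck_on k S f"
  shows "ck_on k S (\<lambda>x. L (f x))"
  using assms(3)
proof (induction k arbitrary: f)
  case 0
  then show ?case using bounded_linear.continuous_on[OF assms(1)] by simp
next
  case (Suc k)
  show ?case
    by (rule ck_on_SucI[OF assms(2) bounded_linear.has_derivative[OF assms(1) ck_on_SucD[OF Suc.prems]]])
      (use Suc in auto)
qed

lemma ck_on_ident: "open S \<Longrightarrow> ck_on k S (\<lambda>x. x)"
proof (cases k)
  case (Suc j)
  show "open S \<Longrightarrow> ck_on k S (\<lambda>x. x)"
    unfolding Suc by (rule ck_on_SucI[OF _ has_derivative_ident]) (simp_all add: ck_on_const)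
qed simp

lemma ck_on_add:
  assumes "open S" "ck_on k S f" "ck_on k S g"
  shows "ck_on k S (\<lambda>x. f x + g x)"
  using assms(2,3)
proof (induction k arbitrary: f g)
  case 0
  then show ?case by (simp add: continuous_on_add)
next
  case (Suc k)
  show ?case
    by (rule ck_on_SucI[OF assms(1) has_derivative_add[OF ck_on_SucD[OF Suc.prems(1)] ck_on_SucD[OF Suc.prems(2)]]])
      (use Suc in auto)
qed

lemma ck_on_sum:
  assumes "open S" "\<And>i. i \<in> I \<Longrightarrow> ck_on k S (f i)"
  shows "ck_on k S (\<lambda>x. \<Sum>i\<in>I. f i x)"
  using assms(2)
  by (induction I rule: infinite_finite_induct) (auto intro: ck_on_const ck_on_add assms(1))

lemma ck_on_bilinear:
  assumes "bounded_bilinear B" "open S" "ck_on k S f" "ck_on k S g"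
  shows "ck_on k S (\<lambda>x. B (f x) (g x))"
  using assms(3,4)
proof (induction k arbitrary: f g)
  case 0
  then show ?case using bounded_bilinear.continuous_on[OF assms(1)] by simp
next
  case (Suc k)
  show ?case
  proof (rule ck_on_SucI[OF assms(2) bounded_bilinear.FDERIV[OF assms(1) ck_on_SucD[OF Suc.prems(1)] ck_on_SucD[OF Suc.prems(2)]]])
    fix v
    show "ck_on k S (\<lambda>x. B (f x) (frechet_derivative g (at x) v) + B (frechet_derivative f (at x) v) (g x))"
      using Suc.prems by (intro ck_on_add Suc.IH assms(2)) (auto intro: ck_on_decr)
  qed
qed

lemmas ck_on_mult = ck_on_bilinear[OF bounded_bilinear_mult]
lemmas ck_on_scaleR = ck_on_bilinear[OF bounded_bilinear_scaleR]

lemma ck_on_prod: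
  fixes f :: "'i \<Rightarrow> 'a::real_normed_vector \<Rightarrow> real"
  assumes "open S" "\<And>i. i \<in> I \<Longrightarrow> ck_on k S (f i)"
  shows "ck_on k S (\<lambda>x. \<Prod>i\<in>I. f i x)"
  using assms(2)
  by (induction I rule: infinite_finite_induct) (auto intro: ck_on_const ck_on_mult assms(1))

lemma ck_on_inverse:
  fixes f :: "'a::real_normed_vector \<Rightarrow> real"
  assumes "open S" "ck_on k S f" "\<And>x. x \<in> S \<Longrightarrow> f x \<noteq> 0"
  shows "ck_on k S (\<lambda>x. inverse (f x))"
  using assms(2)
proof (induction k)
  case 0
  then show ?case using assms(3) by (auto intro!: continuous_on_inverse)
next
  case (Suc k)
  have "ck_on k S (\<lambda>x. inverse (f x))" using Suc ck_on_decr by blast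
  moreover have "ck_on k S (\<lambda>x. frechet_derivative f (at x) v)" for v using Suc.prems by simp
  ultimately show ?case
    by (intro ck_on_SucI[OF assms(1) Deriv.has_derivative_inverse[OF assms(3) ck_on_SucD[OF Suc.prems]]]
        ck_on_bounded_linear[OF bounded_linear_minus[OF bounded_linear_ident]] ck_on_mult assms(1)) auto
qed

text \<open>The chain rule applies a linear map depending on the point to a vector depending on the
  point. Expanding that vector over \<open>Basis\<close> turns this into a finite sum of products of
  functions known to be of class C^k, which is why the middle space is Euclidean.\<close>

lemma ck_on_compose:
  fixes f :: "'a::real_normed_vector \<Rightarrow> 'b::euclidean_space"
  assumes "open S" "open T" "ck_on k S f" "ck_on k T g" "f ` S \<subseteq> T"
  shows "ck_on k S (\<lambda>x. g (f x))"
  using assms(3,4)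
proof (induction k arbitrary: g)
  case 0
  then show ?case using continuous_on_compose2[of T g S f] assms(5) by simp
next
  case (Suc k)
  have der: "((\<lambda>x. g (f x)) has_derivative
      (\<lambda>v. \<Sum>b\<in>Basis. (frechet_derivative f (at x) v \<bullet> b) *\<^sub>R frechet_derivative g (at (f x)) b)) (at x)"
    if "x \<in> S" for x
  proof -
    have g: "(g has_derivative frechet_derivative g (at (f x))) (at (f x))"
      using ck_on_SucD[OF Suc.prems(2)] assms(5) that by auto
    then have lin: "linear (frechet_derivative g (at (f x)))" by (simp add: has_derivative_linear)
    have "frechet_derivative g (at (f x)) w = (\<Sum>b\<in>Basis. (w \<bullet> b) *\<^sub>R frechet_derivative g (at (f x)) b)" for w
    proof -
      have "frechet_derivative g (at (f x)) (\<Sum>b\<in>Basis. (w \<bullet> b) *\<^sub>R b)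
          = (\<Sum>b\<in>Basis. (w \<bullet> b) *\<^sub>R frechet_derivative g (at (f x)) b)"
        by (simp add: linear_sum[OF lin] linear_scale[OF lin])
      then show ?thesis by (simp add: euclidean_representation)
    qed
    then have "(\<lambda>v. frechet_derivative g (at (f x)) (frechet_derivative f (at x) v)) =
        (\<lambda>v. \<Sum>b\<in>Basis. (frechet_derivative f (at x) v \<bullet> b) *\<^sub>R frechet_derivative g (at (f x)) b)"
      by (rule ext)
    then show ?thesis
      using has_derivative_compose[OF ck_on_SucD[OF Suc.prems(1) that] g] by simp
  qed
  show ?case
  proof (rule ck_on_SucI[OF assms(1) der])
    fix v
    have *: "ck_on k S (\<lambda>x. frechet_derivative g (at (f x)) b)" for b
      using Suc.IH[of "\<lambda>y. frechet_derivative g (at y) b"] Suc.prems ck_on_decr by (metis ck_on.simps(2))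
    have **: "ck_on k S (\<lambda>x. frechet_derivative f (at x) v)" using Suc.prems by simp
    have "ck_on k S (\<lambda>x. (frechet_derivative f (at x) v \<bullet> b) *\<^sub>R frechet_derivative g (at (f x)) b)" for b
      using ck_on_scaleR[OF assms(1) ck_on_bounded_linear[OF bounded_linear_inner_left assms(1) **] *] .
    then show "ck_on k S (\<lambda>x. \<Sum>b\<in>Basis. (frechet_derivative f (at x) v \<bullet> b) *\<^sub>R frechet_derivative g (at (f x)) b)"
      by (intro ck_on_sum assms(1))
  qed auto
qed

lemma ck_on_Pair:
  assumes "open S" "ck_on k S f" "ck_on k S g"
  shows "ck_on k S (\<lambda>x. (f x, g x))"
  using ck_on_add[OF assms(1) ck_on_bounded_linear[OF bounded_linear_Pair[OF bounded_linear_ident bounded_linear_zero] assms(1,2)]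
      ck_on_bounded_linear[OF bounded_linear_Pair[OF bounded_linear_zero bounded_linear_ident] assms(1,3)]]
  by simp

lemma ck_on_vec:
  fixes f :: "'a::real_normed_vector \<Rightarrow> real^'n"
  assumes "open S" "\<And>i. ck_on k S (\<lambda>x. f x $ i)"
  shows "ck_on k S f"
proof -
  have "ck_on k S (\<lambda>x. \<Sum>i\<in>UNIV. (f x $ i) *\<^sub>R axis i (1::real))"
    by (intro ck_on_sum ck_on_scaleR assms ck_on_const)
  moreover have "(\<Sum>i\<in>UNIV. (f x $ i) *\<^sub>R axis i (1::real)) = f x" for x
    using basis_expansion[of "f x"] by (simp add: scalar_mult_eq_scaleR)
  ultimately show ?thesis by simp
qed

lemma ck_on_det:
  fixes G :: "'a::real_normed_vector \<Rightarrow> real^'n^'n"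
  assumes "open S" "\<And>i j. ck_on k S (\<lambda>x. G x $ i $ j)"
  shows "ck_on k S (\<lambda>x. det (G x))"
  unfolding det_def by (intro ck_on_sum ck_on_mult ck_on_prod assms ck_on_const)

text \<open>Cramer's rule expresses the solution of a linear system rationally in its entries.\<close>

lemma ck_on_linear_system:
  fixes G :: "'a::real_normed_vector \<Rightarrow> real^'n^'n" and z r :: "'a \<Rightarrow> real^'n"
  assumes S: "open S" and G: "\<And>i j. ck_on k S (\<lambda>x. G x $ i $ j)" and r: "\<And>i. ck_on k S (\<lambda>x. r x $ i)"
    and det: "\<And>x. x \<in> S \<Longrightarrow> det (G x) \<noteq> 0" and eq: "\<And>x. x \<in> S \<Longrightarrow> G x *v z x = r x"
  shows "ck_on k S z"
proof (rule ck_on_vec[OF S])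
  fix l
  have "ck_on k S (\<lambda>x. det (\<chi> i j. if j = l then r x $ i else G x $ i $ j) * inverse (det (G x)))"
  proof (intro ck_on_mult ck_on_inverse ck_on_det S G det)
    show "ck_on k S (\<lambda>x. (\<chi> i j. if j = l then r x $ i else G x $ i $ j) $ i $ j)" for i j
      using r G by (cases "j = l") auto
  qed
  moreover have "det (\<chi> i j. if j = l then r x $ i else G x $ i $ j) * inverse (det (G x)) = z x $ l"
    if "x \<in> S" for x
    using cramer[OF det[OF that]] eq[OF that] by (auto simp: divide_inverse)
  ultimately show "ck_on k S (\<lambda>x. z x $ l)" by (rule ck_on_cong[OF S, rotated]) auto
qed

section \<open>Smooth maps\<close>

lemma smooth_on_cong: "open S \<Longrightarrow> (\<And>x. x \<in> S \<Longrightarrow> f x = g x) \<Longrightarrow> smooth_on S f \<Longrightarrow> smooth_on S g"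
  unfolding smooth_on_def using ck_on_cong by blast

lemma smooth_on_subset: "smooth_on S f \<Longrightarrow> T \<subseteq> S \<Longrightarrow> smooth_on T f"
  unfolding smooth_on_def using ck_on_subset by blast

lemma smooth_on_local:
  assumes "\<And>x. x \<in> S \<Longrightarrow> \<exists>T. open T \<and> x \<in> T \<and> smooth_on T f"
  shows "smooth_on S f"
  unfolding smooth_on_def
proof
  show "ck_on k S f" for k
    using assms by (intro ck_on_local) (meson smooth_on_def)
qed

lemma smooth_on_const: "open S \<Longrightarrow> smooth_on S (\<lambda>x. c)"
  by (simp add: smooth_on_def ck_on_const)

lemma smooth_on_ident: "open S \<Longrightarrow> smooth_on S (\<lambda>x. x)"
  by (simp add: smooth_on_def ck_on_ident)

lemma smooth_on_bounded_linear:
  "bounded_linear L \<Longrightarrow> open S \<Longrightarrow> smooth_on S f \<Longrightarrow> smooth_on S (\<lambda>x. L (f x))"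
  by (simp add: smooth_on_def ck_on_bounded_linear)

lemma smooth_on_add: "open S \<Longrightarrow> smooth_on S f \<Longrightarrow> smooth_on S g \<Longrightarrow> smooth_on S (\<lambda>x. f x + g x)"
  by (simp add: smooth_on_def ck_on_add)

lemma smooth_on_mult:
  fixes f g :: "'a::real_normed_vector \<Rightarrow> real"
  shows "open S \<Longrightarrow> smooth_on S f \<Longrightarrow> smooth_on S g \<Longrightarrow> smooth_on S (\<lambda>x. f x * g x)"
  by (simp add: smooth_on_def ck_on_mult)

lemma smooth_on_compose:
  fixes f :: "'a::real_normed_vector \<Rightarrow> 'b::euclidean_space"
  shows "open S \<Longrightarrow> open T \<Longrightarrow> smooth_on S f \<Longrightarrow> smooth_on T g \<Longrightarrow> f ` S \<subseteq> T
    \<Longrightarrow> smooth_on S (\<lambda>x. g (f x))"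
  by (simp add: smooth_on_def ck_on_compose)

lemma smooth_on_Pair: "open S \<Longrightarrow> smooth_on S f \<Longrightarrow> smooth_on S g \<Longrightarrow> smooth_on S (\<lambda>x. (f x, g x))"
  by (simp add: smooth_on_def ck_on_Pair)

lemma smooth_on_vec:
  fixes f :: "'a::real_normed_vector \<Rightarrow> real^'n"
  shows "open S \<Longrightarrow> (\<And>i. smooth_on S (\<lambda>x. f x $ i)) \<Longrightarrow> smooth_on S f"
  by (simp add: smooth_on_def ck_on_vec)

lemma smooth_on_frechet_derivative:
  "smooth_on S f \<Longrightarrow> smooth_on S (\<lambda>x. frechet_derivative f (at x) v)"
  unfolding smooth_on_def by (metis ck_on.simps(2))

lemma smooth_on_has_derivative:
  "smooth_on S f \<Longrightarrow> x \<in> S \<Longrightarrow> (f has_derivative frechet_derivative f (at x)) (at x)"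
  unfolding smooth_on_def using ck_on_SucD by blast

lemma smooth_on_continuous: "smooth_on S f \<Longrightarrow> continuous_on S f"
  unfolding smooth_on_def using ck_on_continuous by blast

lemma smooth_on_linear_system:
  fixes G :: "'a::real_normed_vector \<Rightarrow> real^'n^'n" and z r :: "'a \<Rightarrow> real^'n"
  assumes "open S" "\<And>i j. smooth_on S (\<lambda>x. G x $ i $ j)" "\<And>i. smooth_on S (\<lambda>x. r x $ i)"
    "\<And>x. x \<in> S \<Longrightarrow> det (G x) \<noteq> 0" "\<And>x. x \<in> S \<Longrightarrow> G x *v z x = r x"
  shows "smooth_on S z"
  unfolding smooth_on_def
proof
  show "ck_on k S z" for k
    by (rule ck_on_linear_system[where G = G and r = r]) (use assms in \<open>auto simp: smooth_on_def\<close>)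
qed

section \<open>Inverse function theorem with smooth inverse\<close>

lemma det_nonzero_iff_ker:
  fixes A :: "real^'n^'n"
  shows "det A \<noteq> 0 \<longleftrightarrow> (\<forall>x. A *v x = 0 \<longrightarrow> x = 0)"
  by (metis invertible_det_nz invertible_left_inverse matrix_left_invertible_ker)

text \<open>Made for replacing the fibre coordinates of a chart by new ones while keeping the base
  coordinates. The inverse function theorem gives a differentiable inverse; its smoothness is
  obtained by induction on k from the formula for its derivative.\<close>

lemma smooth_graph_inverse:
  fixes s :: "(real^'n) \<times> (real^'k) \<Rightarrow> real^'k"
  assumes U: "open U" "smooth_on U s" "x0 \<in> U"
    and ker: "\<And>x v. x \<in> U \<Longrightarrow> frechet_derivative s (at x) (0, v) = 0 \<Longrightarrow> v = 0"
  obtains U' V g where "open U'" "U' \<subseteq> U" "x0 \<in> U'" "open V"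
    "homeomorphism U' V (\<lambda>x. (fst x, s x)) g" "smooth_on V g"
proof -
  define D where "D x = frechet_derivative s (at x)" for x
  define f' where "f' x = Blinfun (\<lambda>v. (fst v, D x v))" for x
  have ds: "(s has_derivative D x) (at x)" if "x \<in> U" for x
    using smooth_on_has_derivative[OF U(2) that] by (simp add: D_def)
  have f': "blinfun_apply (f' x) = (\<lambda>v. (fst v, D x v))" if "x \<in> U" for x
    unfolding f'_def
    by (intro bounded_linear_Blinfun_apply bounded_linear_Pair bounded_linear_fst
        has_derivative_bounded_linear[OF ds[OF that]])
  have der: "((\<lambda>x. (fst x, s x)) has_derivative blinfun_apply (f' x)) (at x)" if "x \<in> U" for x
    unfolding f'[OF that]
    by (intro has_derivative_Pair ds that bounded_linear_imp_has_derivative bounded_linear_fst)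
  have cont: "continuous_on U f'"
  proof (rule continuous_on_blinfun_componentwise)
    fix i :: "(real^'n) \<times> (real^'k)"
    have "continuous_on U (\<lambda>x. (fst i, D x i))"
      unfolding D_def
      by (intro continuous_intros smooth_on_continuous smooth_on_frechet_derivative U(2))
    then show "continuous_on U (\<lambda>x. blinfun_apply (f' x) i)"
      by (rule continuous_on_eq) (simp add: f')
  qed
  have lin: "linear (blinfun_apply (f' x0))" by (simp add: blinfun.bounded_linear_right linear_conv_bounded_linear)
  \<comment> \<open>The first component of the derivative is \<open>fst\<close>, so a kernel vector
    has the form (0, v), and \<open>ker\<close> applies.\<close>
  have "v = 0" if "blinfun_apply (f' x0) v = 0" for v
    using that f'[OF U(3)] ker[OF U(3), of "snd v"] by (cases v) (auto simp: D_def zero_prod_def)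
  then have "inj (blinfun_apply (f' x0))"
    using lin linear_injective_0 by blast
  then obtain h where h: "linear h" "h \<circ> blinfun_apply (f' x0) = id"
    using linear_injective_left_inverse[OF lin] by blast
  then have "blinfun_apply (Blinfun h) = h"
    by (simp add: bounded_linear_Blinfun_apply linear_conv_bounded_linear)
  then have inv: "Blinfun h o\<^sub>L f' x0 = id_blinfun"
    using h(2) by (intro blinfun_eqI) (metis blinfun_apply_blinfun_compose blinfun_apply_id_blinfun comp_apply id_apply)
  have "\<exists>U' V g g'. open U' \<and> U' \<subseteq> U \<and> x0 \<in> U' \<and> open V \<and> homeomorphism U' V (\<lambda>x. (fst x, s x)) g \<and>
      (\<forall>y\<in>V. (g has_derivative g' y) (at y)) \<and> (\<forall>y\<in>V. g' y = inv (blinfun_apply (f' (g y)))) \<and>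
      (\<forall>y\<in>V. bij (blinfun_apply (f' (g y))))"
    by (rule inverse_function_theorem[OF U(1) der cont U(3) inv]) (assumption, blast)
  then obtain U' V g g' where g: "open U'" "U' \<subseteq> U" "x0 \<in> U'" "open V"
      and g': "homeomorphism U' V (\<lambda>x. (fst x, s x)) g"
      "\<And>y. y \<in> V \<Longrightarrow> (g has_derivative g' y) (at y)"
      "\<And>y. y \<in> V \<Longrightarrow> g' y = inv (blinfun_apply (f' (g y)))"
      "\<And>y. y \<in> V \<Longrightarrow> bij (blinfun_apply (f' (g y)))"
    by blast
  have gV: "g y \<in> U" if "y \<in> V" for y
    using g(2) homeomorphism_image2[OF g'(1)] that by blast
  have fg: "(fst (g' y v), D (g y) (g' y v)) = v" if "y \<in> V" for y v
    using surj_f_inv_f[OF bij_is_surj[OF g'(4)[OF that]], of v] g'(3)[OF that] f'[OF gV[OF that]] by simp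
  \<comment> \<open>The block of the Jacobian of \<open>s\<close> in the fibre variables, taken at
    \<open>g y\<close>. As \<open>ker\<close> is assumed throughout \<open>U\<close>, it is
    invertible on all of \<open>V\<close>.\<close>
  define G where "G y = (\<chi> i j. D (g y) (0, axis j 1) $ i)" for y
  have lind: "linear (D (g y))" if "y \<in> V" for y
    using ds[OF gV[OF that]] by (rule has_derivative_linear)
  have Gapp: "G y *v v = D (g y) (0, v)" if "y \<in> V" for y v
  proof -
    have "linear (\<lambda>v. D (g y) (0, v))"
      using linear_add[OF lind[OF that], of "(0, v)" "(0, w)" for v w]
        linear_scale[OF lind[OF that], of c "(0, v)" for c v]
      by (auto intro!: linearI)
    moreover have "matrix (\<lambda>v. D (g y) (0, v)) = G y" by (simp add: matrix_def G_def vec_eq_iff)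
    ultimately show ?thesis using matrix_works[of "\<lambda>v. D (g y) (0, v)" v] by (simp add: linear_matrix_vector_mul_eq)
  qed
  have detG: "det (G y) \<noteq> 0" if "y \<in> V" for y
    unfolding det_nonzero_iff_ker using Gapp[OF that] ker[OF gV[OF that]] by (auto simp: D_def)
  \<comment> \<open>Bootstrap: the derivative of \<open>g\<close> is a rational expression in
    derivatives of the smooth \<open>s\<close> taken at \<open>g y\<close>, so class C^k of
    \<open>g\<close> passes to its derivative.\<close>
  have "ck_on k V g" for k
  proof (induction k)
    case 0
    then show ?case using g'(1) by (simp add: homeomorphism_def)
  next
    case (Suc k)
    show ?case
    proof (rule ck_on_SucI[OF g(4) g'(2)])
      fix v
      have D: "ck_on k V (\<lambda>y. D (g y) w)" for w
        using smooth_on_frechet_derivative[OF U(2), of w] gV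
        by (intro ck_on_compose[OF g(4) U(1) Suc]) (auto simp: smooth_on_def D_def)
      have Di: "ck_on k V (\<lambda>y. D (g y) w $ i)" for w i
        by (intro ck_on_bounded_linear[OF bounded_linear_vec_nth g(4)] D)
      \<comment> \<open>By \<open>fg\<close> the base part of \<open>g' y v\<close> is
        \<open>fst v\<close>; the fibre part then solves a linear system with matrix
        \<open>G y\<close>.\<close>
      have "ck_on k V (\<lambda>y. snd (g' y v))"
      proof (rule ck_on_linear_system[OF g(4) _ _ detG])
        show "ck_on k V (\<lambda>x. G x $ i $ j)" for i j using Di by (simp add: G_def)
        have "ck_on k V (\<lambda>x. snd v $ i + - (D (g x) (fst v, 0) $ i))" for i
          by (intro ck_on_add g(4) ck_on_const ck_on_bounded_linear[OF bounded_linear_minus[OF bounded_linear_ident]] Di)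
        then show "ck_on k V (\<lambda>x. (snd v - D (g x) (fst v, 0)) $ i)" for i by simp
        fix y assume y: "y \<in> V"
        have "D (g y) (fst v, 0) + D (g y) (0, snd (g' y v)) = D (g y) (g' y v)"
          using linear_add[OF lind[OF y], of "(fst v, 0)" "(0, snd (g' y v))", symmetric]
          arg_cong[OF fg[OF y, of v], of fst] by (metis (no_types) add.right_neutral add_0 add_Pair fst_conv prod.collapse)
        also have "\<dots> = snd v" using arg_cong[OF fg[OF y, of v], of snd] by simp
        finally show "G y *v snd (g' y v) = snd v - D (g y) (fst v, 0)"
          by (simp add: Gapp[OF y] algebra_simps)
      qed
      then have "ck_on k V (\<lambda>y. (fst v, snd (g' y v)))" by (intro ck_on_Pair ck_on_const g(4))
      then show "ck_on k V (\<lambda>y. g' y v)"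
        by (rule ck_on_cong[OF g(4), rotated]) (use fg in \<open>simp add: prod_eq_iff\<close>)
    qed
  qed
  then have "smooth_on V g" by (simp add: smooth_on_def)
  then show ?thesis using that g(1-4) g'(1) by blast
qed

section \<open>Smooth functions and tangent vectors on manifolds\<close>

lemma is_chartD:
  assumes "is_chart c"
  shows "open (fst c)" "open (snd c ` fst c)" "inj_on (snd c) (fst c)"
    "continuous_on (fst c) (snd c)" "continuous_on (snd c ` fst c) (chart_inv c)"
  using assms by (auto simp: is_chart_def homeomorphism_def)

lemma chart_inv_left: "is_chart c \<Longrightarrow> x \<in> fst c \<Longrightarrow> chart_inv c (snd c x) = x"
  by (simp add: is_chartD the_inv_into_f_f)

lemma chart_inv_right: "is_chart c \<Longrightarrow> y \<in> snd c ` fst c \<Longrightarrow> snd c (chart_inv c y) = y"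
  by (simp add: is_chartD f_the_inv_into_f)

lemma chart_inv_in: "is_chart c \<Longrightarrow> y \<in> snd c ` fst c \<Longrightarrow> chart_inv c y \<in> fst c"
  using chart_inv_left by fastforce

lemma open_chart_image:
  assumes "is_chart c" "open U"
  shows "open (snd c ` (fst c \<inter> U))"
proof -
  have "snd c ` (fst c \<inter> U) = chart_inv c -` U \<inter> snd c ` fst c"
    using chart_inv_left[OF assms(1)] by force
  then show ?thesis
    using continuous_on_open_vimage[OF is_chartD(2)[OF assms(1)]] is_chartD(5)[OF assms(1)] assms(2) by metis
qed

lemma smooth_near_cong:
  assumes "open U" "p \<in> U" "\<And>q. q \<in> U \<Longrightarrow> f q = g q" "smooth_near A p f" "\<And>c. c \<in> A \<Longrightarrow> is_chart c"
  shows "smooth_near A p g"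
proof -
  obtain V where V: "p \<in> V" "smooth_fun A V f" using assms(4) by (auto simp: smooth_near_def)
  have "smooth_on (snd c ` (fst c \<inter> (U \<inter> V))) (g \<circ> chart_inv c)" if "c \<in> A" for c
  proof (rule smooth_on_cong[OF open_chart_image])
    show "is_chart c" using assms(5) that .
    show "open (U \<inter> V)" using V assms(1) by (auto simp: smooth_fun_def)
    show "smooth_on (snd c ` (fst c \<inter> (U \<inter> V))) (f \<circ> chart_inv c)"
      by (rule smooth_on_subset[of "snd c ` (fst c \<inter> V)"]) (use V that in \<open>auto simp: smooth_fun_def\<close>)
    show "\<And>x. x \<in> snd c ` (fst c \<inter> (U \<inter> V)) \<Longrightarrow> (f \<circ> chart_inv c) x = (g \<circ> chart_inv c) x"
      using assms(3) chart_inv_left[OF \<open>is_chart c\<close>] by auto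
  qed
  then have "smooth_fun A (U \<inter> V) g" using V assms(1) by (auto simp: smooth_fun_def)
  then show ?thesis using V assms(2) unfolding smooth_near_def by blast
qed

section \<open>Smooth functions on a manifold\<close>

locale manifold =
  fixes A :: "('a::t2_space, 'e::euclidean_space) chart set"
  assumes smooth_manifold: "smooth_manifold A"
begin

lemma chart: "c \<in> A \<Longrightarrow> is_chart c"
  using smooth_manifold by (simp add: smooth_manifold_def)

lemma chart_cover: obtains c where "c \<in> A" "p \<in> fst c"
  using smooth_manifold unfolding smooth_manifold_def by blast

lemma transition: "c \<in> A \<Longrightarrow> d \<in> A \<Longrightarrow> smooth_on (snd c ` (fst c \<inter> fst d)) (snd d \<circ> chart_inv c)"
  using smooth_manifold unfolding smooth_manifold_def smooth_transition_def by blast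

lemma in_atlasI:
  assumes "is_chart c" "\<And>d. d \<in> A \<Longrightarrow> smooth_transition c d" "\<And>d. d \<in> A \<Longrightarrow> smooth_transition d c"
  shows "c \<in> A"
  using smooth_manifold assms unfolding smooth_manifold_def by blast

lemma smooth_funD:
  "smooth_fun A U f \<Longrightarrow> c \<in> A \<Longrightarrow> smooth_on (snd c ` (fst c \<inter> U)) (f \<circ> chart_inv c)"
  by (simp add: smooth_fun_def)

lemma smooth_fun_open: "smooth_fun A U f \<Longrightarrow> open U"
  by (simp add: smooth_fun_def)

text \<open>Transition maps are smooth, so one chart containing \<open>U\<close> decides smoothness
  in all of them.\<close>

lemma smooth_fun_chartI:
  assumes c: "c \<in> A" and U: "open U" "U \<subseteq> fst c" and f: "smooth_on (snd c ` U) (f \<circ> chart_inv c)"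
  shows "smooth_fun A U f"
  unfolding smooth_fun_def
proof (intro conjI ballI U)
  fix d assume d: "d \<in> A"
  have o: "open (snd d ` (fst d \<inter> U))" by (rule open_chart_image[OF chart[OF d] U(1)])
  have oc: "open (snd c ` U)" using open_chart_image[OF chart[OF c] U(1)] U(2) by (simp add: Int_absorb1)
  have t: "smooth_on (snd d ` (fst d \<inter> U)) (snd c \<circ> chart_inv d)"
    by (rule smooth_on_subset[OF transition[OF d c]]) (use U in auto)
  have "smooth_on (snd d ` (fst d \<inter> U)) (\<lambda>x. (f \<circ> chart_inv c) ((snd c \<circ> chart_inv d) x))"
    by (rule smooth_on_compose[OF o oc t f]) (use U chart_inv_left[OF chart[OF d]] in auto)
  then show "smooth_on (snd d ` (fst d \<inter> U)) (f \<circ> chart_inv d)"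
    by (rule smooth_on_cong[OF o, rotated])
      (use U chart_inv_left[OF chart[OF d]] chart_inv_left[OF chart[OF c]] in auto)
qed

lemma smooth_fun_subset:
  assumes "smooth_fun A U f" "open V" "V \<subseteq> U"
  shows "smooth_fun A V f"
  unfolding smooth_fun_def
proof (intro conjI ballI assms(2))
  show "smooth_on (snd c ` (fst c \<inter> V)) (f \<circ> chart_inv c)" if "c \<in> A" for c
    by (rule smooth_on_subset[OF smooth_funD[OF assms(1) that]]) (use assms in auto)
qed

lemma smooth_fun_cong:
  assumes "smooth_fun A U f" "\<And>x. x \<in> U \<Longrightarrow> f x = g x"
  shows "smooth_fun A U g"
  unfolding smooth_fun_def
proof (intro conjI ballI smooth_fun_open[OF assms(1)])
  fix c assume c: "c \<in> A"
  show "smooth_on (snd c ` (fst c \<inter> U)) (g \<circ> chart_inv c)"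
    by (rule smooth_on_cong[OF open_chart_image[OF chart[OF c] smooth_fun_open[OF assms(1)]] _ smooth_funD[OF assms(1) c]])
      (use assms(2) chart_inv_left[OF chart[OF c]] in auto)
qed

lemma smooth_fun_local:
  assumes "open U" "\<And>x. x \<in> U \<Longrightarrow> \<exists>V. x \<in> V \<and> smooth_fun A V f"
  shows "smooth_fun A U f"
  unfolding smooth_fun_def
proof (intro conjI ballI assms(1))
  fix c assume c: "c \<in> A"
  show "smooth_on (snd c ` (fst c \<inter> U)) (f \<circ> chart_inv c)"
  proof (rule smooth_on_local)
    fix y assume "y \<in> snd c ` (fst c \<inter> U)"
    then obtain x where x: "x \<in> fst c" "x \<in> U" "y = snd c x" by auto
    then obtain V where V: "x \<in> V" "smooth_fun A V f" using assms(2) by blast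
    show "\<exists>T. open T \<and> y \<in> T \<and> smooth_on T (f \<circ> chart_inv c)"
      using open_chart_image[OF chart[OF c] smooth_fun_open[OF V(2)]] smooth_funD[OF V(2) c] x V(1) by blast
  qed
qed

lemma smooth_fun_const: "open U \<Longrightarrow> smooth_fun A U (\<lambda>x. c)"
  unfolding smooth_fun_def by (auto simp: o_def intro!: smooth_on_const open_chart_image chart)

lemma smooth_fun_add:
  assumes "smooth_fun A U f" "smooth_fun A U g"
  shows "smooth_fun A U (\<lambda>x. f x + g x)"
  using assms by (simp add: smooth_fun_def o_def smooth_on_add open_chart_image chart)

lemma smooth_fun_mult:
  assumes "smooth_fun A U f" "smooth_fun A U g"
  shows "smooth_fun A U (\<lambda>x. f x * g x)"
  using assms by (simp add: smooth_fun_def o_def smooth_on_mult open_chart_image chart)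

lemma smooth_fun_minus: "smooth_fun A U f \<Longrightarrow> smooth_fun A U (\<lambda>x. - f x)"
  using smooth_fun_mult[OF smooth_fun_const[of U "-1"]] smooth_fun_open by fastforce

lemma smooth_fun_sum:
  assumes "open U" "\<And>i. i \<in> I \<Longrightarrow> smooth_fun A U (f i)"
  shows "smooth_fun A U (\<lambda>x. \<Sum>i\<in>I. f i x)"
  using assms(2)
  by (induction I rule: infinite_finite_induct) (auto intro: smooth_fun_const smooth_fun_add assms(1))

text \<open>Cramer's rule on a manifold. Invertibility is phrased as triviality of the kernel, the
  form in which changes of frame and nondegenerate metrics supply it.\<close>

lemma smooth_fun_linear_system:
  fixes G :: "'k::finite \<Rightarrow> 'k \<Rightarrow> 'a \<Rightarrow> real"
  assumes U: "open U" and G: "\<And>i j. smooth_fun A U (G i j)" and r: "\<And>i. smooth_fun A U (r i)"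
    and ker: "\<And>x v. x \<in> U \<Longrightarrow> (\<And>i. (\<Sum>j\<in>UNIV. G i j x * v j) = 0) \<Longrightarrow> \<forall>j. v j = 0"
    and eq: "\<And>x i. x \<in> U \<Longrightarrow> (\<Sum>j\<in>UNIV. G i j x * z j x) = r i x"
  shows "smooth_fun A U (z j)"
  unfolding smooth_fun_def
proof (intro conjI ballI U)
  fix c assume c: "c \<in> A"
  have o: "open (snd c ` (fst c \<inter> U))" by (rule open_chart_image[OF chart[OF c] U])
  have "smooth_on (snd c ` (fst c \<inter> U)) (\<lambda>y. (\<chi> j. z j (chart_inv c y)) :: real^'k)"
  proof (rule smooth_on_linear_system[OF o, of "\<lambda>y. \<chi> i j. G i j (chart_inv c y)" "\<lambda>y. \<chi> i. r i (chart_inv c y)"])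
    show "smooth_on (snd c ` (fst c \<inter> U)) (\<lambda>x. (\<chi> i j. G i j (chart_inv c x)) $ i $ j)" for i j
      using smooth_funD[OF G c] by (simp add: o_def)
    show "smooth_on (snd c ` (fst c \<inter> U)) (\<lambda>x. (\<chi> i. r i (chart_inv c x)) $ i)" for i
      using smooth_funD[OF r c] by (simp add: o_def)
    fix y assume "y \<in> snd c ` (fst c \<inter> U)"
    then have y: "chart_inv c y \<in> U" using chart_inv_left[OF chart[OF c]] by auto
    show "(\<chi> i j. G i j (chart_inv c y)) *v (\<chi> j. z j (chart_inv c y)) = (\<chi> i. r i (chart_inv c y))"
      by (simp add: vec_eq_iff matrix_vector_mult_def eq[OF y])
    show "det (\<chi> i j. G i j (chart_inv c y)) \<noteq> 0"
      unfolding det_nonzero_iff_ker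
    proof (intro allI impI)
      fix v :: "real^'k" assume "(\<chi> i j. G i j (chart_inv c y)) *v v = 0"
      then have "(\<Sum>j\<in>UNIV. G i j (chart_inv c y) * v $ j) = 0" for i
        by (simp add: vec_eq_iff matrix_vector_mult_def)
      from ker[OF y this] show "v = 0" by (simp add: vec_eq_iff)
    qed
  qed
  from smooth_on_bounded_linear[OF bounded_linear_vec_nth[of j] o this]
  show "smooth_on (snd c ` (fst c \<inter> U)) (z j \<circ> chart_inv c)" by (simp add: o_def)
qed

lemma smooth_fun_coord:
  assumes "c \<in> A" "bounded_linear L"
  shows "smooth_fun A (fst c) (\<lambda>p. L (snd c p))"
proof (rule smooth_fun_chartI[OF assms(1)])
  have o: "open (snd c ` fst c)" by (rule is_chartD(2)[OF chart[OF assms(1)]])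
  have "smooth_on (snd c ` fst c) (\<lambda>y. L y)"
    by (rule smooth_on_bounded_linear[OF assms(2) o smooth_on_ident[OF o]])
  then show "smooth_on (snd c ` fst c) ((\<lambda>p. L (snd c p)) \<circ> chart_inv c)"
    by (rule smooth_on_cong[OF o, rotated]) (simp add: chart_inv_right[OF chart[OF assms(1)]])
qed (simp_all add: is_chartD(1)[OF chart[OF assms(1)]])

section \<open>Tangent vectors in charts\<close>

lemma smooth_near_has_derivative:
  assumes "smooth_near A p f" "c \<in> A" "p \<in> fst c"
  shows "((f \<circ> chart_inv c) has_derivative frechet_derivative (f \<circ> chart_inv c) (at (snd c p))) (at (snd c p))"
proof -
  obtain U where U: "p \<in> U" "smooth_fun A U f" using assms(1) by (auto simp: smooth_near_def)
  show ?thesis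
    by (rule smooth_on_has_derivative[OF smooth_funD[OF U(2) assms(2)]]) (use U assms in auto)
qed

lemma tvec_apply:
  "smooth_near A p f \<Longrightarrow> tvec A c p u f = frechet_derivative (f \<circ> chart_inv c) (at (snd c p)) u"
  by (simp add: tvec_def germwise_def)

lemma tvec_eqI:
  assumes "smooth_near A p f" "((f \<circ> chart_inv c) has_derivative D) (at (snd c p))"
  shows "tvec A c p u f = D u"
  using frechet_derivative_at[OF assms(2)] by (simp add: tvec_apply assms(1))

lemma tvec_not_smooth: "\<not> smooth_near A p f \<Longrightarrow> tvec A c p u f = 0"
  by (simp add: tvec_def germwise_def)

text \<open>Chain rule through the coordinate change; at functions that are not smooth near
  \<open>p\<close> both sides are 0 by \<open>germwise\<close>. Hence a single chart around
  \<open>p\<close> yields the whole tangent space.\<close>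

lemma tvec_change:
  assumes c: "c \<in> A" "p \<in> fst c" and d: "d \<in> A" "p \<in> fst d"
  shows "tvec A c p u = tvec A d p (frechet_derivative (snd d \<circ> chart_inv c) (at (snd c p)) u)"
proof
  fix f
  show "tvec A c p u f = tvec A d p (frechet_derivative (snd d \<circ> chart_inv c) (at (snd c p)) u) f"
  proof (cases "smooth_near A p f")
    case True
    have inv: "chart_inv c (snd c p) = p" by (simp add: chart_inv_left chart c)
    have o: "open (snd c ` (fst c \<inter> fst d))"
      by (rule open_chart_image[OF chart[OF c(1)] is_chartD(1)[OF chart[OF d(1)]]])
    have 1: "((snd d \<circ> chart_inv c) has_derivative frechet_derivative (snd d \<circ> chart_inv c) (at (snd c p))) (at (snd c p))"
      by (rule smooth_on_has_derivative[OF transition[OF c(1) d(1)]]) (use c d in auto)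
    have 2: "((f \<circ> chart_inv d) has_derivative frechet_derivative (f \<circ> chart_inv d) (at (snd d p)))
        (at ((snd d \<circ> chart_inv c) (snd c p)))"
      using smooth_near_has_derivative[OF True d] inv by simp
    have "((f \<circ> chart_inv c) has_derivative (\<lambda>u. frechet_derivative (f \<circ> chart_inv d) (at (snd d p))
        (frechet_derivative (snd d \<circ> chart_inv c) (at (snd c p)) u))) (at (snd c p))"
    proof (rule has_derivative_transform_within_open[OF has_derivative_compose[OF 1 2] o])
      show "snd c p \<in> snd c ` (fst c \<inter> fst d)" using c d by auto
      show "(f \<circ> chart_inv d) ((snd d \<circ> chart_inv c) x) = (f \<circ> chart_inv c) x"
        if "x \<in> snd c ` (fst c \<inter> fst d)" for x
        using that chart_inv_left[OF chart[OF c(1)]] chart_inv_left[OF chart[OF d(1)]] by auto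
    qed
    from tvec_eqI[OF True this] show ?thesis by (simp add: tvec_apply True)
  qed (simp add: tvec_not_smooth)
qed

lemma tangent_space_chart:
  assumes "c \<in> A" "p \<in> fst c"
  shows "tangent_space A p = range (tvec A c p)"
  using tvec_change[OF _ _ assms] assms unfolding tangent_space_def by blast

lemma linear_tvec:
  assumes "c \<in> A" "p \<in> fst c"
  shows "linear (tvec A c p)"
proof (rule linearI)
  have lin: "linear (frechet_derivative (f \<circ> chart_inv c) (at (snd c p)))" if "smooth_near A p f" for f
    by (rule has_derivative_linear[OF smooth_near_has_derivative[OF that assms]])
  show "tvec A c p (u + v) = tvec A c p u + tvec A c p v" for u v
    using linear_add[OF lin] by (auto simp: fun_eq_iff tvec_def germwise_def)
  show "tvec A c p (r *\<^sub>R u) = r *\<^sub>R tvec A c p u" for r u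
    using linear_scale[OF lin] by (auto simp: fun_eq_iff tvec_def germwise_def scaleR_fun_def)
qed

lemma tvec_coord:
  assumes "c \<in> A" "p \<in> fst c" "bounded_linear L"
  shows "tvec A c p u (\<lambda>q. L (snd c q)) = L u"
proof (rule tvec_eqI)
  show "smooth_near A p (\<lambda>q. L (snd c q))"
    using smooth_fun_coord[OF assms(1,3)] assms(2) by (auto simp: smooth_near_def)
  show "((\<lambda>q. L (snd c q)) \<circ> chart_inv c has_derivative L) (at (snd c p))"
  proof (rule has_derivative_transform_within_open)
    show "(L has_derivative L) (at (snd c p))" by (rule bounded_linear_imp_has_derivative[OF assms(3)])
    show "open (snd c ` fst c)" by (rule is_chartD(2)[OF chart[OF assms(1)]])
    show "snd c p \<in> snd c ` fst c" using assms(2) by auto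
  qed (simp add: chart_inv_right[OF chart[OF assms(1)]])
qed

text \<open>Smoothness near \<open>p\<close> is itself a property of the germ, so the extension of
  tangent vectors by 0 respects equality near \<open>p\<close> as well.\<close>

lemma tangent_cong:
  assumes v: "v \<in> tangent_space A p" and U: "open U" "p \<in> U" "\<And>q. q \<in> U \<Longrightarrow> f q = g q"
  shows "v f = v g"
proof -
  obtain c u where c: "c \<in> A" "p \<in> fst c" "v = tvec A c p u" using v by (auto simp: tangent_space_def)
  have near: "smooth_near A p f \<longleftrightarrow> smooth_near A p g"
    using smooth_near_cong[OF U(1,2), of f g A] smooth_near_cong[OF U(1,2), of g f A] U(3) chart by auto
  have "frechet_derivative (f \<circ> chart_inv c) (at (snd c p)) = frechet_derivative (g \<circ> chart_inv c) (at (snd c p))"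
    by (rule frechet_derivative_cong_open[OF open_chart_image[OF chart[OF c(1)] U(1)]])
      (use U c chart_inv_left[OF chart[OF c(1)]] in auto)
  then show ?thesis using near by (simp add: c(3) tvec_def germwise_def)
qed

lemma smooth_fun_near: "smooth_fun A U f \<Longrightarrow> p \<in> U \<Longrightarrow> smooth_near A p f"
  by (auto simp: smooth_near_def)

lemma tangent_add:
  assumes v: "v \<in> tangent_space A p" and fg: "smooth_fun A U f" "smooth_fun A U g" "p \<in> U"
  shows "v (\<lambda>q. f q + g q) = v f + v g"
proof -
  obtain c u where c: "c \<in> A" "p \<in> fst c" "v = tvec A c p u" using v by (auto simp: tangent_space_def)
  have "(((\<lambda>q. f q + g q) \<circ> chart_inv c) has_derivative (\<lambda>u. frechet_derivative (f \<circ> chart_inv c) (at (snd c p)) u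
      + frechet_derivative (g \<circ> chart_inv c) (at (snd c p)) u)) (at (snd c p))"
    unfolding o_def
    by (intro has_derivative_add) (use smooth_near_has_derivative[OF smooth_fun_near c(1,2)] fg in \<open>auto simp: o_def\<close>)
  from tvec_eqI[OF smooth_fun_near[OF smooth_fun_add[OF fg(1,2)] fg(3)] this]
  show ?thesis by (simp add: c(3) tvec_apply smooth_fun_near[OF fg(1,3)] smooth_fun_near[OF fg(2,3)])
qed

lemma tangent_mult:
  assumes v: "v \<in> tangent_space A p" and fg: "smooth_fun A U f" "smooth_fun A U g" "p \<in> U"
  shows "v (\<lambda>q. f q * g q) = f p * v g + v f * g p"
proof -
  obtain c u where c: "c \<in> A" "p \<in> fst c" "v = tvec A c p u" using v by (auto simp: tangent_space_def)
  have inv: "chart_inv c (snd c p) = p" by (simp add: chart_inv_left chart c)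
  have "(((\<lambda>q. f q * g q) \<circ> chart_inv c) has_derivative (\<lambda>u. (f \<circ> chart_inv c) (snd c p) * frechet_derivative (g \<circ> chart_inv c) (at (snd c p)) u
      + frechet_derivative (f \<circ> chart_inv c) (at (snd c p)) u * (g \<circ> chart_inv c) (snd c p))) (at (snd c p))"
    using has_derivative_mult[OF smooth_near_has_derivative[OF smooth_fun_near[OF fg(1,3)] c(1,2)]
      smooth_near_has_derivative[OF smooth_fun_near[OF fg(2,3)] c(1,2)]] by (simp add: o_def)
  from tvec_eqI[OF smooth_fun_near[OF smooth_fun_mult[OF fg(1,2)] fg(3)] this]
  show ?thesis by (simp add: c(3) tvec_apply smooth_fun_near[OF fg(1,3)] smooth_fun_near[OF fg(2,3)] inv)
qed

lemma tangent_const: "v \<in> tangent_space A p \<Longrightarrow> v (\<lambda>q. r) = 0"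
proof -
  assume "v \<in> tangent_space A p"
  then obtain c u where c: "c \<in> A" "p \<in> fst c" "v = tvec A c p u" by (auto simp: tangent_space_def)
  have "tvec A c p u (\<lambda>q. r) = 0"
    by (rule tvec_eqI) (auto simp: o_def intro: smooth_fun_near[OF smooth_fun_const[OF open_UNIV]])
  then show ?thesis by (simp add: c(3))
qed

lemma tangent_sum:
  assumes v: "v \<in> tangent_space A p" and U: "open U" "p \<in> U" and f: "\<And>i. i \<in> I \<Longrightarrow> smooth_fun A U (f i)"
  shows "v (\<lambda>q. \<Sum>i\<in>I. f i q) = (\<Sum>i\<in>I. v (f i))"
  using f
proof (induction I rule: infinite_finite_induct)
  case (insert i I)
  then have "v (\<lambda>q. f i q + (\<Sum>i\<in>I. f i q)) = v (f i) + v (\<lambda>q. \<Sum>i\<in>I. f i q)"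
    by (intro tangent_add[OF v _ smooth_fun_sum[OF U(1)] U(2)]) auto
  then show ?case using insert by simp
qed (simp_all add: tangent_const[OF v])

lemma smooth_fun_tvec:
  assumes c: "c \<in> A" and U: "U \<subseteq> fst c" and f: "smooth_fun A U f"
  shows "smooth_fun A U (\<lambda>p. tvec A c p u f)"
proof (rule smooth_fun_chartI[OF c smooth_fun_open[OF f] U])
  have im: "snd c ` (fst c \<inter> U) = snd c ` U" using U by auto
  have o: "open (snd c ` U)" using open_chart_image[OF chart[OF c] smooth_fun_open[OF f]] im by simp
  have "smooth_on (snd c ` U) (\<lambda>x. frechet_derivative (f \<circ> chart_inv c) (at x) u)"
    using smooth_on_frechet_derivative smooth_funD[OF f c] im by metis
  then show "smooth_on (snd c ` U) ((\<lambda>p. tvec A c p u f) \<circ> chart_inv c)"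
    by (rule smooth_on_cong[OF o, rotated])
      (use U chart_inv_left[OF chart[OF c]] smooth_fun_near[OF f] in \<open>auto simp: tvec_apply subsetD\<close>)
qed

text \<open>Maximality of the atlas at work: a chart followed by a smooth map with smooth inverse is
  compatible with all charts, hence a chart. Both the shrinking of charts and the new fibre
  coordinates of adapted bases are obtained this way.\<close>

lemma chart_composeI:
  assumes c: "c \<in> A" and U: "open U" "U \<subseteq> snd c ` fst c" and V: "open V"
    and h: "homeomorphism U V F g" and F: "smooth_on U F" and g: "smooth_on V g"
  shows "(chart_inv c ` U, F \<circ> snd c) \<in> A"
proof (rule in_atlasI)
  let ?d = "(chart_inv c ` U, F \<circ> snd c)"
  note cc = chart[OF c]
  have hU: "F x \<in> V" "g (F x) = x" if "x \<in> U" for x using h that by (auto simp: homeomorphism_def)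
  have hV: "g y \<in> U" "F (g y) = y" if "y \<in> V" for y using h that by (fastforce simp: homeomorphism_def)+
  have sc: "snd c (chart_inv c x) = x" if "x \<in> U" for x using U that chart_inv_right[OF cc] by blast
  have dom: "chart_inv c ` U \<subseteq> fst c" using U chart_inv_in[OF cc] by blast
  have domeq: "chart_inv c ` U = snd c -` U \<inter> fst c"
    using dom sc chart_inv_left[OF cc] by force
  have od: "open (chart_inv c ` U)"
    unfolding domeq using continuous_on_open_vimage[OF is_chartD(1)[OF cc]] is_chartD(4)[OF cc] U(1) by metis
  have img: "(F \<circ> snd c) ` chart_inv c ` U = V"
    using sc h by (auto simp: homeomorphism_def image_image)
  have inj: "inj_on (F \<circ> snd c) (chart_inv c ` U)"
    proof (rule inj_onI)
    fix x y assume "x \<in> chart_inv c ` U" "y \<in> chart_inv c ` U" "(F \<circ> snd c) x = (F \<circ> snd c) y"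
    then obtain x' y' where "x = chart_inv c x'" "y = chart_inv c y'" "x' \<in> U" "y' \<in> U" "F x' = F y'"
      using sc by auto
    then show "x = y" using hU(2) by metis
  qed
  have inv: "chart_inv ?d y = chart_inv c (g y)" if "y \<in> V" for y
    using the_inv_into_f_eq[OF inj, of "chart_inv c (g y)" y] hV[OF that] sc by simp
  have contd: "continuous_on (chart_inv c ` U) (F \<circ> snd c)"
  proof (rule continuous_on_compose)
    show "continuous_on (chart_inv c ` U) (snd c)" using continuous_on_subset[OF is_chartD(4)[OF cc] dom] .
    have "snd c ` chart_inv c ` U = U" using sc by (auto simp: image_image)
    then show "continuous_on (snd c ` chart_inv c ` U) F" using h by (simp add: homeomorphism_def)
  qed
  have conti: "continuous_on V (chart_inv ?d)"
  proof -
    have "continuous_on V (\<lambda>y. chart_inv c (g y))"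
      by (rule continuous_on_compose2[OF is_chartD(5)[OF cc]]) (use h hV U in \<open>auto simp: homeomorphism_def\<close>)
    then show ?thesis by (rule continuous_on_eq) (use inv in simp)
  qed
  show ch: "is_chart ?d"
    unfolding is_chart_def homeomorphism_def fst_conv snd_conv img
  proof (intro conjI ballI od V inj contd)
    show "continuous_on V (the_inv_into (chart_inv c ` U) (F \<circ> snd c))" using conti by simp
    show "the_inv_into (chart_inv c ` U) (F \<circ> snd c) ` V = chart_inv c ` U"
      using the_inv_into_onto[OF inj] img by simp
    show "(F \<circ> snd c) (the_inv_into (chart_inv c ` U) (F \<circ> snd c) y) = y" if "y \<in> V" for y
      using f_the_inv_into_f[OF inj] img that by blast
    show "the_inv_into (chart_inv c ` U) (F \<circ> snd c) ((F \<circ> snd c) x) = x" if "x \<in> chart_inv c ` U" for x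
      by (rule the_inv_into_f_f[OF inj that])
  qed (rule img refl)+
  fix e assume e: "e \<in> A"
  note ee = chart[OF e]
  have o1: "open (snd ?d ` (fst ?d \<inter> fst e))" by (rule open_chart_image[OF ch is_chartD(1)[OF ee]])
  have o2: "open (snd e ` (fst e \<inter> fst ?d))" by (rule open_chart_image[OF ee is_chartD(1)[OF ch]])
  have oce: "open (snd c ` (fst c \<inter> fst e))" by (rule open_chart_image[OF cc is_chartD(1)[OF ee]])
  have sub: "snd ?d ` (fst ?d \<inter> fst e) \<subseteq> V" using img by auto
  have "smooth_on (snd ?d ` (fst ?d \<inter> fst e)) (\<lambda>y. (snd e \<circ> chart_inv c) (g y))"
  proof (rule smooth_on_compose[OF o1 oce smooth_on_subset[OF g sub] transition[OF c e]])
    show "g ` snd ?d ` (fst ?d \<inter> fst e) \<subseteq> snd c ` (fst c \<inter> fst e)"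
    proof
      fix z assume "z \<in> g ` snd ?d ` (fst ?d \<inter> fst e)"
      then obtain x where x: "x \<in> U" "chart_inv c x \<in> fst e" and z: "z = g (F (snd c (chart_inv c x)))"
        by force
      have "z = snd c (chart_inv c x)" using z sc[OF x(1)] hU(2)[OF x(1)] by simp
      moreover have "chart_inv c x \<in> fst c" using dom x(1) by blast
      ultimately show "z \<in> snd c ` (fst c \<inter> fst e)" using x(2) by blast
    qed
  qed
  then show "smooth_transition ?d e"
    unfolding smooth_transition_def by (rule smooth_on_cong[OF o1, rotated]) (use inv hU sc in auto)
  have "smooth_on (snd e ` (fst e \<inter> fst ?d)) (\<lambda>y. F ((snd c \<circ> chart_inv e) y))"
  proof (rule smooth_on_compose[OF o2 U(1) smooth_on_subset[OF transition[OF e c]] F])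
    show "snd e ` (fst e \<inter> fst ?d) \<subseteq> snd e ` (fst e \<inter> fst c)" using dom by auto
    show "(snd c \<circ> chart_inv e) ` snd e ` (fst e \<inter> fst ?d) \<subseteq> U"
      using chart_inv_left[OF ee] sc by auto
  qed
  then show "smooth_transition e ?d" unfolding smooth_transition_def by (simp add: o_def)
qed

lemma chart_restrict:
  assumes "c \<in> A" "open W"
  shows "(fst c \<inter> W, snd c) \<in> A"
proof -
  let ?U = "snd c ` (fst c \<inter> W)"
  have o: "open ?U" by (rule open_chart_image[OF chart[OF assms(1)] assms(2)])
  have "(chart_inv c ` ?U, (\<lambda>x. x) \<circ> snd c) \<in> A"
    by (rule chart_composeI[OF assms(1) o _ o homeomorphism_ident])
      (auto intro: smooth_on_ident o)
  moreover have "chart_inv c ` ?U = fst c \<inter> W"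
    using chart_inv_left[OF chart[OF assms(1)]] by force
  ultimately show ?thesis by (simp add: o_def)
qed

end

text \<open>Locally a single chart of the target suffices, and there the pullback is a composition
  of two smooth coordinate expressions.\<close>

lemma smooth_fun_pullback:
  assumes A: "smooth_manifold A" and B: "smooth_manifold B"
    and f: "smooth_map A B S f" and h: "smooth_fun B W h"
  shows "smooth_fun A (S \<inter> f -` W) (\<lambda>p. h (f p))"
proof -
  interpret A: manifold A by standard fact
  interpret B: manifold B by standard fact
  have S: "open S" "continuous_on S f" using f by (auto simp: smooth_map_def)
  have oW: "open (S \<inter> f -` T)" if "open T" for T
    using S that by (metis Int_commute continuous_on_open_vimage)
  show ?thesis
    unfolding smooth_fun_def
  proof (intro conjI ballI oW B.smooth_fun_open[OF h])
    fix c assume c: "c \<in> A"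
    show "smooth_on (snd c ` (fst c \<inter> (S \<inter> f -` W))) ((\<lambda>p. h (f p)) \<circ> chart_inv c)"
    proof (rule smooth_on_local)
      fix y assume "y \<in> snd c ` (fst c \<inter> (S \<inter> f -` W))"
      then obtain p where p: "p \<in> fst c" "p \<in> S" "f p \<in> W" "y = snd c p" by auto
      obtain d where d: "d \<in> B" "f p \<in> fst d" by (rule B.chart_cover)
      let ?V = "fst c \<inter> (S \<inter> f -` (fst d \<inter> W))"
      have oV: "open (snd c ` ?V)"
        by (intro open_chart_image A.chart c oW open_Int is_chartD(1) B.chart d B.smooth_fun_open[OF h])
      have od: "open (snd d ` (fst d \<inter> W))"
        by (rule open_chart_image[OF B.chart[OF d(1)] B.smooth_fun_open[OF h]])
      have "smooth_on (snd c ` (fst c \<inter> S \<inter> f -` fst d)) (snd d \<circ> f \<circ> chart_inv c)"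
        using f c d(1) by (auto simp: smooth_map_def)
      then have 1: "smooth_on (snd c ` ?V) (snd d \<circ> f \<circ> chart_inv c)"
        by (rule smooth_on_subset) auto
      have "smooth_on (snd c ` ?V) (\<lambda>x. (h \<circ> chart_inv d) ((snd d \<circ> f \<circ> chart_inv c) x))"
        by (rule smooth_on_compose[OF oV od 1 B.smooth_funD[OF h d(1)]])
          (use chart_inv_left[OF A.chart[OF c]] in auto)
      then have "smooth_on (snd c ` ?V) ((\<lambda>p. h (f p)) \<circ> chart_inv c)"
        by (rule smooth_on_cong[OF oV, rotated])
          (use chart_inv_left[OF A.chart[OF c]] chart_inv_left[OF B.chart[OF d(1)]] in auto)
      then show "\<exists>T. open T \<and> y \<in> T \<and> smooth_on T ((\<lambda>p. h (f p)) \<circ> chart_inv c)"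
        using oV p d(2) by blast
    qed
  qed
qed

section \<open>Coordinates with respect to a basis or a frame\<close>

lemma frame_coeff_sum:
  fixes e :: "'i::finite \<Rightarrow> 'b \<Rightarrow> 'v::real_vector"
  assumes "basis_of F (\<lambda>i. e i x)"
  shows "frame_coeff e x (\<Sum>j\<in>UNIV. c j *\<^sub>R e j x) i = c i"
proof -
  let ?B = "range (\<lambda>j. e j x)"
  have B: "independent ?B" "inj (\<lambda>j. e j x)" using assms by (auto simp: basis_of_def)
  have sp: "e j x \<in> span ?B" for j by (simp add: span_base)
  have "representation ?B (\<Sum>j\<in>UNIV. c j *\<^sub>R e j x) (e i x) = (\<Sum>j\<in>UNIV. c j * representation ?B (e j x) (e i x))"
    by (simp add: representation_sum[OF B(1)] representation_scale[OF B(1)] sp span_scale)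
  also have "\<dots> = (\<Sum>j\<in>UNIV. if j = i then c j else 0)"
    using injD[OF B(2)] by (intro sum.cong) (auto simp: representation_basis[OF B(1)])
  finally show ?thesis by (simp add: frame_coeff_def)
qed

lemma basis_of_expand:
  fixes f :: "'i::finite \<Rightarrow> 'v::real_vector"
  assumes "basis_of F f" "v \<in> F"
  obtains c where "v = (\<Sum>j\<in>UNIV. c j *\<^sub>R f j)"
proof -
  have "v \<in> span (range f)" "inj f" using assms by (auto simp: basis_of_def)
  then obtain u where "v = (\<Sum>w\<in>range f. u w *\<^sub>R w)" by (auto simp: span_finite)
  then have "v = (\<Sum>j\<in>UNIV. u (f j) *\<^sub>R f j)" using \<open>inj f\<close> by (simp add: sum.reindex)
  then show ?thesis by (rule that)
qed

lemma frame_expand: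
  fixes e :: "'i::finite \<Rightarrow> 'b \<Rightarrow> 'v::real_vector"
  assumes "basis_of F (\<lambda>i. e i x)" "v \<in> F"
  shows "(\<Sum>i\<in>UNIV. frame_coeff e x v i *\<^sub>R e i x) = v"
proof -
  obtain c where "v = (\<Sum>j\<in>UNIV. c j *\<^sub>R e j x)" by (rule basis_of_expand[OF assms])
  then show ?thesis by (simp add: frame_coeff_sum[where e = e and x = x, OF assms(1)])
qed

text \<open>Reduces \<open>basis_of\<close> to unique representation by coefficients. Injectivity of
  the indexing family is included, since a repeated vector yields the relation with coefficients 1
  and -1.\<close>

lemma basis_ofI:
  fixes f :: "'i::finite \<Rightarrow> 'v::real_vector"
  assumes F: "F = range (\<lambda>c. \<Sum>j\<in>UNIV. c j *\<^sub>R f j)"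
    and ind: "\<And>c. (\<Sum>j\<in>UNIV. c j *\<^sub>R f j) = 0 \<Longrightarrow> \<forall>j. c j = 0"
  shows "basis_of F f"
proof -
  have inj: "inj f"
  proof (rule injI, rule ccontr)
    fix i j assume ij: "f i = f j" "i \<noteq> j"
    let ?c = "\<lambda>l. (if l = i then 1 else 0) - (if l = j then 1 else (0::real))"
    have "(\<Sum>l\<in>UNIV. ?c l *\<^sub>R f l) = (\<Sum>l\<in>UNIV. (if l = i then f l else 0) - (if l = j then f l else 0))"
      by (intro sum.cong) auto
    also have "\<dots> = 0" using ij by (simp add: sum_subtractf)
    finally have "?c i = 0" using ind[of ?c] by blast
    then show False using ij(2) by simp
  qed
  have "independent (range f)"
  proof (rule independent_if_scalars_zero)
    fix g w assume g: "(\<Sum>x\<in>range f. g x *\<^sub>R x) = 0" "w \<in> range f"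
    then have "(\<Sum>j\<in>UNIV. g (f j) *\<^sub>R f j) = 0" using inj by (simp add: sum.reindex)
    then show "g w = 0" using ind[of "\<lambda>j. g (f j)"] g(2) by auto
  qed simp
  moreover have "span (range f) = F"
  proof
    show "span (range f) \<subseteq> F"
      unfolding F by (auto simp: span_finite sum.reindex[OF inj])
    show "F \<subseteq> span (range f)"
      unfolding F by (intro image_subsetI span_sum span_scale span_base rangeI)
  qed
  ultimately show ?thesis using inj by (simp add: basis_of_def)
qed

lemma basis_of_unique:
  fixes f :: "'i::finite \<Rightarrow> 'v::real_vector"
  assumes "basis_of F f" "(\<Sum>j\<in>UNIV. c j *\<^sub>R f j) = (\<Sum>j\<in>UNIV. d j *\<^sub>R f j)"
  shows "c = d"
proof
  fix i
  have "frame_coeff (\<lambda>i _. f i) undefined (\<Sum>j\<in>UNIV. c j *\<^sub>R f j) i = c i" for c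
    by (rule frame_coeff_sum[where e = "\<lambda>i _. f i"]) (rule assms(1))
  from this[of c] this[of d] show "c i = d i" using assms(2) by metis
qed

section \<open>Fibred charts\<close>

lemma frame_coeff_lincomb:
  fixes e :: "'i::finite \<Rightarrow> 'b \<Rightarrow> 'v::real_vector"
  assumes "basis_of F (\<lambda>i. e i x)" "\<And>l. w l \<in> F"
  shows "frame_coeff e x (\<Sum>l\<in>I. z l *\<^sub>R w l) i = (\<Sum>l\<in>I. z l * frame_coeff e x (w l) i)"
proof -
  have B: "independent (range (\<lambda>j. e j x))" and "\<And>l. w l \<in> span (range (\<lambda>j. e j x))"
    using assms by (auto simp: basis_of_def)
  then show ?thesis
    by (simp add: frame_coeff_def representation_sum[OF B] representation_scale[OF B] span_scale)
qed

lemma frame_coeff_add: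
  fixes e :: "'i::finite \<Rightarrow> 'b \<Rightarrow> 'v::real_vector"
  assumes "basis_of F (\<lambda>i. e i x)" "v \<in> F" "w \<in> F"
  shows "frame_coeff e x (v + w) i = frame_coeff e x v i + frame_coeff e x w i"
  using assms by (auto simp: frame_coeff_def basis_of_def representation_add)

lemma frame_coeff_scale:
  fixes e :: "'i::finite \<Rightarrow> 'b \<Rightarrow> 'v::real_vector"
  assumes "basis_of F (\<lambda>i. e i x)" "v \<in> F"
  shows "frame_coeff e x (r *\<^sub>R v) i = r * frame_coeff e x v i"
  using assms by (auto simp: frame_coeff_def basis_of_def representation_scale)

lemma frame_coeff_zero:
  fixes e :: "'i::finite \<Rightarrow> 'b \<Rightarrow> 'v::real_vector"
  shows "frame_coeff e x 0 i = 0"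
  by (simp add: frame_coeff_def representation_zero)

lemma basis_of_subspace: "basis_of F f \<Longrightarrow> subspace F"
  by (auto simp: basis_of_def)

lemma basis_of_in: "basis_of F f \<Longrightarrow> f i \<in> F"
  by (auto simp: basis_of_def span_base)

lemma smooth_sectionD:
  "smooth_section A E U s \<Longrightarrow> (W, e) \<in> frames E \<Longrightarrow> smooth_fun A (U \<inter> W) (\<lambda>x. frame_coeff e x (s x) i)"
  unfolding smooth_section_def by blast

text \<open>\<open>smooth_section\<close> tests only the frames stored in the bundle. The
  coefficients with respect to another local frame \<open>e\<close> solve a linear system whose
  matrix expresses \<open>e\<close> in a stored frame \<open>f\<close>; independence of
  \<open>e\<close> makes its kernel trivial.\<close>

lemma (in manifold) frame_coeff_smooth:
  fixes E :: "('a, 'v::real_vector, 'i::finite) vbundle"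
  assumes E: "vector_bundle A E" and e: "local_frame A E W e" and s: "smooth_section A E U s"
  shows "smooth_fun A (U \<inter> W) (\<lambda>x. frame_coeff e x (s x) i)"
proof (rule smooth_fun_local)
  have oW: "open W" "open U" using e s by (auto simp: local_frame_def smooth_section_def)
  then show "open (U \<inter> W)" by auto
  fix x0 assume x0: "x0 \<in> U \<inter> W"
  have "x0 \<in> (\<Union>(W, e)\<in>frames E. W)" using E by (simp add: vector_bundle_def)
  then obtain W' f where f: "(W', f) \<in> frames E" "x0 \<in> W'" by auto
  then have f': "open W'" "local_frame A E W' f" using E by (auto simp: vector_bundle_def)
  let ?V = "U \<inter> W \<inter> W'"
  have oV: "open ?V" using oW f'(1) by auto
  have bf: "basis_of (fibre E x) (\<lambda>i. f i x)" if "x \<in> W'" for x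
    using f'(2) that by (simp add: local_frame_def)
  have be: "basis_of (fibre E x) (\<lambda>i. e i x)" if "x \<in> W" for x
    using e that by (simp add: local_frame_def)
  have sx: "s x \<in> fibre E x" if "x \<in> U" for x using s that by (simp add: smooth_section_def)
  have ex: "e l x \<in> fibre E x" if "x \<in> W" for l x using basis_of_in[OF be[OF that]] .
  have sub: "smooth_fun A ?V g" if "smooth_fun A (X \<inter> W') g" "?V \<subseteq> X \<inter> W'" for X g
    by (rule smooth_fun_subset[OF that(1) oV that(2)])
  have e_smooth: "smooth_fun A (W \<inter> W') (\<lambda>x. frame_coeff f x (e j x) i)" for i j
    by (rule smooth_sectionD[OF _ f(1)]) (use e in \<open>simp add: local_frame_def\<close>)
  have s_smooth: "smooth_fun A (U \<inter> W') (\<lambda>x. frame_coeff f x (s x) i)" for i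
    by (rule smooth_sectionD[OF s f(1)])
  have "smooth_fun A ?V (\<lambda>x. frame_coeff e x (s x) i)"
  proof (rule smooth_fun_linear_system[OF oV, of "\<lambda>i j x. frame_coeff f x (e j x) i" "\<lambda>i x. frame_coeff f x (s x) i"])
    show "smooth_fun A ?V (\<lambda>x. frame_coeff f x (e j x) i)" for i j
      by (rule sub[OF e_smooth]) auto
    show "smooth_fun A ?V (\<lambda>x. frame_coeff f x (s x) i)" for i
      by (rule sub[OF s_smooth]) auto
    fix x assume x: "x \<in> ?V"
    show "(\<Sum>j\<in>UNIV. frame_coeff f x (e j x) i * frame_coeff e x (s x) j) = frame_coeff f x (s x) i" for i
    proof -
      have "frame_coeff f x (s x) i = frame_coeff f x (\<Sum>j\<in>UNIV. frame_coeff e x (s x) j *\<^sub>R e j x) i"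
        using frame_expand[where e = e and x = x, OF be[of x] sx[of x]] x by simp
      also have "\<dots> = (\<Sum>j\<in>UNIV. frame_coeff e x (s x) j * frame_coeff f x (e j x) i)"
        by (rule frame_coeff_lincomb[where e = f and x = x, OF bf]) (use x ex in auto)
      finally show ?thesis by (simp add: mult.commute)
    qed
    fix v assume v: "\<And>i. (\<Sum>j\<in>UNIV. frame_coeff f x (e j x) i * v j) = 0"
    have mem: "(\<Sum>j\<in>UNIV. v j *\<^sub>R e j x) \<in> fibre E x"
      using basis_of_subspace[OF be[of x]] ex x by (intro subspace_sum subspace_scale) auto
    have "frame_coeff f x (\<Sum>j\<in>UNIV. v j *\<^sub>R e j x) i = 0" for i
      using frame_coeff_lincomb[where e = f and x = x, OF bf, where w = "\<lambda>l. e l x" and z = v and I = UNIV and i = i] x ex v[of i]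
      by (simp add: mult.commute)
    then have "(\<Sum>j\<in>UNIV. v j *\<^sub>R e j x) = 0"
      using frame_expand[where e = f and x = x, OF bf mem] x by simp
    then have "(\<Sum>j\<in>UNIV. v j *\<^sub>R e j x) = (\<Sum>j\<in>UNIV. 0 *\<^sub>R e j x)" by simp
    from basis_of_unique[OF be this] x show "\<forall>j. v j = 0" by (auto simp: fun_eq_iff)
  qed
  then show "\<exists>V. x0 \<in> V \<and> smooth_fun A V (\<lambda>x. frame_coeff e x (s x) i)"
    using x0 f(2) by (intro exI[of _ ?V]) simp
qed

lemma sum_axis: "(\<Sum>i\<in>UNIV. a i *\<^sub>R axis i (1::real)) = (\<chi> i. a i)"
  using basis_expansion[of "\<chi> i. a i"] by (simp add: scalar_mult_eq_scaleR)

text \<open>The coordinate functions of the chart are dual to the coordinate vectors and therefore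
  detect linear relations among them.\<close>

lemma tangent_frame_basis:
  fixes B :: "('b::t2_space, real^'n) chart set"
  assumes "smooth_manifold B" "c \<in> B" "x \<in> fst c"
  shows "basis_of (tangent_space B x) (\<lambda>i. tvec B c x (axis i 1))"
proof -
  interpret B: manifold B by standard fact
  note lin = B.linear_tvec[OF assms(2,3)]
  have s: "(\<Sum>j\<in>UNIV. a j *\<^sub>R tvec B c x (axis j 1)) = tvec B c x (\<chi> j. a j)" for a
    by (simp add: sum_axis[symmetric] linear_sum[OF lin] linear_scale[OF lin])
  show ?thesis
  proof (rule basis_ofI)
    have "u = (\<chi> j. vec_nth u j)" for u :: "real^'n" by simp
    then have "range (tvec B c x) = range (\<lambda>a. tvec B c x (\<chi> j. a j))"
      by (metis (no_types, lifting) rangeI image_subsetI subset_antisym)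
    then show "tangent_space B x = range (\<lambda>a. \<Sum>j\<in>UNIV. a j *\<^sub>R tvec B c x (axis j 1))"
      unfolding s B.tangent_space_chart[OF assms(2,3)] .
    fix a assume "(\<Sum>j\<in>UNIV. a j *\<^sub>R tvec B c x (axis j 1)) = 0"
    then have 0: "tvec B c x (\<chi> j. a j) = 0" by (simp add: s)
    show "\<forall>j. a j = 0"
    proof
      fix j
      show "a j = 0"
        using B.tvec_coord[OF assms(2,3) bounded_linear_vec_nth[of j], of "\<chi> j. a j"] 0 by simp
    qed
  qed
qed

section \<open>Existence of fibred charts and of canonical bases\<close>

locale fibred =
  fixes K :: "('m::t2_space, 'p::t2_space, 'v::real_vector, 'n::finite, 'k::finite) fibred_algebroid"
    and AF :: "('f::t2_space, real^'k) chart set"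
  assumes fibred: "fibred_pre_lie_algebroid K AF"
begin

abbreviation "AB \<equiv> base_atlas K"
abbreviation "AT \<equiv> total_atlas K"

sublocale B: manifold AB
  by standard (use fibred in \<open>simp add: fibred_pre_lie_algebroid_def\<close>)

sublocale T: manifold AT
  by standard (use fibred in \<open>simp add: fibred_pre_lie_algebroid_def\<close>)

sublocale F: manifold AF
  by standard (use fibred in \<open>simp add: fibred_pre_lie_algebroid_def\<close>)

lemma proj_smooth: "smooth_map AT AB UNIV (proj K)"
  using fibred by (simp add: fibred_pre_lie_algebroid_def fibration_def)

lemma alg_bundle: "vector_bundle AB (alg K)"
  and anchor_morphism: "bundle_morphism AB (alg K) (tangent_bundle AB) (anchor K)"
  using fibred by (simp_all add: fibred_pre_lie_algebroid_def pre_lie_algebroid_def)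

lemma open_proj_vimage: "open W \<Longrightarrow> open (proj K -` W)"
  using proj_smooth by (simp add: smooth_map_def open_vimage)

lemma smooth_fun_proj: "smooth_fun AB W h \<Longrightarrow> smooth_fun AT (proj K -` W) (\<lambda>m. h (proj K m))"
  using smooth_fun_pullback[OF T.smooth_manifold B.smooth_manifold proj_smooth] by fastforce

lemma smooth_fun_proj': "smooth_fun AB W h \<Longrightarrow> open U \<Longrightarrow> proj K ` U \<subseteq> W \<Longrightarrow> smooth_fun AT U (\<lambda>m. h (proj K m))"
  by (rule T.smooth_fun_subset[OF smooth_fun_proj]) auto

text \<open>The candidate is a product chart composed with a local trivialisation. Its transition
  maps to the charts of the total space are smooth because the inverse of the trivialisation is,
  those in the other direction because the trivialisation is; maximality of the atlas then makes it
  a chart.\<close>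

lemma fibred_chart_ex: "\<exists>c c0. fibred_chart K c c0 \<and> m \<in> fst c"
proof -
  have "fibration AB AT AF (proj K)" using fibred by (simp add: fibred_pre_lie_algebroid_def)
  then obtain U \<psi> where U: "open U" "proj K m \<in> U"
    and dif: "diffeo AT (prod_charts AB AF) (proj K -` U) (U \<times> UNIV) (\<lambda>m. (proj K m, \<psi> m))"
    unfolding fibration_def by blast
  let ?f = "\<lambda>m. (proj K m, \<psi> m)" and ?S = "proj K -` U" and ?T = "U \<times> (UNIV :: 'f set)"
  let ?g = "the_inv_into ?S ?f"
  obtain c0 where c0: "c0 \<in> AB" "proj K m \<in> fst c0" by (rule B.chart_cover)
  obtain d where d: "d \<in> AF" "\<psi> m \<in> fst d" by (rule F.chart_cover)
  note cc = B.chart[OF c0(1)] and dd = F.chart[OF d(1)]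
  let ?D = "(fst c0 \<inter> U) \<times> fst d"
  let ?h = "map_prod (snd c0) (snd d)"
  have bij: "bij_betw ?f ?S ?T" and f: "smooth_map AT (prod_charts AB AF) ?S ?f"
    and g: "smooth_map (prod_charts AB AF) AT ?T ?g"
    using dif by (simp_all add: diffeo_def)
  have gS: "?g x \<in> ?S" "?f (?g x) = x" if "x \<in> ?T" for x
    using the_inv_into_into[of ?f ?S x ?S] f_the_inv_into_f[of ?f ?S x] bij that by (simp_all only: bij_betw_def order_refl)
  have gf: "?g (?f x) = x" if "x \<in> ?S" for x
    using the_inv_into_f_f[of ?f ?S x] bij that by (simp only: bij_betw_def)
  have cf: "continuous_on ?S ?f" and cg: "continuous_on ?T ?g" and oS: "open ?S"
    using f g by (auto simp: smooth_map_def)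
  have oD: "open ?D" using U(1) is_chartD(1)[OF cc] is_chartD(1)[OF dd] by (intro open_Times) auto
  define p where "p = (fst c0 \<times> fst d, ?h)"
  have p: "p \<in> prod_charts AB AF" unfolding p_def prod_charts_def using c0(1) d(1) by blast
  \<comment> \<open>The part of the trivialised region that lands in the domain of the product
    chart. The intersection with \<open>U\<close> in \<open>?D\<close> keeps the image inside the
    range of the trivialisation.\<close>
  define W where "W = {x \<in> ?S. ?f x \<in> ?D}"
  have oW: "open W"
  proof -
    have "W = ?f -` ?D \<inter> ?S" by (auto simp: W_def)
    then show ?thesis using continuous_on_open_vimage[OF oS] cf oD by metis
  qed
  define c where "c = (W, \<lambda>x. ?h (?f x))"
  have hinj: "inj_on ?h ?D"
    using is_chartD(3)[OF cc] is_chartD(3)[OF dd] by (auto simp: inj_on_def)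
  have fW: "?f x \<in> ?D" if "x \<in> W" for x using that by (simp add: W_def)
  have fimg: "?f ` W = ?D"
  proof
    show "?D \<subseteq> ?f ` W"
    proof
      fix x assume x: "x \<in> ?D"
      then have xT: "x \<in> ?T" by auto
      have "?g x \<in> W" unfolding W_def mem_Collect_eq gS(2)[OF xT] using gS(1)[OF xT] x by (rule conjI)
      then show "x \<in> ?f ` W" by (rule image_eqI[where x = "?g x" and f = ?f, OF gS(2)[OF xT, symmetric]])
    qed
  qed (use fW in blast)
  have img: "snd c ` fst c = snd c0 ` (fst c0 \<inter> U) \<times> snd d ` fst d"
  proof -
    have "snd c ` fst c = ?h ` ?f ` W" by (simp add: c_def image_image)
    then show ?thesis unfolding fimg by (simp add: map_prod_surj_on)
  qed
  have oimg: "open (snd c ` fst c)"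
    unfolding img by (intro open_Times open_chart_image cc U is_chartD(2)[OF dd])
  have inj: "inj_on (snd c) (fst c)"
  proof (rule inj_onI)
    fix x y assume xy: "x \<in> fst c" "y \<in> fst c" "snd c x = snd c y"
    have fxy: "?f x = ?f y"
      by (rule inj_onD[OF hinj]) (use xy fW in \<open>auto simp: c_def\<close>)
    have xS: "x \<in> ?S" "y \<in> ?S" using xy by (auto simp: c_def W_def)
    have "x = ?g (?f x)" by (rule gf[OF xS(1), symmetric])
    also have "\<dots> = ?g (?f y)" by (simp only: fxy)
    also have "\<dots> = y" by (rule gf[OF xS(2)])
    finally show "x = y" .
  qed
  let ?hi = "\<lambda>y. (chart_inv c0 (fst y), chart_inv d (snd y))"
  have hi: "?hi y \<in> ?D" "?h (?hi y) = y" if y0: "y \<in> snd c ` fst c" for y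
  proof -
    obtain a b where y: "y = (snd c0 a, snd d b)" "a \<in> fst c0 \<inter> U" "b \<in> fst d" using y0 unfolding img by auto
    then show "?hi y \<in> ?D" "?h (?hi y) = y" by (auto simp: chart_inv_left cc dd)
  qed
  have inv: "chart_inv c y = ?g (?hi y)" if "y \<in> snd c ` fst c" for y
  proof (rule the_inv_into_f_eq[OF inj])
    have T: "?hi y \<in> ?T" using hi(1)[OF that] by blast
    have e: "?f (?g (?hi y)) = ?hi y" by (rule gS(2)[OF T])
    show "snd c (?g (?hi y)) = y"
      unfolding c_def snd_conv e by (rule hi(2)[OF that])
    show "?g (?hi y) \<in> fst c"
      unfolding c_def fst_conv W_def mem_Collect_eq e using gS(1)[OF T] hi(1)[OF that] by blast
  qed
  have ch: "is_chart c"
    unfolding is_chart_def homeomorphism_def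
  proof (intro conjI ballI)
    show "open (fst c)" using oW by (simp add: c_def)
    have "continuous_on W (\<lambda>x. (snd c0 (proj K x), snd d (\<psi> x)))"
    proof (rule continuous_on_Pair)
      have *: "continuous_on W ?f" by (rule continuous_on_subset[OF cf]) (auto simp: W_def)
      show "continuous_on W (\<lambda>x. snd c0 (proj K x))"
        by (rule continuous_on_compose2[OF is_chartD(4)[OF cc] continuous_on_fst[OF *, simplified]]) (use fW in auto)
      show "continuous_on W (\<lambda>x. snd d (\<psi> x))"
        by (rule continuous_on_compose2[OF is_chartD(4)[OF dd] continuous_on_snd[OF *, simplified]]) (use fW in auto)
    qed
    then show "continuous_on (fst c) (snd c)" by (simp add: c_def)
    have "continuous_on (snd c ` fst c) (\<lambda>y. ?g (?hi y))"
    proof (rule continuous_on_compose2[OF cg])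
      show "continuous_on (snd c ` fst c) ?hi"
        unfolding img
        by (intro continuous_on_Pair continuous_on_compose2[OF is_chartD(5)[OF cc] continuous_on_fst[OF continuous_on_id]]
            continuous_on_compose2[OF is_chartD(5)[OF dd] continuous_on_snd[OF continuous_on_id]]) auto
      show "?hi ` snd c ` fst c \<subseteq> ?T" using hi(1) by blast
    qed
    then show "continuous_on (snd c ` fst c) (chart_inv c)"
      by (rule continuous_on_eq) (rule inv[symmetric])
    show "chart_inv c ` snd c ` fst c = fst c" using the_inv_into_onto[OF inj] .
  qed (simp_all add: oimg inj the_inv_into_f_f[OF inj] f_the_inv_into_f[OF inj])
  have sc: "snd c x = snd p (?f x)" for x by (simp add: c_def p_def)
  have pinj: "inj_on (snd p) (fst p)"
    using is_chartD(3)[OF cc] is_chartD(3)[OF dd] by (auto simp: p_def inj_on_def)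
  have pinv: "chart_inv p (snd p x) = x" if "x \<in> fst p" for x
    using pinj that by (simp add: the_inv_into_f_f)
  have "c \<in> AT"
  proof (rule T.in_atlasI[OF ch])
    fix e assume e: "e \<in> AT"
    note ee = T.chart[OF e]
    have o1: "open (snd c ` (fst c \<inter> fst e))" by (rule open_chart_image[OF ch is_chartD(1)[OF ee]])
    have o2: "open (snd e ` (fst e \<inter> fst c))" by (rule open_chart_image[OF ee is_chartD(1)[OF ch]])
    have s: "smooth_on (snd p ` (fst p \<inter> ?T \<inter> ?g -` fst e)) (snd e \<circ> ?g \<circ> chart_inv p)"
      using g p e by (auto simp: smooth_map_def)
    have "smooth_on (snd c ` (fst c \<inter> fst e)) (snd e \<circ> ?g \<circ> chart_inv p)"
    proof (rule smooth_on_subset[OF s], rule subsetI)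
      fix y assume "y \<in> snd c ` (fst c \<inter> fst e)"
      then obtain x where x: "x \<in> W" "x \<in> fst e" "y = snd c x" by (auto simp: c_def)
      then have "?f x \<in> fst p \<inter> ?T \<inter> ?g -` fst e"
        using fW[OF x(1)] gf[of x] by (auto simp: p_def W_def)
      then show "y \<in> snd p ` (fst p \<inter> ?T \<inter> ?g -` fst e)" unfolding x(3) sc by (rule imageI)
    qed
    then show "smooth_transition c e"
      unfolding smooth_transition_def
    proof (rule smooth_on_cong[OF o1, rotated])
      fix y assume "y \<in> snd c ` (fst c \<inter> fst e)"
      then obtain x where x: "x \<in> W" "x \<in> fst e" "y = snd c x" by (auto simp: c_def)
      have "chart_inv c y = x" using chart_inv_left[OF ch, of x] x by (simp add: c_def)
      moreover have "chart_inv p y = ?f x"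
        unfolding x(3) sc by (rule pinv) (use fW[OF x(1)] in \<open>auto simp: p_def\<close>)
      moreover have "?g (?f x) = x" by (rule gf) (use x in \<open>simp add: W_def\<close>)
      ultimately show "(snd e \<circ> ?g \<circ> chart_inv p) y = (snd e \<circ> chart_inv c) y" by simp
    qed
    have "smooth_on (snd e ` (fst e \<inter> ?S \<inter> ?f -` fst p)) (snd p \<circ> ?f \<circ> chart_inv e)"
      using f p e by (auto simp: smooth_map_def)
    then have "smooth_on (snd e ` (fst e \<inter> fst c)) (snd p \<circ> ?f \<circ> chart_inv e)"
      by (rule smooth_on_subset) (use fW in \<open>auto simp: c_def W_def p_def\<close>)
    then show "smooth_transition e c"
      unfolding smooth_transition_def by (rule smooth_on_cong[OF o2, rotated]) (simp add: sc)
  qed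
  moreover have "m \<in> fst c" using U(2) c0(2) d(2) by (simp add: c_def W_def)
  moreover have "proj K x \<in> fst c0 \<and> fst (snd c x) = snd c0 (proj K x)" if "x \<in> fst c" for x
    using that by (auto simp: c_def W_def)
  ultimately show ?thesis using c0(1) unfolding fibred_chart_def by blast
qed

text \<open>A fibred chart is shrunk to the preimage of the domain of a frame of the algebroid;
  \<open>chart_restrict\<close> keeps it in the atlas.\<close>

lemma canonical_ex: "\<exists>b. canonical K b \<and> m \<in> cdom b"
proof -
  obtain c c0 where c: "fibred_chart K c c0" "m \<in> fst c" using fibred_chart_ex by blast
  have "proj K m \<in> (\<Union>(W, e)\<in>frames (alg K). W)" using alg_bundle by (simp add: vector_bundle_def)
  then obtain W e where e: "(W, e) \<in> frames (alg K)" "proj K m \<in> W" by auto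
  then have W: "open W" "local_frame AB (alg K) W e" using alg_bundle by (auto simp: vector_bundle_def)
  have "(fst c \<inter> proj K -` W, snd c) \<in> AT"
    by (rule T.chart_restrict[OF _ open_proj_vimage[OF W(1)]]) (use c in \<open>simp add: fibred_chart_def\<close>)
  then have "canonical K \<lparr>tchart = (fst c \<inter> proj K -` W, snd c), bchart = c0, aframe = e\<rparr>"
    using c(1) W(2) by (auto simp: canonical_def fibred_chart_def)
  then show ?thesis using c(2) e(2) by (intro exI[of _ "\<lparr>tchart = (fst c \<inter> proj K -` W, snd c), bchart = c0, aframe = e\<rparr>"]) auto
qed

end

section \<open>Canonical bases of the prolongation\<close>

context fibred
begin

lemma canonicalD:
  assumes "canonical K b"
  shows "tchart b \<in> AT" "bchart b \<in> AB" "open (cdom b)"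
    "m \<in> cdom b \<Longrightarrow> proj K m \<in> fst (bchart b)"
    "m \<in> cdom b \<Longrightarrow> fst (snd (tchart b) m) = snd (bchart b) (proj K m)"
  using assms is_chartD(1)[OF T.chart] by (auto simp: canonical_def fibred_chart_def)

lemma canonical_frame:
  assumes "canonical K b"
  obtains W where "local_frame AB (alg K) W (aframe b)" "proj K ` cdom b \<subseteq> W" "open W"
proof -
  obtain W where W: "local_frame AB (alg K) W (aframe b)" "proj K ` cdom b \<subseteq> W"
    using assms by (auto simp: canonical_def)
  moreover have "open W" using W(1) by (simp add: local_frame_def smooth_section_def)
  ultimately show ?thesis using that by blast
qed

lemma alg_basis:
  assumes "canonical K b" "m \<in> cdom b"
  shows "basis_of (fibre (alg K) (proj K m)) (\<lambda>\<alpha>. aframe b \<alpha> (proj K m))"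
proof -
  obtain W where "local_frame AB (alg K) W (aframe b)" "proj K ` cdom b \<subseteq> W"
    using canonical_frame[OF assms(1)] by metis
  then show ?thesis using assms(2) by (auto simp: local_frame_def)
qed

text \<open>In fibred charts the projection is \<open>fst\<close>, hence so is its
  differential.\<close>

lemma pushforward_tvec:
  assumes c: "fibred_chart K c c0" and m: "m \<in> fst c"
  shows "pushforward AB (proj K) m (tvec AT c m u) = tvec AB c0 (proj K m) (fst u)"
proof
  fix h
  have c': "c \<in> AT" "c0 \<in> AB" "\<And>q. q \<in> fst c \<Longrightarrow> proj K q \<in> fst c0"
    "\<And>q. q \<in> fst c \<Longrightarrow> fst (snd c q) = snd c0 (proj K q)"
    using c by (auto simp: fibred_chart_def)
  note cc = T.chart[OF c'(1)] and cc0 = B.chart[OF c'(2)]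
  show "pushforward AB (proj K) m (tvec AT c m u) h = tvec AB c0 (proj K m) (fst u) h"
  proof (cases "smooth_near AB (proj K m) h")
    case True
    then obtain W where W: "proj K m \<in> W" "smooth_fun AB W h" by (auto simp: smooth_near_def)
    have near: "smooth_near AT m (h \<circ> proj K)"
      unfolding smooth_near_def o_def
      by (rule exI[of _ "proj K -` W"]) (use W smooth_fun_proj in auto)
    define D where "D = frechet_derivative (h \<circ> chart_inv c0) (at (snd c0 (proj K m)))"
    have 1: "(fst has_derivative fst) (at (snd c m))"
      by (rule bounded_linear_imp_has_derivative[OF bounded_linear_fst])
    have 2: "((h \<circ> chart_inv c0) has_derivative D) (at (fst (snd c m)))"
      unfolding D_def c'(4)[OF m] by (rule B.smooth_near_has_derivative[OF True c'(2) c'(3)[OF m]])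
    have "((h \<circ> proj K) \<circ> chart_inv c has_derivative (\<lambda>u. D (fst u))) (at (snd c m))"
    proof (rule has_derivative_transform_within_open[OF has_derivative_compose[OF 1 2] is_chartD(2)[OF cc]])
      show "snd c m \<in> snd c ` fst c" using m by blast
      fix y assume "y \<in> snd c ` fst c"
      then obtain q where q: "q \<in> fst c" "y = snd c q" by blast
      then show "(h \<circ> chart_inv c0) (fst y) = ((h \<circ> proj K) \<circ> chart_inv c) y"
        by (simp add: c'(4) chart_inv_left[OF cc] chart_inv_left[OF cc0] c'(3))
    qed
    from T.tvec_eqI[OF near this] show ?thesis
      by (simp add: pushforward_def germwise_def True B.tvec_apply D_def)
  qed (simp add: pushforward_def germwise_def B.tvec_not_smooth)
qed

lemma alg_fibre_subspace: "subspace (fibre (alg K) x)"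
proof -
  have "x \<in> (\<Union>(W, e)\<in>frames (alg K). W)" using alg_bundle by (simp add: vector_bundle_def)
  then obtain W e where e: "(W, e) \<in> frames (alg K)" "x \<in> W" by auto
  then have "local_frame AB (alg K) W e" using alg_bundle by (auto simp: vector_bundle_def)
  then have "basis_of (fibre (alg K) x) (\<lambda>i. e i x)" using e(2) by (simp add: local_frame_def)
  then show ?thesis by (rule basis_of_subspace)
qed

lemma anchor_tangent: "a \<in> fibre (alg K) x \<Longrightarrow> anchor K x a \<in> tangent_space AB x"
  and anchor_add: "a \<in> fibre (alg K) x \<Longrightarrow> a' \<in> fibre (alg K) x \<Longrightarrow> anchor K x (a + a') = anchor K x a + anchor K x a'"
  and anchor_scale: "a \<in> fibre (alg K) x \<Longrightarrow> anchor K x (r *\<^sub>R a) = r *\<^sub>R anchor K x a"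
  using anchor_morphism by (auto simp: bundle_morphism_def tangent_bundle_def)

lemma anchor_sum:
  assumes "\<And>l. w l \<in> fibre (alg K) x"
  shows "anchor K x (\<Sum>l\<in>I. z l *\<^sub>R w l) = (\<Sum>l\<in>I. z l *\<^sub>R anchor K x (w l))"
proof -
  note s = alg_fibre_subspace[of x]
  have 0: "anchor K x 0 = 0" using anchor_scale[OF subspace_0[OF s], of 0] by simp
  show ?thesis
  proof (induction I rule: infinite_finite_induct)
    case (insert i I)
    have "(\<Sum>l\<in>I. z l *\<^sub>R w l) \<in> fibre (alg K) x"
      by (intro subspace_sum[OF s] subspace_scale[OF s] assms)
    then show ?case using insert
      by (simp add: anchor_add anchor_scale assms subspace_scale[OF s])
  qed (simp_all add: 0)
qed

lemma anchor_frame: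
  assumes "canonical K b" "m \<in> cdom b"
  shows "anchor K (proj K m) (aframe b \<alpha> (proj K m)) =
    tvec AB (bchart b) (proj K m) (\<chi> i. anchor_coeff K b \<alpha> i (proj K m))"
proof -
  have c0: "bchart b \<in> AB" "proj K m \<in> fst (bchart b)" using canonicalD assms by blast+
  have "anchor K (proj K m) (aframe b \<alpha> (proj K m)) \<in> tangent_space AB (proj K m)"
    by (rule anchor_tangent[OF basis_of_in[OF alg_basis[OF assms]]])
  then obtain u where u: "anchor K (proj K m) (aframe b \<alpha> (proj K m)) = tvec AB (bchart b) (proj K m) u"
    unfolding B.tangent_space_chart[OF c0] by blast
  have "anchor_coeff K b \<alpha> i (proj K m) = u $ i" for i
    using B.tvec_coord[OF c0 bounded_linear_vec_nth[of i]] by (simp add: anchor_coeff_def u)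
  then have "u = (\<chi> i. anchor_coeff K b \<alpha> i (proj K m))" by (simp add: vec_eq_iff)
  then show ?thesis using u by simp
qed

lemma sum_axis_fst: "(\<Sum>i\<in>UNIV. a i *\<^sub>R (axis i (1::real), 0::real^'k)) = (\<chi> i. a i, 0)"
  by (simp add: prod_eq_iff fst_sum snd_sum sum_axis)

lemma sum_axis_snd: "(\<Sum>i\<in>UNIV. a i *\<^sub>R (0::real^'n, axis i (1::real))) = (0, \<chi> i. a i)"
  by (simp add: prod_eq_iff fst_sum snd_sum sum_axis)

lemma Xc_eq:
  assumes "canonical K b" "m \<in> cdom b"
  shows "Xc K b \<alpha> m = (aframe b \<alpha> (proj K m), tvec AT (tchart b) m (\<chi> i. anchor_coeff K b \<alpha> i (proj K m), 0))"
proof -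
  note lin = T.linear_tvec[OF canonicalD(1)[OF assms(1)] assms(2)]
  show ?thesis
    unfolding Xc_def sum_axis_fst[symmetric] linear_sum[OF lin] linear_scale[OF lin] ..
qed

definition comb :: "('m, 'p, 'v, 'n, 'k) canon \<Rightarrow> 'p \<Rightarrow> ('k \<Rightarrow> real) \<Rightarrow> ('k \<Rightarrow> real) \<Rightarrow> ('p, 'v) pvec" where
  "comb b m a u = (\<Sum>\<alpha>\<in>UNIV. a \<alpha> *\<^sub>R Xc K b \<alpha> m) + (\<Sum>\<beta>\<in>UNIV. u \<beta> *\<^sub>R Vc K (tchart b) \<beta> m)"

text \<open>Reads the component along X_\<alpha> off the algebroid part alone, because vertical
  vectors have algebroid part 0.\<close>

definition base_coeff :: "('m, 'p, 'v, 'n, 'k) canon \<Rightarrow> 'p \<Rightarrow> ('p, 'v) pvec \<Rightarrow> 'k \<Rightarrow> real" where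
  "base_coeff b m w \<alpha> = frame_coeff (aframe b) (proj K m) (fst w) \<alpha>"

text \<open>Applying the tangent part to y^\<beta> gives the component along V_\<beta>, because
  X_\<alpha> annihilates the fibre coordinates. Defined this way the component is additive on all
  pairs, without membership conditions.\<close>

definition vert_coeff :: "('m, 'p, 'v, 'n, 'k) canon \<Rightarrow> ('p, 'v) pvec \<Rightarrow> 'k \<Rightarrow> real" where
  "vert_coeff b w \<beta> = snd w (ycoord (tchart b) \<beta>)"

lemma comb_eq:
  assumes "canonical K b" "m \<in> cdom b"
  shows "comb b m a u = (\<Sum>\<alpha>\<in>UNIV. a \<alpha> *\<^sub>R aframe b \<alpha> (proj K m),
     tvec AT (tchart b) m (\<Sum>\<alpha>\<in>UNIV. a \<alpha> *\<^sub>R (\<chi> i. anchor_coeff K b \<alpha> i (proj K m)), \<chi> \<beta>. u \<beta>))"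
proof -
  note lin = T.linear_tvec[OF canonicalD(1)[OF assms(1)] assms(2)]
  have "(\<Sum>\<alpha>\<in>UNIV. a \<alpha> *\<^sub>R (\<chi> i. anchor_coeff K b \<alpha> i (proj K m)), \<chi> \<beta>. u \<beta>)
      = (\<Sum>\<alpha>\<in>UNIV. a \<alpha> *\<^sub>R (\<chi> i. anchor_coeff K b \<alpha> i (proj K m), 0)) + (\<Sum>\<beta>\<in>UNIV. u \<beta> *\<^sub>R (0, axis \<beta> 1))"
    unfolding sum_axis_snd by (simp add: prod_eq_iff fst_sum snd_sum)
  then have "tvec AT (tchart b) m (\<Sum>\<alpha>\<in>UNIV. a \<alpha> *\<^sub>R (\<chi> i. anchor_coeff K b \<alpha> i (proj K m)), \<chi> \<beta>. u \<beta>)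
      = (\<Sum>\<alpha>\<in>UNIV. a \<alpha> *\<^sub>R tvec AT (tchart b) m (\<chi> i. anchor_coeff K b \<alpha> i (proj K m), 0))
        + (\<Sum>\<beta>\<in>UNIV. u \<beta> *\<^sub>R tvec AT (tchart b) m (0, axis \<beta> 1))"
    by (simp only: linear_add[OF lin] linear_sum[OF lin] linear_scale[OF lin])
  then show ?thesis
    by (simp add: comb_def Xc_eq[OF assms] Vc_def prod_eq_iff fst_sum snd_sum)
qed

lemma TT_iff: "w \<in> TT K m \<longleftrightarrow> fst w \<in> fibre (alg K) (proj K m) \<and> snd w \<in> tangent_space AT m \<and>
    anchor K (proj K m) (fst w) = pushforward AB (proj K) m (snd w)"
  by (cases w) (simp add: prol_def prol_fibre_def)

lemma VV_iff: "w \<in> VV K m \<longleftrightarrow> w \<in> TT K m \<and> fst w = 0"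
  by (simp add: vert_def prol_def)

lemma comb_TT:
  assumes "canonical K b" "m \<in> cdom b"
  shows "comb b m a u \<in> TT K m"
proof -
  note c = canonicalD[OF assms(1)]
  note s = alg_fibre_subspace[of "proj K m"]
  have e: "aframe b \<alpha> (proj K m) \<in> fibre (alg K) (proj K m)" for \<alpha>
    by (rule basis_of_in[OF alg_basis[OF assms]])
  note lin = B.linear_tvec[OF c(2) c(4)[OF assms(2)]]
  have fc: "fibred_chart K (tchart b) (bchart b)" using assms(1) by (simp add: canonical_def)
  show ?thesis
    unfolding TT_iff comb_eq[OF assms] fst_conv snd_conv pushforward_tvec[OF fc assms(2)]
      anchor_sum[OF e] anchor_frame[OF assms]
    using T.tangent_space_chart[OF c(1) assms(2)]
    by (auto intro!: subspace_sum[OF s] subspace_scale[OF s] e simp: linear_sum[OF lin] linear_scale[OF lin])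
qed

lemma base_coeff_comb:
  assumes "canonical K b" "m \<in> cdom b"
  shows "base_coeff b m (comb b m a u) \<alpha> = a \<alpha>"
  unfolding base_coeff_def comb_eq[OF assms] fst_conv
  by (rule frame_coeff_sum[where e = "aframe b" and x = "proj K m"]) (rule alg_basis[OF assms])

lemma bounded_linear_snd_nth: "bounded_linear (\<lambda>y::'x::real_normed_vector \<times> (real^'k). snd y $ \<beta>)"
  by (rule bounded_linear_compose[OF bounded_linear_vec_nth bounded_linear_snd])

lemma tvec_ycoord:
  assumes "c \<in> AT" "m \<in> fst c"
  shows "tvec AT c m u (ycoord c \<beta>) = snd u $ \<beta>"
  using T.tvec_coord[OF assms bounded_linear_snd_nth] by (simp add: ycoord_def[abs_def])

lemma vert_coeff_comb:
  assumes "canonical K b" "m \<in> cdom b"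
  shows "vert_coeff b (comb b m a u) \<beta> = u \<beta>"
  by (simp add: vert_coeff_def comb_eq[OF assms] tvec_ycoord[OF canonicalD(1)[OF assms(1)] assms(2)])

text \<open>Once the algebroid part is given, the condition that its anchor equals the pushforward
  of the tangent part fixes the base components of the latter; only the k fibre components stay
  free.\<close>

lemma TT_obtain_comb:
  assumes b: "canonical K b" "m \<in> cdom b" and w: "w \<in> TT K m"
  obtains a u where "w = comb b m a u"
proof -
  note c = canonicalD[OF b(1)]
  note ab = alg_basis[OF b]
  have fc: "fibred_chart K (tchart b) (bchart b)" using b(1) by (simp add: canonical_def)
  have e: "aframe b \<alpha> (proj K m) \<in> fibre (alg K) (proj K m)" for \<alpha>
    by (rule basis_of_in[OF ab])
  obtain a where a: "fst w = (\<Sum>\<alpha>\<in>UNIV. a \<alpha> *\<^sub>R aframe b \<alpha> (proj K m))"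
    by (rule basis_of_expand[OF ab]) (use w in \<open>auto simp: TT_iff\<close>)
  obtain u where u: "snd w = tvec AT (tchart b) m u"
    using w T.tangent_space_chart[OF c(1) b(2)] by (auto simp: TT_iff)
  note lin = B.linear_tvec[OF c(2) c(4)[OF b(2)]]
  let ?r = "\<Sum>\<alpha>\<in>UNIV. a \<alpha> *\<^sub>R (\<chi> i. anchor_coeff K b \<alpha> i (proj K m))"
  have "tvec AB (bchart b) (proj K m) (fst u) = tvec AB (bchart b) (proj K m) ?r"
    using w by (simp add: TT_iff a u pushforward_tvec[OF fc b(2)] anchor_sum[OF e] anchor_frame[OF b]
        linear_sum[OF lin] linear_scale[OF lin])
  then have "fst u $ i = ?r $ i" for i
    using B.tvec_coord[OF c(2) c(4)[OF b(2)] bounded_linear_vec_nth[of i], of "fst u"]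
      B.tvec_coord[OF c(2) c(4)[OF b(2)] bounded_linear_vec_nth[of i], of ?r] by (simp only:)
  then have "fst u = ?r" by (simp add: vec_eq_iff)
  then have "w = comb b m a (vec_nth (snd u))"
    unfolding comb_eq[OF b] by (simp add: prod_eq_iff a u flip: \<open>fst u = ?r\<close>)
  then show ?thesis by (rule that)
qed

lemma TT_expand:
  assumes "canonical K b" "m \<in> cdom b" "w \<in> TT K m"
  shows "comb b m (base_coeff b m w) (vert_coeff b w) = w"
proof -
  obtain a u where w: "w = comb b m a u" by (rule TT_obtain_comb[OF assms])
  have "base_coeff b m w = a" "vert_coeff b w = u"
    by (simp_all add: w fun_eq_iff base_coeff_comb[OF assms(1,2)] vert_coeff_comb[OF assms(1,2)])
  then show ?thesis using w by simp
qed

lemma comb_add: "comb b m a u + comb b m a' u' = comb b m (\<lambda>\<alpha>. a \<alpha> + a' \<alpha>) (\<lambda>\<alpha>. u \<alpha> + u' \<alpha>)"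
  by (simp add: comb_def scaleR_add_left sum.distrib algebra_simps)

lemma comb_scale: "r *\<^sub>R comb b m a u = comb b m (\<lambda>\<alpha>. r * a \<alpha>) (\<lambda>\<alpha>. r * u \<alpha>)"
  by (simp add: comb_def scaleR_add_right scaleR_sum_right)

lemma comb_zero: "comb b m (\<lambda>_. 0) (\<lambda>_. 0) = 0"
  by (simp add: comb_def)

lemma TT_subspace: "subspace (TT K m)"
proof -
  obtain b where b: "canonical K b" "m \<in> cdom b" using canonical_ex by blast
  show ?thesis
  proof (rule subspaceI)
    show "0 \<in> TT K m" using comb_TT[OF b, of "\<lambda>_. 0" "\<lambda>_. 0"] by (simp add: comb_zero)
    fix x y r assume x: "x \<in> TT K m"
    obtain a u where xa: "x = comb b m a u" by (rule TT_obtain_comb[OF b x])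
    show "r *\<^sub>R x \<in> TT K m" unfolding xa comb_scale by (rule comb_TT[OF b])
    assume y: "y \<in> TT K m"
    obtain a' u' where ya: "y = comb b m a' u'" by (rule TT_obtain_comb[OF b y])
    show "x + y \<in> TT K m" unfolding xa ya comb_add by (rule comb_TT[OF b])
  qed
qed

lemma VV_subspace: "subspace (VV K m)"
  by (rule subspaceI) (auto simp: VV_iff subspace_0[OF TT_subspace] subspace_add[OF TT_subspace] subspace_scale[OF TT_subspace])

lemma VV_TT: "w \<in> VV K m \<Longrightarrow> w \<in> TT K m"
  by (simp add: VV_iff)

lemma comb_unit:
  "Xc K b \<alpha> m = comb b m (\<lambda>\<gamma>. if \<gamma> = \<alpha> then 1 else 0) (\<lambda>_. 0)"
  "Vc K (tchart b) \<alpha> m = comb b m (\<lambda>_. 0) (\<lambda>\<gamma>. if \<gamma> = \<alpha> then 1 else 0)"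
  by (simp_all add: comb_def if_distrib[of "\<lambda>r. r *\<^sub>R _"] cong: if_cong)

lemma Xc_TT: "canonical K b \<Longrightarrow> m \<in> cdom b \<Longrightarrow> Xc K b \<alpha> m \<in> TT K m"
  unfolding comb_unit by (rule comb_TT)

lemma Vc_VV: "canonical K b \<Longrightarrow> m \<in> cdom b \<Longrightarrow> Vc K (tchart b) \<alpha> m \<in> VV K m"
  by (simp add: VV_iff comb_unit(2) comb_TT) (simp add: comb_unit(2)[symmetric] Vc_def)

lemmas Vc_TT = VV_TT[OF Vc_VV]

lemma base_coeff_VV: "w \<in> VV K m \<Longrightarrow> base_coeff b m w \<alpha> = 0"
  by (simp add: VV_iff base_coeff_def frame_coeff_zero)

lemma VV_expand:
  assumes "canonical K b" "m \<in> cdom b" "w \<in> VV K m"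
  shows "(\<Sum>\<beta>\<in>UNIV. vert_coeff b w \<beta> *\<^sub>R Vc K (tchart b) \<beta> m) = w"
  using TT_expand[OF assms(1,2) VV_TT[OF assms(3)]] by (simp add: comb_def base_coeff_VV[OF assms(3)])

lemma VV_sum_Vc: "canonical K b \<Longrightarrow> m \<in> cdom b \<Longrightarrow> (\<Sum>\<beta>\<in>UNIV. u \<beta> *\<^sub>R Vc K (tchart b) \<beta> m) \<in> VV K m"
  by (intro subspace_sum[OF VV_subspace] subspace_scale[OF VV_subspace] Vc_VV)

lemma vert_coeff_sum_Vc:
  assumes "canonical K b" "m \<in> cdom b"
  shows "vert_coeff b (\<Sum>\<beta>\<in>UNIV. u \<beta> *\<^sub>R Vc K (tchart b) \<beta> m) \<gamma> = u \<gamma>"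
  using vert_coeff_comb[OF assms, of "\<lambda>_. 0" u \<gamma>] by (simp add: comb_def)

lemma vert_coeff_add: "vert_coeff b (v + w) \<beta> = vert_coeff b v \<beta> + vert_coeff b w \<beta>"
  by (simp add: vert_coeff_def)

lemma vert_coeff_scale: "vert_coeff b (r *\<^sub>R w) \<beta> = r * vert_coeff b w \<beta>"
  by (simp add: vert_coeff_def scaleR_fun_def)

lemma base_coeff_add:
  assumes "canonical K b" "m \<in> cdom b" "v \<in> TT K m" "w \<in> TT K m"
  shows "base_coeff b m (v + w) \<alpha> = base_coeff b m v \<alpha> + base_coeff b m w \<alpha>"
  unfolding base_coeff_def fst_add
  by (rule frame_coeff_add[where F = "fibre (alg K) (proj K m)"]) (use alg_basis assms TT_iff in auto)

lemma base_coeff_scale: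
  assumes "canonical K b" "m \<in> cdom b" "w \<in> TT K m"
  shows "base_coeff b m (r *\<^sub>R w) \<alpha> = r * base_coeff b m w \<alpha>"
  unfolding base_coeff_def fst_scaleR
  by (rule frame_coeff_scale[where F = "fibre (alg K) (proj K m)"]) (use alg_basis assms TT_iff in auto)

lemma sum_case_sum: "(\<Sum>j\<in>UNIV. c j *\<^sub>R (case_sum X V j :: 'z::real_vector)) =
    (\<Sum>\<alpha>\<in>UNIV. c (Inl \<alpha>) *\<^sub>R X \<alpha>) + (\<Sum>\<beta>\<in>UNIV. c (Inr \<beta>) *\<^sub>R V \<beta>)"
  for c :: "'k + 'k \<Rightarrow> real"
  by (simp add: UNIV_Plus_UNIV[symmetric] sum.Plus del: UNIV_Plus_UNIV)

lemma case_sum_app: "case_sum X V j m = case_sum (\<lambda>\<alpha>. X \<alpha> m) (\<lambda>\<beta>. V \<beta> m) j"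
  by (simp split: sum.split)

lemma prol_basis:
  assumes b: "canonical K b" "m \<in> cdom b"
  shows "basis_of (TT K m) (\<lambda>j. case_sum (Xc K b) (Vc K (tchart b)) j m)"
proof -
  have s: "(\<Sum>j\<in>UNIV. c j *\<^sub>R case_sum (Xc K b) (Vc K (tchart b)) j m) = comb b m (\<lambda>\<alpha>. c (Inl \<alpha>)) (\<lambda>\<beta>. c (Inr \<beta>))" for c
    unfolding case_sum_app sum_case_sum comb_def by simp
  show ?thesis
  proof (rule basis_ofI)
    have "\<exists>c. w = comb b m (\<lambda>\<alpha>. c (Inl \<alpha>)) (\<lambda>\<beta>. c (Inr \<beta>))" if w0: "w \<in> TT K m" for w
    proof -
      obtain a u where w: "w = comb b m a u" by (rule TT_obtain_comb[OF b w0])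
      then show ?thesis by (intro exI[of _ "case_sum a u"]) simp
    qed
    then show "TT K m = range (\<lambda>c. \<Sum>j\<in>UNIV. c j *\<^sub>R case_sum (Xc K b) (Vc K (tchart b)) j m)"
      unfolding s using comb_TT[OF b] by (intro equalityI subsetI) (simp only: image_iff bex_UNIV, blast)
    fix c :: "'k + 'k \<Rightarrow> real"
    assume "(\<Sum>j\<in>UNIV. c j *\<^sub>R case_sum (Xc K b) (Vc K (tchart b)) j m) = 0"
    then have z: "comb b m (\<lambda>\<alpha>. c (Inl \<alpha>)) (\<lambda>\<beta>. c (Inr \<beta>)) = comb b m (\<lambda>_. 0) (\<lambda>_. 0)" by (simp add: s comb_zero)
    have "c (Inl \<alpha>) = 0" for \<alpha>
      using base_coeff_comb[OF b, of "\<lambda>\<alpha>. c (Inl \<alpha>)" "\<lambda>\<beta>. c (Inr \<beta>)" \<alpha>] base_coeff_comb[OF b, of "\<lambda>_. 0" "\<lambda>_. 0" \<alpha>]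
      by (simp add: z)
    moreover have "c (Inr \<alpha>) = 0" for \<alpha>
      using vert_coeff_comb[OF b, of "\<lambda>\<alpha>. c (Inl \<alpha>)" "\<lambda>\<beta>. c (Inr \<beta>)" \<alpha>] vert_coeff_comb[OF b, of "\<lambda>_. 0" "\<lambda>_. 0" \<alpha>]
      by (simp add: z)
    ultimately show "\<forall>j. c j = 0" by (metis sum.exhaust)
  qed
qed

lemma frame_coeff_prol:
  assumes b: "canonical K b" "m \<in> cdom b" and w: "w \<in> TT K m"
  shows "frame_coeff (case_sum (Xc K b) (Vc K (tchart b))) m w (Inl \<alpha>) = base_coeff b m w \<alpha>"
    "frame_coeff (case_sum (Xc K b) (Vc K (tchart b))) m w (Inr \<alpha>) = vert_coeff b w \<alpha>"
proof -
  have s: "(\<Sum>j\<in>UNIV. case_sum (base_coeff b m w) (vert_coeff b w) j *\<^sub>R case_sum (Xc K b) (Vc K (tchart b)) j m) = w"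
    using TT_expand[OF b w] unfolding case_sum_app sum_case_sum comb_def by simp
  have "frame_coeff (case_sum (Xc K b) (Vc K (tchart b))) m w j = case_sum (base_coeff b m w) (vert_coeff b w) j" for j
    using frame_coeff_sum[where e = "case_sum (Xc K b) (Vc K (tchart b))" and x = m, OF prol_basis[OF b],
        of "case_sum (base_coeff b m w) (vert_coeff b w)" j] unfolding s .
  then show "frame_coeff (case_sum (Xc K b) (Vc K (tchart b))) m w (Inl \<alpha>) = base_coeff b m w \<alpha>"
    "frame_coeff (case_sum (Xc K b) (Vc K (tchart b))) m w (Inr \<alpha>) = vert_coeff b w \<alpha>" by simp_all
qed

lemma vert_basis:
  assumes b: "canonical K b" "m \<in> cdom b"
  shows "basis_of (VV K m) (\<lambda>\<beta>. Vc K (tchart b) \<beta> m)"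
proof (rule basis_ofI)
  show "VV K m = range (\<lambda>c. \<Sum>\<beta>\<in>UNIV. c \<beta> *\<^sub>R Vc K (tchart b) \<beta> m)"
  proof
    show "VV K m \<subseteq> range (\<lambda>c. \<Sum>\<beta>\<in>UNIV. c \<beta> *\<^sub>R Vc K (tchart b) \<beta> m)"
    proof
      fix w assume "w \<in> VV K m"
      then show "w \<in> range (\<lambda>c. \<Sum>\<beta>\<in>UNIV. c \<beta> *\<^sub>R Vc K (tchart b) \<beta> m)"
        by (intro range_eqI[where x = "vert_coeff b w"] VV_expand[OF b, symmetric])
    qed
    show "range (\<lambda>c. \<Sum>\<beta>\<in>UNIV. c \<beta> *\<^sub>R Vc K (tchart b) \<beta> m) \<subseteq> VV K m"
      by (intro image_subsetI VV_sum_Vc[OF b])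
  qed
  show "\<forall>\<beta>. c \<beta> = 0" if "(\<Sum>\<beta>\<in>UNIV. c \<beta> *\<^sub>R Vc K (tchart b) \<beta> m) = 0" for c
    using vert_coeff_sum_Vc[OF b, of c] that by (simp add: vert_coeff_def)
qed

lemma frame_coeff_vert:
  assumes b: "canonical K b" "m \<in> cdom b" and w: "w \<in> VV K m"
  shows "frame_coeff (Vc K (tchart b)) m w \<beta> = vert_coeff b w \<beta>"
proof -
  have "frame_coeff (Vc K (tchart b)) m (\<Sum>\<beta>\<in>UNIV. vert_coeff b w \<beta> *\<^sub>R Vc K (tchart b) \<beta> m) \<beta> = vert_coeff b w \<beta>"
    by (rule frame_coeff_sum[where e = "Vc K (tchart b)" and x = m]) (rule vert_basis[OF b])
  then show ?thesis unfolding VV_expand[OF b w] .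
qed

end

section \<open>Smooth sections and the bracket of the prolongation\<close>

lemma sum_fun_apply: "(\<Sum>i\<in>I. f i) x = (\<Sum>i\<in>I. f i x)"
  for f :: "'i \<Rightarrow> 'a \<Rightarrow> 'b::comm_monoid_add"
  by (induction I rule: infinite_finite_induct) simp_all

context fibred
begin

section \<open>Sections of the prolongation and of its vertical bundle\<close>

abbreviation "PS \<equiv> smooth_section AT (prol K)"
abbreviation "VS \<equiv> smooth_section AT (vert K)"

text \<open>Replaces frame coefficients indexed by \<open>'k + 'k\<close> by the two explicit
  families of components, which behave well under sums, products and restriction.\<close>

lemma PS_iff:
  "PS U s \<longleftrightarrow> open U \<and> (\<forall>m\<in>U. s m \<in> TT K m) \<and>
    (\<forall>b \<alpha>. canonical K b \<longrightarrow> smooth_fun AT (U \<inter> cdom b) (\<lambda>m. base_coeff b m (s m) \<alpha>) \<and>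
       smooth_fun AT (U \<inter> cdom b) (\<lambda>m. vert_coeff b (s m) \<alpha>))"
  (is "?L \<longleftrightarrow> ?R")
proof
  assume L: ?L
  then have s: "open U" "\<forall>m\<in>U. s m \<in> TT K m" by (simp_all add: smooth_section_def)
  have "smooth_fun AT (U \<inter> cdom b) (\<lambda>m. base_coeff b m (s m) \<alpha>) \<and>
       smooth_fun AT (U \<inter> cdom b) (\<lambda>m. vert_coeff b (s m) \<alpha>)" if b: "canonical K b" for b \<alpha>
  proof -
    have fr: "(cdom b, case_sum (Xc K b) (Vc K (tchart b))) \<in> frames (prol K)"
      using b by (auto simp: prol_def)
    show ?thesis
      using T.smooth_fun_cong[OF smooth_sectionD[OF L fr, of "Inl \<alpha>"], of "\<lambda>m. base_coeff b m (s m) \<alpha>"]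
        T.smooth_fun_cong[OF smooth_sectionD[OF L fr, of "Inr \<alpha>"], of "\<lambda>m. vert_coeff b (s m) \<alpha>"]
        frame_coeff_prol[OF b] s(2) by simp
  qed
  then show ?R using s by blast
next
  assume R: ?R
  have "smooth_fun AT (U \<inter> W) (\<lambda>m. frame_coeff e m (s m) j)" if We: "(W, e) \<in> frames (prol K)" for W e j
  proof -
    obtain b where b: "canonical K b" "W = cdom b" "e = case_sum (Xc K b) (Vc K (tchart b))"
      using We by (auto simp: prol_def)
    show ?thesis
    proof (cases j)
      case (Inl \<alpha>)
      have "smooth_fun AT (U \<inter> cdom b) (\<lambda>m. base_coeff b m (s m) \<alpha>)" using R b(1) by blast
      then show ?thesis unfolding b(2,3) Inl
        by (rule T.smooth_fun_cong) (use frame_coeff_prol[OF b(1)] R in simp)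
    next
      case (Inr \<alpha>)
      have "smooth_fun AT (U \<inter> cdom b) (\<lambda>m. vert_coeff b (s m) \<alpha>)" using R b(1) by blast
      then show ?thesis unfolding b(2,3) Inr
        by (rule T.smooth_fun_cong) (use frame_coeff_prol[OF b(1)] R in simp)
    qed
  qed
  then show ?L using R unfolding smooth_section_def by blast
qed

lemma PS_open: "PS U s \<Longrightarrow> open U" and PS_TT: "PS U s \<Longrightarrow> m \<in> U \<Longrightarrow> s m \<in> TT K m"
  by (simp_all add: smooth_section_def)

lemma PS_base_coeff:
  "PS U s \<Longrightarrow> canonical K b \<Longrightarrow> smooth_fun AT (U \<inter> cdom b) (\<lambda>m. base_coeff b m (s m) \<alpha>)"
  and PS_vert_coeff:
  "PS U s \<Longrightarrow> canonical K b \<Longrightarrow> smooth_fun AT (U \<inter> cdom b) (\<lambda>m. vert_coeff b (s m) \<alpha>)"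
  unfolding PS_iff by blast+

text \<open>Lets vertical sections be inserted into the bracket, which is defined on sections of the
  whole prolongation.\<close>

lemma VS_iff: "VS U s \<longleftrightarrow> PS U s \<and> (\<forall>m\<in>U. s m \<in> VV K m)"
proof
  assume L: "VS U s"
  then have s: "open U" "\<forall>m\<in>U. s m \<in> VV K m" by (simp_all add: smooth_section_def)
  have "smooth_fun AT (U \<inter> cdom b) (\<lambda>m. base_coeff b m (s m) \<alpha>)" if b: "canonical K b" for b \<alpha>
    by (rule T.smooth_fun_cong[OF T.smooth_fun_const[of _ 0]])
      (use s canonicalD(3)[OF b] base_coeff_VV in auto)
  moreover have "smooth_fun AT (U \<inter> cdom b) (\<lambda>m. vert_coeff b (s m) \<alpha>)" if b: "canonical K b" for b \<alpha>
  proof -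
    have fr: "(cdom b, Vc K (tchart b)) \<in> frames (vert K)" using b by (auto simp: vert_def)
    show ?thesis
      by (rule T.smooth_fun_cong[OF smooth_sectionD[OF L fr, of \<alpha>]]) (use s frame_coeff_vert[OF b] in simp)
  qed
  ultimately show "PS U s \<and> (\<forall>m\<in>U. s m \<in> VV K m)" using s VV_TT unfolding PS_iff by blast
next
  assume R: "PS U s \<and> (\<forall>m\<in>U. s m \<in> VV K m)"
  have "smooth_fun AT (U \<inter> W) (\<lambda>m. frame_coeff e m (s m) j)" if We: "(W, e) \<in> frames (vert K)" for W e j
  proof -
    obtain b where b: "canonical K b" "W = cdom b" "e = Vc K (tchart b)"
      using We by (auto simp: vert_def)
    show ?thesis unfolding b(2,3)
      by (rule T.smooth_fun_cong[OF PS_vert_coeff[OF _ b(1)]]) (use frame_coeff_vert[OF b(1)] R in simp_all)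
  qed
  then show "VS U s" using R PS_open[of U s] unfolding smooth_section_def by blast
qed

lemma VS_PS: "VS U s \<Longrightarrow> PS U s" and VS_VV: "VS U s \<Longrightarrow> m \<in> U \<Longrightarrow> s m \<in> VV K m"
  by (simp_all add: VS_iff)

lemma PS_subset:
  assumes "PS U s" "open V" "V \<subseteq> U"
  shows "PS V s"
proof -
  have "smooth_fun AT (V \<inter> cdom b) f" if "smooth_fun AT (U \<inter> cdom b) f" "canonical K b" for b f
    by (rule T.smooth_fun_subset[OF that(1)]) (use assms canonicalD(3)[OF that(2)] in auto)
  moreover have "\<forall>m\<in>V. s m \<in> TT K m" using assms PS_TT by blast
  ultimately show ?thesis
    unfolding PS_iff using PS_base_coeff[OF assms(1)] PS_vert_coeff[OF assms(1)] assms(2) by blast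
qed

lemma PS_cong:
  assumes "PS U s" "\<And>m. m \<in> U \<Longrightarrow> s m = t m"
  shows "PS U t"
proof -
  have "smooth_fun AT (U \<inter> cdom b) (\<lambda>m. base_coeff b m (t m) \<alpha>)" if "canonical K b" for b \<alpha>
    by (rule T.smooth_fun_cong[OF PS_base_coeff[OF assms(1) that]]) (use assms in simp)
  moreover have "smooth_fun AT (U \<inter> cdom b) (\<lambda>m. vert_coeff b (t m) \<alpha>)" if "canonical K b" for b \<alpha>
    by (rule T.smooth_fun_cong[OF PS_vert_coeff[OF assms(1) that]]) (use assms in simp)
  ultimately show ?thesis using assms PS_open[OF assms(1)] PS_TT[OF assms(1)] unfolding PS_iff by simp
qed

lemma PS_local:
  assumes "open U" "\<And>m. m \<in> U \<Longrightarrow> \<exists>V. m \<in> V \<and> PS V s"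
  shows "PS U s"
proof -
  have "smooth_fun AT (U \<inter> cdom b) (\<lambda>m. base_coeff b m (s m) \<alpha>)" if "canonical K b" for b \<alpha>
  proof (rule T.smooth_fun_local)
    show "open (U \<inter> cdom b)" using assms(1) canonicalD(3)[OF that] by (rule open_Int)
    fix m assume m: "m \<in> U \<inter> cdom b"
    then obtain V where "m \<in> V" "PS V s" using assms(2) by blast
    then show "\<exists>V. m \<in> V \<and> smooth_fun AT V (\<lambda>m. base_coeff b m (s m) \<alpha>)"
      using PS_base_coeff[OF _ that] m by (intro exI[of _ "V \<inter> cdom b"]) simp
  qed
  moreover have "smooth_fun AT (U \<inter> cdom b) (\<lambda>m. vert_coeff b (s m) \<alpha>)" if "canonical K b" for b \<alpha>
  proof (rule T.smooth_fun_local)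
    show "open (U \<inter> cdom b)" using assms(1) canonicalD(3)[OF that] by (rule open_Int)
    fix m assume m: "m \<in> U \<inter> cdom b"
    then obtain V where "m \<in> V" "PS V s" using assms(2) by blast
    then show "\<exists>V. m \<in> V \<and> smooth_fun AT V (\<lambda>m. vert_coeff b (s m) \<alpha>)"
      using PS_vert_coeff[OF _ that] m by (intro exI[of _ "V \<inter> cdom b"]) simp
  qed
  moreover have "\<forall>m\<in>U. s m \<in> TT K m" using assms(2) PS_TT by blast
  ultimately show ?thesis using assms(1) unfolding PS_iff by simp
qed

lemma PS_add:
  assumes "PS U s" "PS U t"
  shows "PS U (\<lambda>m. s m + t m)"
proof -
  have "smooth_fun AT (U \<inter> cdom b) (\<lambda>m. base_coeff b m (s m + t m) \<alpha>)" if "canonical K b" for b \<alpha>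
    by (rule T.smooth_fun_cong[OF T.smooth_fun_add[OF PS_base_coeff[OF assms(1) that] PS_base_coeff[OF assms(2) that]]])
      (use base_coeff_add[OF that] PS_TT assms in auto)
  moreover have "smooth_fun AT (U \<inter> cdom b) (\<lambda>m. vert_coeff b (s m + t m) \<alpha>)" if "canonical K b" for b \<alpha>
    unfolding vert_coeff_add
    by (rule T.smooth_fun_add[OF PS_vert_coeff[OF assms(1) that] PS_vert_coeff[OF assms(2) that]])
  ultimately show ?thesis
    using PS_open[OF assms(1)] PS_TT[OF assms(1)] PS_TT[OF assms(2)] subspace_add[OF TT_subspace]
    unfolding PS_iff by simp
qed

lemma PS_scale:
  assumes "smooth_fun AT U f" "PS U s"
  shows "PS U (\<lambda>m. f m *\<^sub>R s m)"
proof -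
  have f: "smooth_fun AT (U \<inter> cdom b) f" if "canonical K b" for b
    by (rule T.smooth_fun_subset[OF assms(1)]) (use PS_open[OF assms(2)] canonicalD(3)[OF that] in auto)
  have "smooth_fun AT (U \<inter> cdom b) (\<lambda>m. base_coeff b m (f m *\<^sub>R s m) \<alpha>)" if "canonical K b" for b \<alpha>
    by (rule T.smooth_fun_cong[OF T.smooth_fun_mult[OF f[OF that] PS_base_coeff[OF assms(2) that]]])
      (use base_coeff_scale[OF that] PS_TT assms in auto)
  moreover have "smooth_fun AT (U \<inter> cdom b) (\<lambda>m. vert_coeff b (f m *\<^sub>R s m) \<alpha>)" if "canonical K b" for b \<alpha>
    unfolding vert_coeff_scale by (rule T.smooth_fun_mult[OF f[OF that] PS_vert_coeff[OF assms(2) that]])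
  ultimately show ?thesis
    using PS_open[OF assms(2)] PS_TT[OF assms(2)] subspace_scale[OF TT_subspace] unfolding PS_iff by simp
qed

lemma PS_zero: "open U \<Longrightarrow> PS U (\<lambda>m. 0)"
  unfolding PS_iff
  using canonicalD(3)
  by (auto simp: subspace_0[OF TT_subspace] base_coeff_def vert_coeff_def frame_coeff_zero intro!: T.smooth_fun_const)

lemma PS_sum:
  assumes "open U" "\<And>i. i \<in> I \<Longrightarrow> PS U (s i)"
  shows "PS U (\<lambda>m. \<Sum>i\<in>I. s i m)"
  using assms(2)
  by (induction I rule: infinite_finite_induct) (auto intro: PS_zero PS_add assms(1))

lemma ycoord_smooth: "c \<in> AT \<Longrightarrow> smooth_fun AT (fst c) (ycoord c \<beta>)"
  using T.smooth_fun_coord[OF _ bounded_linear_snd_nth] by (simp add: ycoord_def[abs_def])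

text \<open>These functions are the frame coefficients of the smooth section rho(e_\<alpha>) of the
  tangent bundle in the coordinate frame, pulled back along the projection.\<close>

lemma anchor_coeff_smooth:
  assumes b: "canonical K b"
  shows "smooth_fun AT (cdom b) (\<lambda>m. anchor_coeff K b \<alpha> i (proj K m))"
proof -
  obtain W where W: "local_frame AB (alg K) W (aframe b)" "proj K ` cdom b \<subseteq> W" by (rule canonical_frame[OF b])
  let ?e = "\<lambda>i p. tvec AB (bchart b) p (axis i 1)"
  have s: "smooth_section AB (tangent_bundle AB) W (\<lambda>x. anchor K x (aframe b \<alpha> x))"
    using anchor_morphism W(1) by (simp add: bundle_morphism_def local_frame_def)
  have fr: "(fst (bchart b), ?e) \<in> frames (tangent_bundle AB)"
    using canonicalD(2)[OF b] by (simp add: tangent_bundle_def del: split_paired_Ex) blast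
  have "smooth_fun AT (cdom b) (\<lambda>m. frame_coeff ?e (proj K m) (anchor K (proj K m) (aframe b \<alpha> (proj K m))) i)"
    by (rule smooth_fun_proj'[OF smooth_sectionD[OF s fr] canonicalD(3)[OF b]])
      (use W(2) canonicalD(4)[OF b] in auto)
  then show ?thesis
  proof (rule T.smooth_fun_cong)
    fix m assume m: "m \<in> cdom b"
    note c0 = canonicalD(2)[OF b] canonicalD(4)[OF b m]
    note lin = B.linear_tvec[OF c0]
    have "anchor K (proj K m) (aframe b \<alpha> (proj K m)) = (\<Sum>i\<in>UNIV. anchor_coeff K b \<alpha> i (proj K m) *\<^sub>R ?e i (proj K m))"
      unfolding anchor_frame[OF b m] sum_axis[symmetric] by (simp add: linear_sum[OF lin] linear_scale[OF lin])
    then show "frame_coeff ?e (proj K m) (anchor K (proj K m) (aframe b \<alpha> (proj K m))) i = anchor_coeff K b \<alpha> i (proj K m)"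
      using frame_coeff_sum[where e = ?e and x = "proj K m", OF tangent_frame_basis[OF B.smooth_manifold c0]] by simp
  qed
qed

text \<open>Smoothness must be tested against every canonical basis \<open>b'\<close>. The
  components along its X come from a change of frame in the algebroid, those along its V from
  applying X_\<alpha> to the fibre coordinates of \<open>b'\<close>.\<close>

lemma Xc_smooth:
  assumes b: "canonical K b"
  shows "PS (cdom b) (Xc K b \<alpha>)"
proof -
  note c = canonicalD[OF b]
  obtain W where W: "local_frame AB (alg K) W (aframe b)" "proj K ` cdom b \<subseteq> W" by (rule canonical_frame[OF b])
  have "smooth_fun AT (cdom b \<inter> cdom b') (\<lambda>m. base_coeff b' m (Xc K b \<alpha> m) \<beta>)" if b': "canonical K b'" for b' \<beta>
  proof -
    obtain W' where W': "local_frame AB (alg K) W' (aframe b')" "proj K ` cdom b' \<subseteq> W'"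
      by (rule canonical_frame[OF b'])
    have "smooth_section AB (alg K) W (aframe b \<alpha>)" using W(1) by (simp add: local_frame_def)
    from smooth_fun_proj'[OF B.frame_coeff_smooth[OF alg_bundle W'(1) this, of \<beta>]
        open_Int[OF c(3) canonicalD(3)[OF b']]]
    show ?thesis using W(2) W'(2) by (auto simp: base_coeff_def Xc_def)
  qed
  moreover have "smooth_fun AT (cdom b \<inter> cdom b') (\<lambda>m. vert_coeff b' (Xc K b \<alpha> m) \<beta>)" if b': "canonical K b'" for b' \<beta>
  proof -
    let ?U = "cdom b \<inter> cdom b'"
    have o: "open ?U" using c(3) canonicalD(3)[OF b'] by (rule open_Int)
    have y: "smooth_fun AT ?U (ycoord (tchart b') \<beta>)"
      by (rule T.smooth_fun_subset[OF ycoord_smooth[OF canonicalD(1)[OF b']] o]) simp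
    have "smooth_fun AT ?U (\<lambda>m. \<Sum>i\<in>UNIV. anchor_coeff K b \<alpha> i (proj K m) *
        tvec AT (tchart b) m (axis i 1, 0) (ycoord (tchart b') \<beta>))"
    proof (intro T.smooth_fun_sum[OF o] T.smooth_fun_mult)
      show "smooth_fun AT ?U (\<lambda>m. anchor_coeff K b \<alpha> i (proj K m))" for i
        by (rule T.smooth_fun_subset[OF anchor_coeff_smooth[OF b] o]) simp
      show "smooth_fun AT ?U (\<lambda>m. tvec AT (tchart b) m (axis i 1, 0) (ycoord (tchart b') \<beta>))" for i
        by (rule T.smooth_fun_tvec[OF c(1) _ y]) simp
    qed
    then show ?thesis by (simp add: vert_coeff_def Xc_def sum_fun_apply scaleR_fun_def)
  qed
  ultimately show ?thesis unfolding PS_iff using c(3) Xc_TT[OF b] by simp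
qed

lemma Vc_smooth:
  assumes b: "canonical K b"
  shows "VS (cdom b) (Vc K (tchart b) \<alpha>)"
proof -
  note c = canonicalD[OF b]
  have o: "open (cdom b \<inter> cdom b')" if b': "canonical K b'" for b'
    using c(3) canonicalD(3)[OF b'] by (rule open_Int)
  have "smooth_fun AT (cdom b \<inter> cdom b') (\<lambda>m. base_coeff b' m (Vc K (tchart b) \<alpha> m) \<beta>)" if b': "canonical K b'" for b' \<beta>
    using T.smooth_fun_const[OF o[OF b'], of 0] by (simp add: base_coeff_def Vc_def frame_coeff_zero)
  moreover have "smooth_fun AT (cdom b \<inter> cdom b') (\<lambda>m. vert_coeff b' (Vc K (tchart b) \<alpha> m) \<beta>)" if b': "canonical K b'" for b' \<beta>
  proof -
    have y: "smooth_fun AT (cdom b \<inter> cdom b') (ycoord (tchart b') \<beta>)"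
      by (rule T.smooth_fun_subset[OF ycoord_smooth[OF canonicalD(1)[OF b']] o[OF b']]) simp
    have "smooth_fun AT (cdom b \<inter> cdom b') (\<lambda>m. tvec AT (tchart b) m (0, axis \<alpha> 1) (ycoord (tchart b') \<beta>))"
      by (rule T.smooth_fun_tvec[OF c(1) _ y]) simp
    then show ?thesis by (simp add: vert_coeff_def Vc_def)
  qed
  ultimately show ?thesis unfolding VS_iff PS_iff using c(3) Vc_TT[OF b] Vc_VV[OF b] by simp
qed

lemma snd_Vc_ycoord:
  assumes "canonical K b" "m \<in> cdom b"
  shows "snd (Vc K (tchart b) \<alpha> m) (ycoord (tchart b) \<beta>) = (if \<beta> = \<alpha> then 1 else 0)"
  using vert_coeff_comb[OF assms] by (simp add: comb_unit(2) vert_coeff_def)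

lemma snd_Xc_ycoord:
  assumes "canonical K b" "m \<in> cdom b"
  shows "snd (Xc K b \<alpha> m) (ycoord (tchart b) \<beta>) = 0"
  using vert_coeff_comb[OF assms] by (simp add: comb_unit(1) vert_coeff_def)

lemma snd_TT_tangent: "w \<in> TT K m \<Longrightarrow> snd w \<in> tangent_space AT m"
  by (simp add: TT_iff)

end

section \<open>The bracket of the prolongation\<close>

locale prolonged = fibred K AF
  for K :: "('m::t2_space, 'p::t2_space, 'v::real_vector, 'n::finite, 'k::finite) fibred_algebroid"
    and AF :: "('f::t2_space, real^'k) chart set" +
  fixes P :: "('p, 'v) pbracket"
  assumes prolongation: "prolongation_bracket K P"
begin

lemma bracket_axioms: "almost_lie_bracket AT (prol K) (\<lambda>m w. snd w) P"
  using prolongation by (simp add: prolongation_bracket_def)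

lemma
  assumes "PS U X" "PS U Y"
  shows P_smooth: "PS U (P X Y)"
    and P_antisym: "m \<in> U \<Longrightarrow> P X Y m = - P Y X m"
    and P_linear: "PS U Y' \<Longrightarrow> m \<in> U \<Longrightarrow> P X (\<lambda>q. a *\<^sub>R Y q + b *\<^sub>R Y' q) m = a *\<^sub>R P X Y m + b *\<^sub>R P X Y' m"
    and P_cong: "PS U Y' \<Longrightarrow> (\<And>x. x \<in> U \<Longrightarrow> Y' x = Y x) \<Longrightarrow> m \<in> U \<Longrightarrow> P X Y' m = P X Y m"
    and P_leibniz: "smooth_fun AT U f \<Longrightarrow> m \<in> U \<Longrightarrow> P X (\<lambda>q. f q *\<^sub>R Y q) m = f m *\<^sub>R P X Y m + snd (X m) f *\<^sub>R Y m"
proof -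
  note A = bracket_axioms[unfolded almost_lie_bracket_def, THEN spec, THEN spec, THEN spec, THEN mp, OF conjI[OF assms]]
  note A1 = A[THEN conjunct1] and A2 = A[THEN conjunct2, THEN conjunct1, THEN bspec]
    and A3 = A[THEN conjunct2, THEN conjunct2, THEN conjunct1, THEN spec, THEN mp]
    and A4 = A[THEN conjunct2, THEN conjunct2, THEN conjunct2, THEN spec, THEN mp, THEN bspec]
  show "PS U (P X Y)" by (rule A1)
  show "P X Y m = - P Y X m" if "m \<in> U" by (rule A2[OF that])
  show "P X (\<lambda>q. a *\<^sub>R Y q + b *\<^sub>R Y' q) m = a *\<^sub>R P X Y m + b *\<^sub>R P X Y' m" if "PS U Y'" "m \<in> U"
    by (rule A3[OF that(1), THEN conjunct1, THEN spec, THEN spec, THEN bspec, OF that(2)])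
  show "P X Y' m = P X Y m" if Y': "PS U Y'" "\<And>x. x \<in> U \<Longrightarrow> Y' x = Y x" and m: "m \<in> U"
    by (rule A3[OF Y'(1), THEN conjunct2, THEN mp, THEN bspec, OF _ m]) (use Y'(2) in blast)
  show "P X (\<lambda>q. f q *\<^sub>R Y q) m = f m *\<^sub>R P X Y m + snd (X m) f *\<^sub>R Y m" if "smooth_fun AT U f" "m \<in> U"
    by (rule A4[OF that])
qed

lemma P_sum:
  assumes X: "PS U X" and Y: "\<And>i. PS U (Y i)" and f: "\<And>i. smooth_fun AT U (f i)" and m: "m \<in> U"
  shows "P X (\<lambda>q. \<Sum>i\<in>I. f i q *\<^sub>R Y i q) m = (\<Sum>i\<in>I. f i m *\<^sub>R P X (Y i) m + snd (X m) (f i) *\<^sub>R Y i m)"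
proof -
  note o = PS_open[OF X]
  have z: "P X (\<lambda>q. 0) m = 0"
    using P_linear[OF X PS_zero[OF o] PS_zero[OF o] m, of 0 0] by simp
  show ?thesis
  proof (induction I rule: infinite_finite_induct)
    case (insert i I)
    have "P X (\<lambda>q. 1 *\<^sub>R (f i q *\<^sub>R Y i q) + 1 *\<^sub>R (\<Sum>i\<in>I. f i q *\<^sub>R Y i q)) m
        = 1 *\<^sub>R P X (\<lambda>q. f i q *\<^sub>R Y i q) m + 1 *\<^sub>R P X (\<lambda>q. \<Sum>i\<in>I. f i q *\<^sub>R Y i q) m"
      by (rule P_linear[OF X _ _ m]) (intro PS_scale PS_sum o Y f)+
    then show ?case using insert P_leibniz[OF X Y f m] by simp
  qed (simp_all add: z)
qed

text \<open>The bracket is one function serving all open sets, so sections may be shrunk to a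
  smaller domain and altered outside it.\<close>

lemma P_local:
  assumes "PS U X" "PS U Y" "PS V Y'" "open V" "V \<subseteq> U" "\<And>x. x \<in> V \<Longrightarrow> Y x = Y' x" "m \<in> V"
  shows "P X Y m = P X Y' m"
  by (rule P_cong[where U = V]) (use PS_subset[OF _ assms(4,5)] assms in auto)

lemma
  assumes "canonical K b" "m \<in> cdom b"
  shows P_Xc_Xc: "P (Xc K b \<alpha>) (Xc K b \<beta>) m = (\<Sum>\<gamma>\<in>UNIV. struct_coeff K b \<alpha> \<beta> \<gamma> (proj K m) *\<^sub>R Xc K b \<gamma> m)"
    and P_Xc_Vc: "P (Xc K b \<alpha>) (Vc K (tchart b) \<beta>) m = 0"
    and P_Vc_Vc: "P (Vc K (tchart b) \<alpha>) (Vc K (tchart b) \<beta>) m = 0"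
  using prolongation assms unfolding prolongation_bracket_def by blast+

text \<open>The axioms treat the second argument, whereas it is S, in the first one, whose
  components are known. Antisymmetry exchanges them, whence the overall minus sign; then the Leibniz
  rule applies to the components of S.\<close>

lemma P_comb:
  assumes b: "canonical K b" and m: "m \<in> cdom b" and S: "PS (cdom b) S" and X: "PS (cdom b) X"
  shows "P S X m = - ((\<Sum>\<alpha>\<in>UNIV. base_coeff b m (S m) \<alpha> *\<^sub>R P X (Xc K b \<alpha>) m)
      + (\<Sum>\<beta>\<in>UNIV. vert_coeff b (S m) \<beta> *\<^sub>R P X (Vc K (tchart b) \<beta>) m)
      + comb b m (\<lambda>\<alpha>. snd (X m) (\<lambda>q. base_coeff b q (S q) \<alpha>)) (\<lambda>\<beta>. snd (X m) (\<lambda>q. vert_coeff b (S q) \<beta>)))"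
proof -
  note o = canonicalD(3)[OF b]
  have s: "smooth_fun AT (cdom b) (\<lambda>q. base_coeff b q (S q) \<alpha>)" for \<alpha> using PS_base_coeff[OF S b] by simp
  have t: "smooth_fun AT (cdom b) (\<lambda>q. vert_coeff b (S q) \<alpha>)" for \<alpha> using PS_vert_coeff[OF S b] by simp
  note V = VS_PS[OF Vc_smooth[OF b]]
  let ?A = "\<lambda>q. \<Sum>\<alpha>\<in>UNIV. base_coeff b q (S q) \<alpha> *\<^sub>R Xc K b \<alpha> q"
  let ?B = "\<lambda>q. \<Sum>\<beta>\<in>UNIV. vert_coeff b (S q) \<beta> *\<^sub>R Vc K (tchart b) \<beta> q"
  have A: "PS (cdom b) ?A" by (intro PS_sum o PS_scale s Xc_smooth b)
  have B: "PS (cdom b) ?B" by (intro PS_sum o PS_scale t V)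
  have "P S X m = - P X S m" by (rule P_antisym[OF S X m])
  also have "P X S m = P X (\<lambda>q. 1 *\<^sub>R ?A q + 1 *\<^sub>R ?B q) m"
  proof (rule P_cong[OF X _ S _ m])
    show "PS (cdom b) (\<lambda>q. 1 *\<^sub>R ?A q + 1 *\<^sub>R ?B q)" using PS_add[OF A B] by simp
    show "S q = 1 *\<^sub>R ?A q + 1 *\<^sub>R ?B q" if "q \<in> cdom b" for q
      using TT_expand[OF b that PS_TT[OF S that]] by (simp add: comb_def)
  qed
  also have "\<dots> = P X ?A m + P X ?B m" using P_linear[OF X A B m, of 1 1] by simp
  finally show ?thesis
    by (simp add: P_sum[OF X Xc_smooth[OF b] s m] P_sum[OF X V t m] comb_def sum.distrib)
qed

lemma P_S_Vc:
  assumes b: "canonical K b" and m: "m \<in> cdom b" and S: "PS (cdom b) S"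
  shows "P S (Vc K (tchart b) \<beta>) m = - comb b m
      (\<lambda>\<alpha>. snd (Vc K (tchart b) \<beta> m) (\<lambda>q. base_coeff b q (S q) \<alpha>))
      (\<lambda>\<alpha>. snd (Vc K (tchart b) \<beta> m) (\<lambda>q. vert_coeff b (S q) \<alpha>))"
proof -
  note V = VS_PS[OF Vc_smooth[OF b]]
  have "P (Vc K (tchart b) \<beta>) (Xc K b \<alpha>) m = 0" for \<alpha>
    using P_antisym[OF V Xc_smooth[OF b] m] P_Xc_Vc[OF b m] by simp
  then show ?thesis
    unfolding P_comb[OF b m S V] by (simp add: P_Vc_Vc[OF b m])
qed

text \<open>Of the brackets of basis sections only [X_\<beta>, X_\<alpha>] contributes. The exchange
  of arguments in \<open>P_comb\<close> is the reason why \<beta> is the first index of the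
  structure function.\<close>

lemma P_S_Xc:
  assumes b: "canonical K b" and m: "m \<in> cdom b" and S: "PS (cdom b) S"
  shows "P S (Xc K b \<beta>) m = - comb b m
      (\<lambda>\<gamma>. (\<Sum>\<alpha>\<in>UNIV. base_coeff b m (S m) \<alpha> * struct_coeff K b \<beta> \<alpha> \<gamma> (proj K m))
         + snd (Xc K b \<beta> m) (\<lambda>q. base_coeff b q (S q) \<gamma>))
      (\<lambda>\<gamma>. snd (Xc K b \<beta> m) (\<lambda>q. vert_coeff b (S q) \<gamma>))"
proof -
  have "(\<Sum>\<alpha>\<in>UNIV. base_coeff b m (S m) \<alpha> *\<^sub>R P (Xc K b \<beta>) (Xc K b \<alpha>) m) =
      (\<Sum>\<gamma>\<in>UNIV. (\<Sum>\<alpha>\<in>UNIV. base_coeff b m (S m) \<alpha> * struct_coeff K b \<beta> \<alpha> \<gamma> (proj K m)) *\<^sub>R Xc K b \<gamma> m)"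
    unfolding P_Xc_Xc[OF b m] scaleR_sum_right scaleR_sum_left scaleR_scaleR by (rule sum.swap)
  also have "\<dots> = comb b m (\<lambda>\<gamma>. \<Sum>\<alpha>\<in>UNIV. base_coeff b m (S m) \<alpha> * struct_coeff K b \<beta> \<alpha> \<gamma> (proj K m)) (\<lambda>_. 0)"
    by (simp add: comb_def)
  finally show ?thesis
    unfolding P_comb[OF b m S Xc_smooth[OF b]] by (simp add: P_Xc_Vc[OF b m] comb_add)
qed

end

section \<open>Adapted canonical bases and the canonical connection\<close>

locale spray = prolonged K AF P
  for K :: "('m::t2_space, 'p::t2_space, 'v::real_vector, 'n::finite, 'k::finite) fibred_algebroid"
    and AF :: "('f::t2_space, real^'k) chart set" and P :: "('p, 'v) pbracket" +
  fixes S :: "('p, 'v) psection" and J :: "('p, 'v) pendo"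
  assumes semispray: "semispray K P S" and associated: "associated_tangent K P S J"
begin

lemma S_smooth: "open U \<Longrightarrow> PS U S"
  using semispray PS_subset[of UNIV S U] by (simp add: semispray_def)

lemma J_endo: "J \<in> endomorphisms AT (prol K)"
  and J_image: "J m ` TT K m = VV K m" and J_ker: "{w \<in> TT K m. J m w = 0} = VV K m"
  using associated unfolding associated_tangent_def almost_tangent_def by blast+

lemma J_spray: "VS U V \<Longrightarrow> m \<in> U \<Longrightarrow> J m (P S V m) = - V m"
  using associated unfolding associated_tangent_def by blast

lemma
  assumes "I \<in> endomorphisms AT E"
  shows endo_in: "w \<in> fibre E m \<Longrightarrow> I m w \<in> fibre E m"
    and endo_add: "w \<in> fibre E m \<Longrightarrow> w' \<in> fibre E m \<Longrightarrow> I m (w + w') = I m w + I m w'"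
    and endo_scale: "w \<in> fibre E m \<Longrightarrow> I m (r *\<^sub>R w) = r *\<^sub>R I m w"
    and endo_smooth: "smooth_section AT E U s \<Longrightarrow> smooth_section AT E U (\<lambda>m. I m (s m))"
    and endo_ext: "I m \<in> extensional (fibre E m)"
  using assms by (auto simp: endomorphisms_def bundle_morphism_def)

lemma endo_sum:
  assumes I: "I \<in> endomorphisms AT E" and sp: "subspace (fibre E m)" and w: "\<And>i. w i \<in> fibre E m"
  shows "I m (\<Sum>i\<in>A. z i *\<^sub>R w i) = (\<Sum>i\<in>A. z i *\<^sub>R I m (w i))"
proof -
  have 0: "I m 0 = 0" using endo_scale[OF I subspace_0[OF sp], of 0] by simp
  show ?thesis
  proof (induction A rule: infinite_finite_induct)
    case (insert i A)
    have "(\<Sum>i\<in>A. z i *\<^sub>R w i) \<in> fibre E m" by (intro subspace_sum[OF sp] subspace_scale[OF sp] w)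
    then show ?case using insert by (simp add: endo_add[OF I] endo_scale[OF I] subspace_scale[OF sp] w)
  qed (simp_all add: 0)
qed

lemma J_VV: "w \<in> TT K m \<Longrightarrow> J m w \<in> VV K m"
  using J_image by blast

lemma J_zero: "w \<in> VV K m \<Longrightarrow> J m w = 0"
  using J_ker by blast

lemma J_kerD: "w \<in> TT K m \<Longrightarrow> J m w = 0 \<Longrightarrow> w \<in> VV K m"
  using J_ker by blast

lemmas J_add = endo_add[OF J_endo] and J_scale = endo_scale[OF J_endo] and J_smooth = endo_smooth[OF J_endo]
  and J_sum = endo_sum[OF J_endo TT_subspace]

lemma J_comb:
  assumes "canonical K b" "m \<in> cdom b"
  shows "J m (comb b m a u) = (\<Sum>\<alpha>\<in>UNIV. a \<alpha> *\<^sub>R J m (Xc K b \<alpha> m))"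
proof -
  have "comb b m a u = (\<Sum>\<alpha>\<in>UNIV. a \<alpha> *\<^sub>R Xc K b \<alpha> m) + (\<Sum>\<beta>\<in>UNIV. u \<beta> *\<^sub>R Vc K (tchart b) \<beta> m)"
    by (simp add: comb_def)
  also have "J m \<dots> = J m (\<Sum>\<alpha>\<in>UNIV. a \<alpha> *\<^sub>R Xc K b \<alpha> m) + J m (\<Sum>\<beta>\<in>UNIV. u \<beta> *\<^sub>R Vc K (tchart b) \<beta> m)"
    by (intro J_add subspace_sum[OF TT_subspace] subspace_scale[OF TT_subspace] Xc_TT Vc_TT assms)
  also have "\<dots> = (\<Sum>\<alpha>\<in>UNIV. a \<alpha> *\<^sub>R J m (Xc K b \<alpha> m))"
    using J_zero[OF VV_sum_Vc[OF assms]] J_sum[OF Xc_TT[OF assms]] by simp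
  finally show ?thesis .
qed

lemma J_minus: "w \<in> TT K m \<Longrightarrow> J m (- w) = - J m w"
  using J_scale[of w m "-1"] by simp

text \<open>This is J [S, V_\<beta>] = - V_\<beta> in coordinates, since J sees only the
  X-components of the bracket. It makes the matrix of fibre derivatives of the X-components of S
  invertible.\<close>

lemma J_base_derivative:
  assumes b: "canonical K b" and m: "m \<in> cdom b"
  shows "(\<Sum>\<alpha>\<in>UNIV. snd (Vc K (tchart b) \<beta> m) (\<lambda>q. base_coeff b q (S q) \<alpha>) *\<^sub>R J m (Xc K b \<alpha> m))
    = Vc K (tchart b) \<beta> m"
proof -
  have "J m (P S (Vc K (tchart b) \<beta>) m) = - Vc K (tchart b) \<beta> m"
    by (rule J_spray[OF Vc_smooth[OF b] m])
  then show ?thesis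
    unfolding P_S_Vc[OF b m S_smooth[OF canonicalD(3)[OF b]]] J_minus[OF comb_TT[OF b m]] J_comb[OF b m] by simp
qed

text \<open>If the X-components of S are the fibre coordinates, their fibre derivatives form the
  identity matrix, and \<open>J_base_derivative\<close> yields J X_\<alpha> = V_\<alpha>.
  Adaptedness is thereby reduced to a choice of fibre coordinates.\<close>

lemma adapted_iff:
  "adapted K S J b \<longleftrightarrow>
    canonical K b \<and> (\<forall>m\<in>cdom b. \<forall>\<alpha>. base_coeff b m (S m) \<alpha> = ycoord (tchart b) \<alpha> m)"
proof (cases "canonical K b")
  case b: True
  have S: "S m \<in> TT K m" for m using PS_TT[OF S_smooth[OF open_UNIV]] by simp
  have sc: "spray_coeff K S b \<beta> m = vert_coeff b (S m) \<beta>" if "m \<in> cdom b" for m \<beta>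
    by (simp add: spray_coeff_def frame_coeff_prol[OF b that S])
  show ?thesis
  proof
    assume L: "adapted K S J b"
    have "base_coeff b m (S m) \<alpha> = ycoord (tchart b) \<alpha> m" if m: "m \<in> cdom b" for m \<alpha>
    proof -
      have "S m = comb b m (\<lambda>\<alpha>. ycoord (tchart b) \<alpha> m) (\<lambda>\<beta>. spray_coeff K S b \<beta> m)"
        using L m unfolding adapted_def comb_def by blast
      then show ?thesis by (simp add: base_coeff_comb[OF b m])
    qed
    then show "canonical K b \<and> (\<forall>m\<in>cdom b. \<forall>\<alpha>. base_coeff b m (S m) \<alpha> = ycoord (tchart b) \<alpha> m)"
      using b by blast
  next
    assume "canonical K b \<and> (\<forall>m\<in>cdom b. \<forall>\<alpha>. base_coeff b m (S m) \<alpha> = ycoord (tchart b) \<alpha> m)"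
    then have R: "base_coeff b m (S m) \<alpha> = ycoord (tchart b) \<alpha> m" if "m \<in> cdom b" for m \<alpha> using that by blast
    have "J m (Xc K b \<alpha> m) = Vc K (tchart b) \<alpha> m" if m: "m \<in> cdom b" for m \<alpha>
    proof -
      have "snd (Vc K (tchart b) \<alpha> m) (\<lambda>q. base_coeff b q (S q) \<gamma>) = (if \<gamma> = \<alpha> then 1 else 0)" for \<gamma>
      proof -
        have "snd (Vc K (tchart b) \<alpha> m) (\<lambda>q. base_coeff b q (S q) \<gamma>) = snd (Vc K (tchart b) \<alpha> m) (ycoord (tchart b) \<gamma>)"
          by (rule T.tangent_cong[OF snd_TT_tangent[OF Vc_TT[OF b m]] canonicalD(3)[OF b] m]) (rule R)
        then show ?thesis by (simp add: snd_Vc_ycoord[OF b m])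
      qed
      then show ?thesis using J_base_derivative[OF b m, of \<alpha>] by (simp add: if_distrib[of "\<lambda>r. r *\<^sub>R _"] cong: if_cong)
    qed
    moreover have "S m = (\<Sum>\<alpha>\<in>UNIV. ycoord (tchart b) \<alpha> m *\<^sub>R Xc K b \<alpha> m) +
              (\<Sum>\<beta>\<in>UNIV. spray_coeff K S b \<beta> m *\<^sub>R Vc K (tchart b) \<beta> m)" if m: "m \<in> cdom b" for m
      using TT_expand[OF b m S] by (simp add: comb_def sc[OF m] R[OF m])
    ultimately show "adapted K S J b" unfolding adapted_def using b by blast
  qed
qed (simp add: adapted_def)

text \<open>The fibre coordinates are the components \<open>s\<^sup>\<alpha>\<close> of the semispray along the \<open>X\<^sub>\<alpha>\<close>. By
  \<open>J [S, V\<^sub>\<beta>] = - V\<^sub>\<beta>\<close> the matrix \<open>\<partial>s\<^sup>\<alpha>/\<partial>y\<^sup>\<beta>\<close> is invertible, so that the inverse function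
  theorem applies.\<close>

lemma adapted_ex: "\<exists>b. adapted K S J b \<and> m \<in> cdom b"
proof -
  obtain b where b: "canonical K b" "m \<in> cdom b" using canonical_ex by blast
  note c = canonicalD[OF b(1)] and o = canonicalD(3)[OF b(1)]
  note cc = T.chart[OF c(1)]
  let ?c = "tchart b"
  define s where "s \<alpha> q = base_coeff b q (S q) \<alpha>" for \<alpha> q
  have s: "smooth_fun AT (cdom b) (s \<alpha>)" for \<alpha>
    using PS_base_coeff[OF S_smooth[OF o] b(1)] by (simp add: s_def[abs_def])
  define sv :: "(real^'n) \<times> (real^'k) \<Rightarrow> real^'k" where "sv y = (\<chi> \<alpha>. s \<alpha> (chart_inv ?c y))" for y
  let ?U = "snd ?c ` cdom b"
  have oU: "open ?U" by (rule is_chartD(2)[OF cc])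
  have svi: "smooth_on ?U (\<lambda>y. s \<alpha> (chart_inv ?c y))" for \<alpha>
    using T.smooth_funD[OF s c(1)] by (simp add: o_def)
  then have sv: "smooth_on ?U sv"
    by (intro smooth_on_vec[OF oU]) (simp add: sv_def)
  \<comment> \<open>The derivative of \<open>sv\<close> along (0, v) has components sum_\<beta>
    v^\<beta> V_\<beta>(s^\<alpha>). If they all vanish, \<open>J_base_derivative\<close> shows that
    sum_\<beta> v^\<beta> V_\<beta> = 0, so v = 0.\<close>
  have ker: "v = 0" if x0: "x \<in> ?U" and v: "frechet_derivative sv (at x) (0, v) = 0" for x v
  proof -
    obtain q where q: "q \<in> cdom b" "x = snd ?c q" using x0 by blast
    have near: "smooth_near AT q (s \<alpha>)" for \<alpha> by (rule T.smooth_fun_near[OF s q(1)])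
    note lin = T.linear_tvec[OF c(1) q(1)]
    have "((s \<alpha> \<circ> chart_inv ?c) has_derivative (\<lambda>u. frechet_derivative sv (at x) u $ \<alpha>)) (at (snd ?c q))" for \<alpha>
      using bounded_linear.has_derivative[OF bounded_linear_vec_nth[of \<alpha>] smooth_on_has_derivative[OF sv x0]]
      by (simp add: sv_def o_def q(2))
    from T.tvec_eqI[OF near this, of "(0, v)"] have z: "tvec AT ?c q (0, v) (s \<alpha>) = 0" for \<alpha>
      by (simp add: v)
    have "(0, v) = (\<Sum>\<beta>\<in>UNIV. v $ \<beta> *\<^sub>R (0::real^'n, axis \<beta> (1::real)))"
      unfolding sum_axis_snd by simp
    then have "tvec AT ?c q (0, v) = (\<Sum>\<beta>\<in>UNIV. v $ \<beta> *\<^sub>R tvec AT ?c q (0, axis \<beta> 1))"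
      by (simp only: linear_sum[OF lin] linear_scale[OF lin])
    then have z': "(\<Sum>\<beta>\<in>UNIV. v $ \<beta> * snd (Vc K ?c \<beta> q) (s \<alpha>)) = 0" for \<alpha>
      using z[of \<alpha>] by (simp add: sum_fun_apply scaleR_fun_def Vc_def)
    have "(\<Sum>\<beta>\<in>UNIV. v $ \<beta> *\<^sub>R Vc K ?c \<beta> q)
        = (\<Sum>\<beta>\<in>UNIV. v $ \<beta> *\<^sub>R (\<Sum>\<alpha>\<in>UNIV. snd (Vc K ?c \<beta> q) (s \<alpha>) *\<^sub>R J q (Xc K b \<alpha> q)))"
      using J_base_derivative[OF b(1) q(1)] by (simp add: s_def[abs_def])
    also have "\<dots> = (\<Sum>\<beta>\<in>UNIV. \<Sum>\<alpha>\<in>UNIV. (v $ \<beta> * snd (Vc K ?c \<beta> q) (s \<alpha>)) *\<^sub>R J q (Xc K b \<alpha> q))"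
      by (simp add: scaleR_sum_right)
    also have "\<dots> = (\<Sum>\<alpha>\<in>UNIV. (\<Sum>\<beta>\<in>UNIV. v $ \<beta> * snd (Vc K ?c \<beta> q) (s \<alpha>)) *\<^sub>R J q (Xc K b \<alpha> q))"
      unfolding scaleR_sum_left by (rule sum.swap)
    also have "\<dots> = 0" by (simp add: z')
    finally have "v $ \<beta> = 0" for \<beta>
      using vert_coeff_sum_Vc[OF b(1) q(1), of "vec_nth v" \<beta>] by (simp add: vert_coeff_def)
    then show "v = 0" by (simp add: vec_eq_iff)
  qed
  have m: "snd ?c m \<in> ?U" using b(2) by blast
  obtain U' V g where g: "open U'" "U' \<subseteq> ?U" "snd ?c m \<in> U'" "open V"
    "homeomorphism U' V (\<lambda>x. (fst x, sv x)) g" "smooth_on V g"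
    by (rule smooth_graph_inverse[OF oU sv m ker])
  have F: "smooth_on U' (\<lambda>x. (fst x, sv x))"
    by (intro smooth_on_Pair g(1) smooth_on_subset[OF sv g(2)])
      (rule smooth_on_bounded_linear[OF bounded_linear_fst g(1) smooth_on_ident[OF g(1)]])
  define c' where "c' = (chart_inv ?c ` U', (\<lambda>x. (fst x, sv x)) \<circ> snd ?c)"
  have c': "c' \<in> AT" unfolding c'_def by (rule T.chart_composeI[OF c(1) g(1,2,4,5) F g(6)])
  have sub: "fst c' \<subseteq> cdom b" using g(2) chart_inv_in[OF cc] by (auto simp: c'_def)
  \<comment> \<open>Only the fibre coordinates change. The frame of the algebroid is kept, so the
    X-components of S are the same functions as before.\<close>
  define b' where "b' = b\<lparr>tchart := c'\<rparr>"
  have [simp]: "tchart b' = c'" "bchart b' = bchart b" "aframe b' = aframe b" by (simp_all add: b'_def)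
  have q: "\<forall>q\<in>fst c'. proj K q \<in> fst (bchart b) \<and> fst (snd c' q) = snd (bchart b) (proj K q)"
    using sub c(4,5) by (auto simp: c'_def)
  have b': "canonical K b'"
  proof -
    obtain W where "local_frame AB (alg K) W (aframe b)" "proj K ` cdom b \<subseteq> W"
      by (rule canonical_frame[OF b(1)])
    moreover have "proj K ` fst c' \<subseteq> proj K ` cdom b" using sub by blast
    ultimately have "\<exists>W. local_frame AB (alg K) W (aframe b) \<and> proj K ` fst c' \<subseteq> W" by blast
    then show ?thesis using q c' c(2) by (simp add: canonical_def fibred_chart_def)
  qed
  have "base_coeff b' q (S q) \<alpha> = ycoord (tchart b') \<alpha> q" if "q \<in> cdom b'" for q \<alpha>
  proof -
    have q: "q \<in> cdom b" using that sub by auto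
    have "snd (snd c' q) $ \<alpha> = s \<alpha> q" by (simp add: c'_def sv_def chart_inv_left[OF cc q])
    then show ?thesis by (simp add: ycoord_def s_def base_coeff_def)
  qed
  then have "adapted K S J b'" using b' by (simp add: adapted_iff)
  moreover have "m \<in> cdom b'" using g(3) chart_inv_left[OF cc b(2)] by (simp add: c'_def image_iff) (metis)
  ultimately show ?thesis by blast
qed

section \<open>Local formulas in an adapted basis\<close>

definition dS :: "('m, 'p, 'v, 'n, 'k) canon \<Rightarrow> 'k \<Rightarrow> 'k \<Rightarrow> 'p \<Rightarrow> real" where
  "dS b \<gamma> \<beta> m = snd (Vc K (tchart b) \<beta> m) (spray_coeff K S b \<gamma>)"

text \<open>In an adapted basis this is the component of [X_\<alpha>, S] along X_\<gamma>.\<close>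

definition yC :: "('m, 'p, 'v, 'n, 'k) canon \<Rightarrow> 'k \<Rightarrow> 'k \<Rightarrow> 'p \<Rightarrow> real" where
  "yC b \<alpha> \<gamma> m = (\<Sum>\<mu>\<in>UNIV. ycoord (tchart b) \<mu> m * struct_coeff K b \<alpha> \<mu> \<gamma> (proj K m))"

context
  fixes b
  assumes adapted: "adapted K S J b"
begin

lemma adapted_canonical: "canonical K b"
  using adapted by (simp add: adapted_iff)

lemma J_Xc: "m \<in> cdom b \<Longrightarrow> J m (Xc K b \<alpha> m) = Vc K (tchart b) \<alpha> m"
  using adapted by (simp add: adapted_def)

lemma base_coeff_S: "m \<in> cdom b \<Longrightarrow> base_coeff b m (S m) \<alpha> = ycoord (tchart b) \<alpha> m"
  using adapted by (simp add: adapted_iff)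

lemma spray_coeff_eq: "m \<in> cdom b \<Longrightarrow> spray_coeff K S b \<beta> m = vert_coeff b (S m) \<beta>"
  using frame_coeff_prol(2)[OF adapted_canonical _ PS_TT[OF S_smooth[OF open_UNIV]]] by (simp add: spray_coeff_def)

lemma adapted_linear_fibration: "tchart b \<in> linear_fibration_atlas K (\<lambda>m. J m (S m))"
proof -
  have "J m (S m) = (\<Sum>\<alpha>\<in>UNIV. ycoord (tchart b) \<alpha> m *\<^sub>R Vc K (tchart b) \<alpha> m)" if m: "m \<in> cdom b" for m
  proof -
    have "J m (S m) = J m (comb b m (base_coeff b m (S m)) (vert_coeff b (S m)))"
      unfolding TT_expand[OF adapted_canonical m PS_TT[OF S_smooth[OF open_UNIV] UNIV_I]] ..
    then show ?thesis by (simp add: J_comb[OF adapted_canonical m] J_Xc[OF m] base_coeff_S[OF m])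
  qed
  then show ?thesis
    using adapted_canonical unfolding linear_fibration_atlas_def canonical_def by blast
qed

lemma P_S_Vc_adapted:
  assumes m: "m \<in> cdom b"
  shows "P S (Vc K (tchart b) \<beta>) m = - (Xc K b \<beta> m + (\<Sum>\<gamma>\<in>UNIV. dS b \<gamma> \<beta> m *\<^sub>R Vc K (tchart b) \<gamma> m))"
proof -
  note b = adapted_canonical and o = canonicalD(3)[OF adapted_canonical]
  note v = snd_TT_tangent[OF Vc_TT[OF b m, of \<beta>]]
  have "snd (Vc K (tchart b) \<beta> m) (\<lambda>q. base_coeff b q (S q) \<alpha>) = (if \<alpha> = \<beta> then 1 else 0)" for \<alpha>
    using T.tangent_cong[OF v o m, of "\<lambda>q. base_coeff b q (S q) \<alpha>" "ycoord (tchart b) \<alpha>"]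
      base_coeff_S snd_Vc_ycoord[OF b m] by simp
  moreover have "snd (Vc K (tchart b) \<beta> m) (\<lambda>q. vert_coeff b (S q) \<gamma>) = dS b \<gamma> \<beta> m" for \<gamma>
    unfolding dS_def by (rule T.tangent_cong[OF v o m]) (simp add: spray_coeff_eq)
  ultimately show ?thesis
    unfolding P_S_Vc[OF b m S_smooth[OF o]] by (simp add: comb_def if_distrib[of "\<lambda>r. r *\<^sub>R _"] cong: if_cong)
qed

text \<open>X_\<beta> annihilates the fibre coordinates, which are the X-components of S here, so
  only the structure functions remain. The V-components of the bracket are removed by J.\<close>

lemma J_P_S_Xc:
  assumes m: "m \<in> cdom b"
  shows "J m (P S (Xc K b \<beta>) m) = - (\<Sum>\<gamma>\<in>UNIV. yC b \<beta> \<gamma> m *\<^sub>R Vc K (tchart b) \<gamma> m)"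
proof -
  note b = adapted_canonical and o = canonicalD(3)[OF adapted_canonical]
  have "snd (Xc K b \<beta> m) (\<lambda>q. base_coeff b q (S q) \<alpha>) = 0" for \<alpha>
    using T.tangent_cong[OF snd_TT_tangent[OF Xc_TT[OF b m, of \<beta>]] o m, of "\<lambda>q. base_coeff b q (S q) \<alpha>" "ycoord (tchart b) \<alpha>"]
      base_coeff_S snd_Xc_ycoord[OF b m] by simp
  then show ?thesis
    unfolding P_S_Xc[OF b m S_smooth[OF o]] J_minus[OF comb_TT[OF b m]] J_comb[OF b m]
    by (simp add: J_Xc[OF m] base_coeff_S[OF m] yC_def)
qed

text \<open>In an adapted basis J has constant matrix, so both brackets in -[S, J X] + J [S, X] can
  be expanded by the Leibniz rule. The result depends on \<open>X m\<close> alone: it sends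
  V_\<gamma> to - V_\<gamma> and adds (dS - yC) V to X_\<alpha>.\<close>

lemma canonical_operator_local:
  assumes X: "PS U X" and m: "m \<in> U" "m \<in> cdom b"
  shows "- lie_deriv_endo P S J X m = comb b m (base_coeff b m (X m))
    (\<lambda>\<gamma>. (\<Sum>\<alpha>\<in>UNIV. base_coeff b m (X m) \<alpha> * (dS b \<gamma> \<alpha> m - yC b \<alpha> \<gamma> m)) - vert_coeff b (X m) \<gamma>)"
proof -
  note b = adapted_canonical and o = canonicalD(3)[OF adapted_canonical]
  let ?V = "U \<inter> cdom b"
  have oV: "open ?V" using PS_open[OF X] o by (rule open_Int)
  have mV: "m \<in> ?V" using m by simp
  note SU = S_smooth[OF PS_open[OF X]] and SV = S_smooth[OF oV]
  define a where "a \<alpha> q = base_coeff b q (X q) \<alpha>" for \<alpha> q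
  define u where "u \<alpha> q = vert_coeff b (X q) \<alpha>" for \<alpha> q
  have a: "smooth_fun AT ?V (a \<alpha>)" and u: "smooth_fun AT ?V (u \<alpha>)" for \<alpha>
    using PS_base_coeff[OF X b] PS_vert_coeff[OF X b] by (simp_all add: a_def[abs_def] u_def[abs_def])
  have Xs: "PS ?V (Xc K b \<alpha>)" and Vs: "PS ?V (Vc K (tchart b) \<alpha>)" for \<alpha>
    using PS_subset[OF Xc_smooth[OF b] oV] PS_subset[OF VS_PS[OF Vc_smooth[OF b]] oV] by simp_all
  let ?JX = "\<lambda>q. \<Sum>\<alpha>\<in>UNIV. a \<alpha> q *\<^sub>R Vc K (tchart b) \<alpha> q"
  let ?A = "\<lambda>q. \<Sum>\<alpha>\<in>UNIV. a \<alpha> q *\<^sub>R Xc K b \<alpha> q"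
  let ?B = "\<lambda>q. \<Sum>\<beta>\<in>UNIV. u \<beta> q *\<^sub>R Vc K (tchart b) \<beta> q"
  have JX: "PS ?V ?JX" and A: "PS ?V ?A" and B: "PS ?V ?B" by (intro PS_sum oV PS_scale a u Xs Vs)+
  have Xq: "X q = comb b q (\<lambda>\<alpha>. a \<alpha> q) (\<lambda>\<alpha>. u \<alpha> q)" if "q \<in> ?V" for q
    unfolding a_def u_def by (rule TT_expand[symmetric, OF b]) (use that PS_TT[OF X] in auto)
  have JXq: "J q (X q) = ?JX q" if "q \<in> ?V" for q
    using that by (simp add: Xq J_comb[OF b] J_Xc)
  have 1: "P S (\<lambda>q. J q (X q)) m = (\<Sum>\<alpha>\<in>UNIV. a \<alpha> m *\<^sub>R P S (Vc K (tchart b) \<alpha>) m + snd (S m) (a \<alpha>) *\<^sub>R Vc K (tchart b) \<alpha> m)"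
    by (rule trans[OF P_local[OF SU J_smooth[OF X] JX oV Int_lower1 JXq mV] P_sum[OF SV Vs a mV]])
  have AB: "PS ?V (\<lambda>q. 1 *\<^sub>R ?A q + 1 *\<^sub>R ?B q)" using PS_add[OF A B] by simp
  have "P S X m = P S (\<lambda>q. 1 *\<^sub>R ?A q + 1 *\<^sub>R ?B q) m"
    by (rule P_local[OF SU X AB oV Int_lower1 _ mV]) (simp add: Xq comb_def)
  also have "\<dots> = P S ?A m + P S ?B m" using P_linear[OF SV A B mV, of 1 1] by simp
  finally have 2: "P S X m = (\<Sum>\<alpha>\<in>UNIV. a \<alpha> m *\<^sub>R P S (Xc K b \<alpha>) m + snd (S m) (a \<alpha>) *\<^sub>R Xc K b \<alpha> m)
      + (\<Sum>\<alpha>\<in>UNIV. u \<alpha> m *\<^sub>R P S (Vc K (tchart b) \<alpha>) m + snd (S m) (u \<alpha>) *\<^sub>R Vc K (tchart b) \<alpha> m)"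
    unfolding P_sum[OF SV Xs a mV] P_sum[OF SV Vs u mV] .
  have PX: "P S (Xc K b \<alpha>) m \<in> TT K m" and PV: "P S (Vc K (tchart b) \<alpha>) m \<in> TT K m" for \<alpha>
    using PS_TT[OF P_smooth[OF SV Xs] mV] PS_TT[OF P_smooth[OF SV Vs] mV] by simp_all
  note sp = subspace_sum[OF TT_subspace] subspace_add[OF TT_subspace] subspace_scale[OF TT_subspace]
  have TTs: "(\<Sum>\<alpha>\<in>UNIV. z \<alpha> *\<^sub>R w \<alpha>) \<in> TT K m" if "\<And>\<alpha>. w \<alpha> \<in> TT K m" for z :: "'k \<Rightarrow> real" and w
    by (intro sp that)
  have PSV: "J m (P S (Vc K (tchart b) \<alpha>) m) = - Vc K (tchart b) \<alpha> m" for \<alpha>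
    by (rule J_spray[OF Vc_smooth[OF b] m(2)])
  have 3: "J m (P S X m) = (\<Sum>\<alpha>\<in>UNIV. a \<alpha> m *\<^sub>R J m (P S (Xc K b \<alpha>) m)) + (\<Sum>\<alpha>\<in>UNIV. snd (S m) (a \<alpha>) *\<^sub>R Vc K (tchart b) \<alpha> m)
      - (\<Sum>\<alpha>\<in>UNIV. u \<alpha> m *\<^sub>R Vc K (tchart b) \<alpha> m)"
    unfolding 2 sum.distrib
    by (simp add: J_add TTs subspace_add[OF TT_subspace] PX PV Xc_TT[OF b m(2)] Vc_TT[OF b m(2)] J_sum J_Xc[OF m(2)] PSV
        J_zero[OF Vc_VV[OF b m(2)]] sum_negf)
  \<comment> \<open>The terms S(a^\<alpha>) V_\<alpha> produced by the two brackets cancel here;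
    this is tensoriality.\<close>
  have "- lie_deriv_endo P S J X m = - (\<Sum>\<alpha>\<in>UNIV. a \<alpha> m *\<^sub>R P S (Vc K (tchart b) \<alpha>) m)
      + (\<Sum>\<alpha>\<in>UNIV. a \<alpha> m *\<^sub>R J m (P S (Xc K b \<alpha>) m)) - (\<Sum>\<alpha>\<in>UNIV. u \<alpha> m *\<^sub>R Vc K (tchart b) \<alpha> m)"
    unfolding lie_deriv_endo_def 1 3 sum.distrib by simp
  also have "\<dots> = (\<Sum>\<alpha>\<in>UNIV. a \<alpha> m *\<^sub>R Xc K b \<alpha> m)
      + (\<Sum>\<alpha>\<in>UNIV. \<Sum>\<gamma>\<in>UNIV. (a \<alpha> m * (dS b \<gamma> \<alpha> m - yC b \<alpha> \<gamma> m)) *\<^sub>R Vc K (tchart b) \<gamma> m)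
      - (\<Sum>\<alpha>\<in>UNIV. u \<alpha> m *\<^sub>R Vc K (tchart b) \<alpha> m)"
    unfolding P_S_Vc_adapted[OF m(2)] J_P_S_Xc[OF m(2)]
    by (simp add: sum.distrib sum_negf scaleR_add_right scaleR_diff_right scaleR_sum_right right_diff_distrib scaleR_diff_left sum_subtractf)
  also have "(\<Sum>\<alpha>\<in>UNIV. \<Sum>\<gamma>\<in>UNIV. (a \<alpha> m * (dS b \<gamma> \<alpha> m - yC b \<alpha> \<gamma> m)) *\<^sub>R Vc K (tchart b) \<gamma> m)
      = (\<Sum>\<gamma>\<in>UNIV. (\<Sum>\<alpha>\<in>UNIV. a \<alpha> m * (dS b \<gamma> \<alpha> m - yC b \<alpha> \<gamma> m)) *\<^sub>R Vc K (tchart b) \<gamma> m)"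
    unfolding scaleR_sum_left by (rule sum.swap)
  finally show ?thesis
    by (simp add: comb_def a_def u_def scaleR_diff_left sum_subtractf)
qed

text \<open>Constant coefficients extend a vector at one point to a section over the chart domain,
  the witness required by the definite description of N_S.\<close>

lemma comb_smooth: "PS (cdom b) (\<lambda>q. comb b q a u)"
proof -
  note b = adapted_canonical and o = canonicalD(3)[OF adapted_canonical]
  show ?thesis
    unfolding comb_def
    by (intro PS_add PS_sum o PS_scale Xc_smooth b VS_PS[OF Vc_smooth[OF b]] T.smooth_fun_const)
qed

text \<open>The section with constant coefficients shows that a value exists;
  \<open>canonical_operator_local\<close>, which involves only the value of the section at
  \<open>m\<close>, shows that it is unique.\<close>

lemma canonical_connection_local:
  assumes m: "m \<in> cdom b" and w: "w \<in> TT K m"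
  shows "canonical_connection K P S J m w = comb b m (base_coeff b m w)
    (\<lambda>\<gamma>. (\<Sum>\<alpha>\<in>UNIV. base_coeff b m w \<alpha> * (dS b \<gamma> \<alpha> m - yC b \<alpha> \<gamma> m)) - vert_coeff b w \<gamma>)" (is "_ = ?r")
proof -
  have "(THE z. \<exists>U X. m \<in> U \<and> PS U X \<and> X m = w \<and> z = - lie_deriv_endo P S J X m) = ?r"
  proof (rule the_equality)
    let ?X = "\<lambda>q. comb b q (base_coeff b m w) (vert_coeff b w)"
    have "?X m = w" by (rule TT_expand[OF adapted_canonical m w])
    then show "\<exists>U X. m \<in> U \<and> PS U X \<and> X m = w \<and> ?r = - lie_deriv_endo P S J X m"
      using canonical_operator_local[OF comb_smooth m m, of "base_coeff b m w" "vert_coeff b w"] m comb_smooth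
      by (intro exI[of _ "cdom b"] exI[of _ ?X]) simp
    show "z = ?r" if "\<exists>U X. m \<in> U \<and> PS U X \<and> X m = w \<and> z = - lie_deriv_endo P S J X m" for z
      using that canonical_operator_local[OF _ _ m] by blast
  qed
  then show ?thesis using w by (simp add: canonical_connection_def endo_of_operator_def)
qed

end

end

section \<open>Nonlinear connections and the vertical metric\<close>

text \<open>Bilinearity on a single fibre, separated from smoothness, so that the same expansion
  rules serve \<Omega> on the prolongation and g on the vertical bundle.\<close>

definition bilinear_on :: "'w::real_vector set \<Rightarrow> ('w \<Rightarrow> 'w \<Rightarrow> real) \<Rightarrow> bool" where
  "bilinear_on T B \<longleftrightarrow> (\<forall>u\<in>T. \<forall>u'\<in>T. \<forall>z\<in>T. B (u + u') z = B u z + B u' z \<and> B z (u + u') = B z u + B z u') \<and>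
    (\<forall>u\<in>T. \<forall>z\<in>T. \<forall>r. B (r *\<^sub>R u) z = r * B u z \<and> B z (r *\<^sub>R u) = r * B z u)"

lemma
  fixes B :: "'w::real_vector \<Rightarrow> 'w \<Rightarrow> real" and v w :: "'i::finite \<Rightarrow> 'w"
  assumes T: "subspace T" and B: "bilinear_on T B"
  shows bilinear_sum_left: "(\<And>i. v i \<in> T) \<Longrightarrow> z \<in> T \<Longrightarrow> B (\<Sum>i\<in>I. x i *\<^sub>R v i) z = (\<Sum>i\<in>I. x i * B (v i) z)"
    and bilinear_sum_right: "(\<And>i. v i \<in> T) \<Longrightarrow> z \<in> T \<Longrightarrow> B z (\<Sum>i\<in>I. x i *\<^sub>R v i) = (\<Sum>i\<in>I. x i * B z (v i))"
    and bilinear_sum_both: "(\<And>i. v i \<in> T) \<Longrightarrow> (\<And>i. w i \<in> T) \<Longrightarrow>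
      B (\<Sum>i\<in>I. x i *\<^sub>R v i) (\<Sum>j\<in>I'. y j *\<^sub>R w j) = (\<Sum>i\<in>I. \<Sum>j\<in>I'. x i * y j * B (v i) (w j))"
proof -
  have add1: "\<And>u u' z. u \<in> T \<Longrightarrow> u' \<in> T \<Longrightarrow> z \<in> T \<Longrightarrow> B (u + u') z = B u z + B u' z"
    and add2: "\<And>u u' z. u \<in> T \<Longrightarrow> u' \<in> T \<Longrightarrow> z \<in> T \<Longrightarrow> B z (u + u') = B z u + B z u'"
    and sc1: "\<And>u z r. u \<in> T \<Longrightarrow> z \<in> T \<Longrightarrow> B (r *\<^sub>R u) z = r * B u z"
    and sc2: "\<And>u z r. u \<in> T \<Longrightarrow> z \<in> T \<Longrightarrow> B z (r *\<^sub>R u) = r * B z u"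
    using B unfolding bilinear_on_def by blast+
  have z1: "B 0 z = 0" if "z \<in> T" for z using sc1[OF subspace_0[OF T] that, of 0] by simp
  have z2: "B z 0 = 0" if "z \<in> T" for z using sc2[OF subspace_0[OF T] that, of 0] by simp
  have mem: "(\<Sum>i\<in>I. x i *\<^sub>R v i) \<in> T" if "\<And>i. v i \<in> T" for I and x :: "'i \<Rightarrow> real" and v
    by (intro subspace_sum[OF T] subspace_scale[OF T] that)
  have l: "B (\<Sum>i\<in>I. x i *\<^sub>R v i) z = (\<Sum>i\<in>I. x i * B (v i) z)" if "\<And>i. v i \<in> T" "z \<in> T" for I and x :: "'i \<Rightarrow> real" and v z
    by (induction I rule: infinite_finite_induct)
      (simp_all add: z1 add1 sc1 mem that subspace_scale[OF T])
  have r: "B z (\<Sum>i\<in>I. x i *\<^sub>R v i) = (\<Sum>i\<in>I. x i * B z (v i))" if "\<And>i. v i \<in> T" "z \<in> T" for I and x :: "'i \<Rightarrow> real" and v z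
    by (induction I rule: infinite_finite_induct)
      (simp_all add: z2 add2 sc2 mem that subspace_scale[OF T])
  show "(\<And>i. v i \<in> T) \<Longrightarrow> z \<in> T \<Longrightarrow> B (\<Sum>i\<in>I. x i *\<^sub>R v i) z = (\<Sum>i\<in>I. x i * B (v i) z)" by (rule l)
  show "(\<And>i. v i \<in> T) \<Longrightarrow> z \<in> T \<Longrightarrow> B z (\<Sum>i\<in>I. x i *\<^sub>R v i) = (\<Sum>i\<in>I. x i * B z (v i))" by (rule r)
  show "(\<And>i. v i \<in> T) \<Longrightarrow> (\<And>i. w i \<in> T) \<Longrightarrow>
      B (\<Sum>i\<in>I. x i *\<^sub>R v i) (\<Sum>j\<in>I'. y j *\<^sub>R w j) = (\<Sum>i\<in>I. \<Sum>j\<in>I'. x i * y j * B (v i) (w j))"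
  proof -
    assume vw: "\<And>i. v i \<in> T" "\<And>i. w i \<in> T"
    show ?thesis unfolding l[OF vw(1) mem[OF vw(2)]] r[OF vw(2) vw(1)] sum_distrib_left mult.assoc ..
  qed
qed

section \<open>The canonical connection as a nonlinear connection\<close>

context spray
begin

lemma endo_diff:
  assumes I: "I \<in> endomorphisms AT E" and sp: "subspace (fibre E m)" and w: "w \<in> fibre E m" "w' \<in> fibre E m"
  shows "I m (w - w') = I m w - I m w'"
proof -
  have "I m (w - w') = I m (w + (-1) *\<^sub>R w')" by simp
  also have "\<dots> = I m w + (-1) *\<^sub>R I m w'"
    unfolding endo_add[OF I w(1) subspace_scale[OF sp w(2)]] endo_scale[OF I w(2)] ..
  finally show ?thesis by simp
qed

lemmas J_diff = endo_diff[OF J_endo TT_subspace]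

abbreviation "NS \<equiv> canonical_connection K P S J"

lemma VV_from_base:
  assumes "canonical K b" "m \<in> cdom b" "w \<in> TT K m" "\<And>\<alpha>. base_coeff b m w \<alpha> = 0"
  shows "w \<in> VV K m"
  using TT_expand[OF assms(1-3)] VV_sum_Vc[OF assms(1,2), of "vert_coeff b w"] by (simp add: comb_def assms(4))

lemma NS_section:
  assumes "PS U X" "m \<in> U"
  shows "NS m (X m) = - lie_deriv_endo P S J X m"
proof -
  obtain b where b: "adapted K S J b" "m \<in> cdom b" using adapted_ex by blast
  show ?thesis
    unfolding canonical_connection_local[OF b PS_TT[OF assms]] canonical_operator_local[OF b(1) assms b(2)] ..
qed

text \<open>Linearity is read off the formula in an adapted basis. Smoothness comes from the
  expression by brackets, -[S, J s] + J [S, s], which holds over the whole domain of the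
  section.\<close>

lemma NS_endo: "NS \<in> endomorphisms AT (prol K)"
proof -
  have lin: "NS m w \<in> TT K m \<and> (\<forall>w'\<in>TT K m. NS m (w + w') = NS m w + NS m w') \<and> (\<forall>r. NS m (r *\<^sub>R w) = r *\<^sub>R NS m w)"
    if w: "w \<in> TT K m" for m w
  proof -
    obtain b where b: "adapted K S J b" "m \<in> cdom b" using adapted_ex by blast
    note bc = adapted_canonical[OF b(1)]
    note loc = canonical_connection_local[OF b]
    have "NS m (w + w') = NS m w + NS m w'" if w': "w' \<in> TT K m" for w'
      unfolding loc[OF w] loc[OF w'] loc[OF subspace_add[OF TT_subspace w w']] comb_add
        base_coeff_add[OF bc b(2) w w'] vert_coeff_add
      by (rule arg_cong[where f = "comb b m _"]) (simp add: fun_eq_iff distrib_right sum.distrib)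
    moreover have "NS m (r *\<^sub>R w) = r *\<^sub>R NS m w" for r
      unfolding loc[OF w] loc[OF subspace_scale[OF TT_subspace w]] comb_scale
        base_coeff_scale[OF bc b(2) w] vert_coeff_scale
      by (rule arg_cong[where f = "comb b m _"]) (simp add: fun_eq_iff right_diff_distrib sum_distrib_left mult.assoc)
    moreover have "NS m w \<in> TT K m" unfolding loc[OF w] by (rule comb_TT[OF bc b(2)])
    ultimately show ?thesis by blast
  qed
  have "PS U (\<lambda>m. NS m (s m))" if s: "PS U s" for U s
  proof -
    note o = PS_open[OF s] and SU = S_smooth[OF PS_open[OF s]]
    have "PS U (\<lambda>m. (-1) *\<^sub>R P S (\<lambda>q. J q (s q)) m + J m (P S s m))"
      by (intro PS_add PS_scale T.smooth_fun_const o P_smooth SU J_smooth s)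
    then show ?thesis
      by (rule PS_cong) (simp add: NS_section[OF s] lie_deriv_endo_def)
  qed
  moreover have "NS m \<in> extensional (TT K m)" for m
    by (simp add: canonical_connection_def endo_of_operator_def)
  ultimately show ?thesis using lin unfolding endomorphisms_def bundle_morphism_def by blast
qed

text \<open>In adapted components N_S is (a, u) |-> (a, a k - u), visibly an involution whose
  (-1)-eigenspace is a = 0.\<close>

lemma NS_nonlinear: "nonlinear_connection K NS"
proof -
  have "NS m (NS m w) = w \<and> (w + NS m w = 0 \<longleftrightarrow> w \<in> VV K m)" if w: "w \<in> TT K m" for m w
  proof -
    obtain b where b: "adapted K S J b" "m \<in> cdom b" using adapted_ex by blast
    note bc = adapted_canonical[OF b(1)]
    note loc = canonical_connection_local[OF b]
    define a where "a = base_coeff b m w"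
    define u where "u = vert_coeff b w"
    define k where "k \<alpha> \<gamma> = dS b \<gamma> \<alpha> m - yC b \<alpha> \<gamma> m" for \<alpha> \<gamma>
    have L: "NS m (comb b m a u) = comb b m a (\<lambda>\<gamma>. (\<Sum>\<alpha>\<in>UNIV. a \<alpha> * k \<alpha> \<gamma>) - u \<gamma>)" for a u
    proof -
      have "base_coeff b m (comb b m a u) = a" by (rule ext) (rule base_coeff_comb[OF bc b(2)])
      then show ?thesis
        unfolding loc[OF comb_TT[OF bc b(2)]] by (simp add: vert_coeff_comb[OF bc b(2)] k_def)
    qed
    have we: "w = comb b m a u" unfolding a_def u_def by (rule TT_expand[OF bc b(2) w, symmetric])
    have "NS m (NS m w) = w" unfolding we L by simp
    moreover have "w + NS m w = 0 \<Longrightarrow> w \<in> VV K m"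
    proof (rule VV_from_base[OF bc b(2) w])
      fix \<alpha> assume "w + NS m w = 0"
      then have "base_coeff b m (comb b m (\<lambda>\<alpha>. a \<alpha> + a \<alpha>) (\<lambda>\<gamma>. u \<gamma> + ((\<Sum>\<alpha>\<in>UNIV. a \<alpha> * k \<alpha> \<gamma>) - u \<gamma>))) \<alpha> = base_coeff b m 0 \<alpha>"
        unfolding we L comb_add by (rule arg_cong)
      then have "a \<alpha> + a \<alpha> = 0" unfolding base_coeff_comb[OF bc b(2)] by (simp add: base_coeff_def frame_coeff_zero)
      then show "base_coeff b m w \<alpha> = 0" by (simp add: a_def)
    qed
    moreover have "w \<in> VV K m \<Longrightarrow> w + NS m w = 0"
    proof -
      assume "w \<in> VV K m"
      then have "a \<alpha> = 0" for \<alpha> by (simp add: a_def base_coeff_VV)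
      then show ?thesis unfolding we L comb_add by (simp add: comb_def)
    qed
    ultimately show ?thesis by blast
  qed
  then show ?thesis using NS_endo VV_TT unfolding nonlinear_connection_def by blast
qed

section \<open>Arbitrary nonlinear connections\<close>

context
  fixes N
  assumes N: "nonlinear_connection K N"
begin

lemma nc_endo: "N \<in> endomorphisms AT (prol K)"
  using N by (simp add: nonlinear_connection_def)

lemmas nc_in = endo_in[OF nc_endo] and nc_add = endo_add[OF nc_endo] and nc_scale = endo_scale[OF nc_endo]
  and nc_sum = endo_sum[OF nc_endo TT_subspace] and nc_diff = endo_diff[OF nc_endo TT_subspace]

lemma nc_square: "w \<in> TT K m \<Longrightarrow> N m (N m w) = w"
  and nc_ker: "{w \<in> TT K m. w + N m w = 0} = VV K m"
  using N by (simp_all add: nonlinear_connection_def)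

lemma nc_VV: "w \<in> VV K m \<Longrightarrow> N m w = - w"
proof -
  assume "w \<in> VV K m"
  then have "w + N m w = 0" using nc_ker by blast
  then show ?thesis by (simp add: add_eq_0_iff)
qed

lemma nc_diff_VV:
  assumes w: "w \<in> TT K m"
  shows "w - N m w \<in> VV K m"
proof -
  note Nw = nc_in[OF w]
  have d: "w - N m w \<in> TT K m" by (rule subspace_diff[OF TT_subspace w Nw])
  have "(w - N m w) + N m (w - N m w) = 0" by (simp add: nc_diff[OF w Nw] nc_square[OF w])
  then show ?thesis using d nc_ker by blast
qed

text \<open>N = 2h - Id. As X_\<alpha> - h X_\<alpha> is vertical, the coefficients of the
  connection, which record only its V-components, determine it completely.\<close>

lemma nc_Xc:
  assumes b: "canonical K b" "m \<in> cdom b"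
  shows "N m (Xc K b \<alpha> m) = Xc K b \<alpha> m - 2 *\<^sub>R (\<Sum>\<gamma>\<in>UNIV. conn_coeff K N b \<alpha> \<gamma> m *\<^sub>R Vc K (tchart b) \<gamma> m)"
proof -
  let ?d = "Xc K b \<alpha> m - hproj N m (Xc K b \<alpha> m)"
  have half: "(1/2) *\<^sub>R (2 *\<^sub>R w) = w" for w :: "('p, 'v) pvec" by simp
  have "2 *\<^sub>R ?d = 2 *\<^sub>R Xc K b \<alpha> m - (Xc K b \<alpha> m + N m (Xc K b \<alpha> m))"
    by (simp add: hproj_def scaleR_diff_right)
  also have "\<dots> = Xc K b \<alpha> m - N m (Xc K b \<alpha> m)" by (simp add: scaleR_2)
  finally have d: "2 *\<^sub>R ?d = Xc K b \<alpha> m - N m (Xc K b \<alpha> m)" .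
  have "(1/2) *\<^sub>R (2 *\<^sub>R ?d) \<in> VV K m"
    unfolding d by (rule subspace_scale[OF VV_subspace nc_diff_VV[OF Xc_TT[OF b]]])
  then have dV: "?d \<in> VV K m" unfolding half .
  have "conn_coeff K N b \<alpha> \<gamma> m = vert_coeff b ?d \<gamma>" for \<gamma>
    unfolding conn_coeff_def by (rule frame_coeff_prol(2)[OF b VV_TT[OF dV]])
  then have "(\<Sum>\<gamma>\<in>UNIV. conn_coeff K N b \<alpha> \<gamma> m *\<^sub>R Vc K (tchart b) \<gamma> m) = ?d"
    using VV_expand[OF b dV] by simp
  then show ?thesis using d by simp
qed

text \<open>This is h_N(X_\<alpha>), a spanning family of the horizontal bundle; written with
  coefficients, it can be inserted directly into \<Omega> and J.\<close>

definition hX :: "('m, 'p, 'v, 'n, 'k) canon \<Rightarrow> 'k \<Rightarrow> 'p \<Rightarrow> ('p, 'v) pvec" where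
  "hX b \<alpha> m = Xc K b \<alpha> m - (\<Sum>\<gamma>\<in>UNIV. conn_coeff K N b \<alpha> \<gamma> m *\<^sub>R Vc K (tchart b) \<gamma> m)"

lemma horizontal_subspace: "subspace (horizontal K N m)"
proof (rule subspaceI)
  have 0: "N m 0 = 0" using nc_scale[OF subspace_0[OF TT_subspace], of m 0] by simp
  show "0 \<in> horizontal K N m" by (simp add: horizontal_def 0 subspace_0[OF TT_subspace])
qed (auto simp: horizontal_def nc_add nc_scale subspace_add[OF TT_subspace] subspace_scale[OF TT_subspace])

lemma hX_horizontal:
  assumes b: "canonical K b" "m \<in> cdom b"
  shows "hX b \<alpha> m \<in> horizontal K N m"
proof -
  let ?v = "\<Sum>\<gamma>\<in>UNIV. conn_coeff K N b \<alpha> \<gamma> m *\<^sub>R Vc K (tchart b) \<gamma> m"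
  have v: "?v \<in> VV K m" by (rule VV_sum_Vc[OF b])
  have "N m (hX b \<alpha> m) = hX b \<alpha> m"
    by (simp add: hX_def nc_diff[OF Xc_TT[OF b] VV_TT[OF v]] nc_Xc[OF b] nc_VV[OF v] scaleR_2)
  moreover have "hX b \<alpha> m \<in> TT K m"
    unfolding hX_def by (rule subspace_diff[OF TT_subspace Xc_TT[OF b] VV_TT[OF v]])
  ultimately show ?thesis by (simp add: horizontal_def)
qed

lemma horizontal_VV: "w \<in> horizontal K N m \<Longrightarrow> w \<in> VV K m \<Longrightarrow> w = 0"
proof -
  assume w: "w \<in> horizontal K N m" "w \<in> VV K m"
  have "w + w = 0" using w(1) nc_VV[OF w(2)] by (simp add: horizontal_def eq_neg_iff_add_eq_0)
  then have "(2::real) *\<^sub>R w = 0" by (simp add: scaleR_2)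
  then show ?thesis by (simp only: scaleR_eq_0_iff) simp
qed

text \<open>The difference of the two sides is horizontal, and vertical because its X-components
  vanish, hence 0.\<close>

lemma horizontal_expand:
  assumes b: "canonical K b" "m \<in> cdom b" and w: "w \<in> horizontal K N m"
  shows "w = (\<Sum>\<alpha>\<in>UNIV. base_coeff b m w \<alpha> *\<^sub>R hX b \<alpha> m)"
proof -
  note H = horizontal_subspace and hh = hX_horizontal[OF b]
  have wT: "w \<in> TT K m" using w by (simp add: horizontal_def)
  let ?h = "\<Sum>\<alpha>\<in>UNIV. base_coeff b m w \<alpha> *\<^sub>R hX b \<alpha> m"
  have "w - ?h \<in> horizontal K N m"
    by (intro subspace_diff[OF H w] subspace_sum[OF H] subspace_scale[OF H] hh)
  moreover have "w - ?h \<in> VV K m"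
  proof -
    have "w - ?h = (\<Sum>\<beta>\<in>UNIV. vert_coeff b w \<beta> *\<^sub>R Vc K (tchart b) \<beta> m)
      + (\<Sum>\<alpha>\<in>UNIV. base_coeff b m w \<alpha> *\<^sub>R (\<Sum>\<gamma>\<in>UNIV. conn_coeff K N b \<alpha> \<gamma> m *\<^sub>R Vc K (tchart b) \<gamma> m))"
      by (subst (1) TT_expand[OF b wT, symmetric]) (simp add: comb_def hX_def scaleR_diff_right sum_subtractf)
    moreover have "\<dots> \<in> VV K m"
      by (intro subspace_add[OF VV_subspace] subspace_sum[OF VV_subspace] subspace_scale[OF VV_subspace] VV_sum_Vc[OF b] Vc_VV[OF b])
    ultimately show ?thesis by simp
  qed
  ultimately have "w - ?h = 0" by (rule horizontal_VV)
  then show ?thesis by simp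
qed

end

end

section \<open>The vertical metric\<close>

locale cotangent_spray = spray K AF P S J
  for K :: "('m::t2_space, 'p::t2_space, 'v::real_vector, 'n::finite, 'k::finite) fibred_algebroid"
    and AF :: "('f::t2_space, real^'k) chart set" and P :: "('p, 'v) pbracket"
    and S :: "('p, 'v) psection" and J :: "('p, 'v) pendo" +
  fixes \<Omega> :: "('p, 'v) pform"
  assumes cotangent: "almost_cotangent K \<Omega>" and compatible: "compatible K J \<Omega>"
begin

lemma Om_bilinear: "bilinear_form AT (prol K) \<Omega>"
  and Om_antisym: "w \<in> TT K m \<Longrightarrow> w' \<in> TT K m \<Longrightarrow> \<Omega> m w w' = - \<Omega> m w' w"
  and Om_nondeg: "w \<in> TT K m \<Longrightarrow> (\<And>w'. w' \<in> TT K m \<Longrightarrow> \<Omega> m w w' = 0) \<Longrightarrow> w = 0"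
  and VV_lagrangian: "lagrangian_subspace (TT K m) (\<Omega> m) (VV K m)"
  using cotangent unfolding almost_cotangent_def by blast+

lemma
  assumes "u \<in> TT K m" "u' \<in> TT K m" "w \<in> TT K m"
  shows Om_add1: "\<Omega> m (u + u') w = \<Omega> m u w + \<Omega> m u' w"
    and Om_add2: "\<Omega> m w (u + u') = \<Omega> m w u + \<Omega> m w u'"
  using Om_bilinear assms unfolding bilinear_form_def by blast+

lemma
  assumes "u \<in> TT K m" "w \<in> TT K m"
  shows Om_scale1: "\<Omega> m (r *\<^sub>R u) w = r * \<Omega> m u w"
    and Om_scale2: "\<Omega> m w (r *\<^sub>R u) = r * \<Omega> m w u"
  using Om_bilinear assms unfolding bilinear_form_def by blast+

lemma Om_smooth: "PS U s \<Longrightarrow> PS U t \<Longrightarrow> smooth_fun AT U (\<lambda>m. \<Omega> m (s m) (t m))"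
  using Om_bilinear unfolding bilinear_form_def by blast

lemma Om_bilinear_on: "bilinear_on (TT K m) (\<Omega> m)"
  unfolding bilinear_on_def using Om_add1 Om_add2 Om_scale1 Om_scale2 by blast

lemmas Om_sum2 = bilinear_sum_right[OF TT_subspace Om_bilinear_on]
  and Om_sum_both = bilinear_sum_both[OF TT_subspace Om_bilinear_on]

lemma Om_diff:
  assumes "u \<in> TT K m" "u' \<in> TT K m" "w \<in> TT K m"
  shows "\<Omega> m (u - u') w = \<Omega> m u w - \<Omega> m u' w" "\<Omega> m w (u - u') = \<Omega> m w u - \<Omega> m w u'"
  using Om_add1[OF assms(1) subspace_scale[OF TT_subspace assms(2), of "-1"] assms(3)]
    Om_add2[OF assms(1) subspace_scale[OF TT_subspace assms(2), of "-1"] assms(3)]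
    Om_scale1[OF assms(2,3), of "-1"] Om_scale2[OF assms(2,3), of "-1"] by simp_all

lemma Om_VV: "u \<in> VV K m \<Longrightarrow> w \<in> VV K m \<Longrightarrow> \<Omega> m u w = 0"
  using VV_lagrangian unfolding lagrangian_subspace_def by blast

abbreviation "g \<equiv> vertical_metric K J \<Omega>"

text \<open>The value does not depend on the chosen preimage under J: two preimages differ by a
  vertical vector, and \<Omega> vanishes on pairs of vertical vectors.\<close>

lemma metric_J:
  assumes z: "z \<in> TT K m" and y: "y \<in> VV K m"
  shows "g m (J m z) y = \<Omega> m z y"
proof -
  have "(THE r. \<exists>z'\<in>TT K m. J m z' = J m z \<and> r = \<Omega> m z' y) = \<Omega> m z y"
  proof (rule the_equality)
    show "\<exists>z'\<in>TT K m. J m z' = J m z \<and> \<Omega> m z y = \<Omega> m z' y" using z by blast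
    fix r assume "\<exists>z'\<in>TT K m. J m z' = J m z \<and> r = \<Omega> m z' y"
    then obtain z' where z': "z' \<in> TT K m" "J m z' = J m z" "r = \<Omega> m z' y" by blast
    have "J m (z' - z) = 0" by (simp add: J_diff[OF z'(1) z] z'(2))
    then have "z' - z \<in> VV K m" by (rule J_kerD[OF subspace_diff[OF TT_subspace z'(1) z]])
    then have "\<Omega> m (z' - z) y = 0" by (rule Om_VV[OF _ y])
    then show "r = \<Omega> m z y" by (simp add: Om_diff[OF z'(1) z VV_TT[OF y]] z'(3))
  qed
  then show ?thesis using J_VV[OF z] y by (simp add: vertical_metric_def)
qed

lemma VV_J: "u \<in> VV K m \<Longrightarrow> \<exists>z\<in>TT K m. u = J m z"
  using J_image by blast

lemma
  assumes "u \<in> VV K m" "u' \<in> VV K m" "w \<in> VV K m"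
  shows g_add1: "g m (u + u') w = g m u w + g m u' w"
    and g_add2: "g m w (u + u') = g m w u + g m w u'"
proof -
  obtain z z' y where z: "z \<in> TT K m" "u = J m z" "z' \<in> TT K m" "u' = J m z'" "y \<in> TT K m" "w = J m y"
    using VV_J assms by metis
  show "g m (u + u') w = g m u w + g m u' w"
    using metric_J[OF subspace_add[OF TT_subspace z(1,3)] assms(3)]
    by (simp add: z(2,4) metric_J z(1,3) assms(3) J_add Om_add1 VV_TT)
  show "g m w (u + u') = g m w u + g m w u'"
    using metric_J[OF z(5) subspace_add[OF VV_subspace assms(1,2)]] metric_J[OF z(5) assms(1)] metric_J[OF z(5) assms(2)]
      Om_add2[OF VV_TT[OF assms(1)] VV_TT[OF assms(2)] z(5)] by (simp add: z(6))
qed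

lemma
  assumes "u \<in> VV K m" "w \<in> VV K m"
  shows g_scale1: "g m (r *\<^sub>R u) w = r * g m u w"
    and g_scale2: "g m w (r *\<^sub>R u) = r * g m w u"
proof -
  obtain z y where z: "z \<in> TT K m" "u = J m z" "y \<in> TT K m" "w = J m y"
    using VV_J assms by metis
  show "g m (r *\<^sub>R u) w = r * g m u w"
    using metric_J[OF subspace_scale[OF TT_subspace z(1)] assms(2), of r] metric_J[OF z(1) assms(2)]
      Om_scale1[OF z(1) VV_TT[OF assms(2)]] by (simp add: z(2) J_scale[OF z(1)])
  show "g m w (r *\<^sub>R u) = r * g m w u"
    using metric_J[OF z(3) subspace_scale[OF VV_subspace assms(1)], of r] metric_J[OF z(3) assms(1)]
      Om_scale2[OF VV_TT[OF assms(1)] z(3)] by (simp add: z(4))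
qed

lemma g_bilinear_on: "bilinear_on (VV K m) (g m)"
  unfolding bilinear_on_def using g_add1 g_add2 g_scale1 g_scale2 by blast

lemmas g_sum1 = bilinear_sum_left[OF VV_subspace g_bilinear_on]
  and g_sum2 = bilinear_sum_right[OF VV_subspace g_bilinear_on]
  and g_sum_both = bilinear_sum_both[OF VV_subspace g_bilinear_on]

abbreviation "gc \<equiv> metric_coeff K \<Omega>"
abbreviation "om \<equiv> omega_coeff K \<Omega>"

text \<open>Uses the maximality in the Lagrangian condition: a vector \<Omega>-orthogonal to the
  vertical space is vertical, so J maps it to 0.\<close>

lemma g_nondeg:
  assumes u: "u \<in> VV K m" and 0: "\<And>y. y \<in> VV K m \<Longrightarrow> g m u y = 0"
  shows "u = 0"
proof -
  obtain z where z: "z \<in> TT K m" "u = J m z" using VV_J[OF u] by blast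
  have "\<Omega> m z y = 0" if "y \<in> VV K m" for y using 0[OF that] metric_J[OF z(1) that] by (simp add: z(2))
  then have "z \<in> VV K m" using VV_lagrangian[of m] z(1) unfolding lagrangian_subspace_def by blast
  then show ?thesis by (simp add: z(2) J_zero)
qed

context
  fixes b m
  assumes ad: "adapted K S J b" and m: "m \<in> cdom b"
begin

lemma bcan: "canonical K b"
  by (rule adapted_canonical[OF ad])

lemma g_Vc: "g m (Vc K (tchart b) \<alpha> m) (Vc K (tchart b) \<beta> m) = gc b \<alpha> \<beta> m"
  using metric_J[OF Xc_TT[OF bcan m] Vc_VV[OF bcan m]] by (simp add: J_Xc[OF ad m] metric_coeff_def)

text \<open>Compatibility of \<Omega> with J and antisymmetry of \<Omega> combine into symmetry of
  g.\<close>

lemma gc_sym: "gc b \<alpha> \<beta> m = gc b \<beta> \<alpha> m"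
proof -
  note X = Xc_TT[OF bcan m] and V = Vc_TT[OF bcan m]
  have "\<Omega> m (J m (Xc K b \<alpha> m)) (Xc K b \<beta> m) + \<Omega> m (Xc K b \<alpha> m) (J m (Xc K b \<beta> m)) = 0"
    using compatible X unfolding compatible_def by blast
  then show ?thesis using Om_antisym[OF V X] by (simp add: J_Xc[OF ad m] metric_coeff_def)
qed

lemma om_antisym: "om b \<alpha> \<beta> m = - om b \<beta> \<alpha> m"
  unfolding omega_coeff_def by (rule Om_antisym[OF Xc_TT[OF bcan m] Xc_TT[OF bcan m]])

text \<open>Nondegeneracy of g in the form in which \<open>smooth_fun_linear_system\<close> expects
  an invertible matrix.\<close>

lemma gc_ker:
  assumes "\<And>\<beta>. (\<Sum>\<gamma>\<in>UNIV. gc b \<beta> \<gamma> m * v \<gamma>) = 0"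
  shows "\<forall>\<gamma>. v \<gamma> = 0"
proof -
  let ?u = "\<Sum>\<gamma>\<in>UNIV. v \<gamma> *\<^sub>R Vc K (tchart b) \<gamma> m"
  note V = Vc_VV[OF bcan m]
  have uV: "?u \<in> VV K m" by (rule VV_sum_Vc[OF bcan m])
  have "g m ?u (Vc K (tchart b) \<beta> m) = 0" for \<beta>
    unfolding g_sum1[OF V V] g_Vc using assms[of \<beta>] gc_sym by (simp add: mult.commute)
  then have "g m ?u y = 0" if "y \<in> VV K m" for y
    using g_sum2[where v = "\<lambda>i. Vc K (tchart b) i m", OF V uV, where I = UNIV and x = "vert_coeff b y"] VV_expand[OF bcan m that] by simp
  then have "?u = 0" by (rule g_nondeg[OF uV])
  then show ?thesis using vert_coeff_sum_Vc[OF bcan m, of v] by (simp add: vert_coeff_def)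
qed

lemma gc_solve: "\<exists>c. \<forall>\<beta>. (\<Sum>\<gamma>\<in>UNIV. gc b \<beta> \<gamma> m * c \<gamma>) = r \<beta>"
proof -
  let ?A = "\<chi> i j. gc b i j m" and ?r = "\<chi> i. r i"
  have "det ?A \<noteq> 0"
    unfolding det_nonzero_iff_ker
  proof (intro allI impI)
    fix x assume "?A *v x = 0"
    then have "(\<Sum>j\<in>UNIV. gc b i j m * x $ j) = 0" for i by (simp add: vec_eq_iff matrix_vector_mult_def)
    from gc_ker[OF this] show "x = 0" by (simp add: vec_eq_iff)
  qed
  then obtain x where "?A *v x = ?r" using cramer by blast
  then show ?thesis by (intro exI[of _ "vec_nth x"]) (simp add: vec_eq_iff matrix_vector_mult_def)
qed

end

end

section \<open>Lagrangian and metric connections in an adapted basis\<close>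

context spray
begin

lemma vproj_eq: "vproj N m w = w - hproj N m w"
proof -
  have "w - hproj N m w = (1/2) *\<^sub>R (2 *\<^sub>R w) - (1/2) *\<^sub>R (w + N m w)" by (simp add: hproj_def)
  also have "\<dots> = vproj N m w" unfolding vproj_def scaleR_diff_right[symmetric] by (simp add: scaleR_2)
  finally show ?thesis by simp
qed

lemma vproj_VV: "nonlinear_connection K N \<Longrightarrow> w \<in> TT K m \<Longrightarrow> vproj N m w \<in> VV K m"
  unfolding vproj_def by (rule subspace_scale[OF VV_subspace nc_diff_VV])

lemma hproj_horizontal:
  assumes N: "nonlinear_connection K N" and w: "w \<in> TT K m"
  shows "hproj N m w \<in> horizontal K N m"
proof -
  note Nw = nc_in[OF N w]
  have "w + N m w \<in> horizontal K N m"
    using nc_add[OF N w Nw] nc_square[OF N w] subspace_add[OF TT_subspace w Nw] by (simp add: horizontal_def)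
  then show ?thesis unfolding hproj_def by (rule subspace_scale[OF horizontal_subspace[OF N]])
qed

end

context cotangent_spray
begin

section \<open>Components of the two conditions\<close>

definition conn_lowered :: "('p, 'v) pendo \<Rightarrow> ('m, 'p, 'v, 'n, 'k) canon \<Rightarrow> 'k \<Rightarrow> 'k \<Rightarrow> 'p \<Rightarrow> real" where
  "conn_lowered N b \<alpha> \<beta> m = (\<Sum>\<gamma>\<in>UNIV. gc b \<beta> \<gamma> m * conn_coeff K N b \<alpha> \<gamma> m)"

definition spray_deriv_lowered :: "('m, 'p, 'v, 'n, 'k) canon \<Rightarrow> 'k \<Rightarrow> 'k \<Rightarrow> 'p \<Rightarrow> real" where
  "spray_deriv_lowered b \<alpha> \<beta> m = (\<Sum>\<gamma>\<in>UNIV. gc b \<beta> \<gamma> m * dS b \<gamma> \<alpha> m)"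

text \<open>The value of \<open>conn_lowered\<close> forced by the two conditions: in their sum the
  terms with exchanged indices cancel and 2 \<open>conn_lowered\<close> remains, whence the factor
  -1/2.\<close>

definition solution_coeff :: "('m, 'p, 'v, 'n, 'k) canon \<Rightarrow> 'k \<Rightarrow> 'k \<Rightarrow> 'p \<Rightarrow> real" where
  "solution_coeff b \<alpha> \<beta> m = - (1/2) * (om b \<alpha> \<beta> m + lie_deriv_fun S (gc b \<alpha> \<beta>) m + spray_deriv_lowered b \<beta> \<alpha> m + spray_deriv_lowered b \<alpha> \<beta> m)"

definition lagrangian_coeff :: "('p, 'v) pendo \<Rightarrow> ('m, 'p, 'v, 'n, 'k) canon \<Rightarrow> 'k \<Rightarrow> 'k \<Rightarrow> 'p \<Rightarrow> real" where
  "lagrangian_coeff N b \<alpha> \<beta> m = om b \<alpha> \<beta> m + conn_lowered N b \<alpha> \<beta> m - conn_lowered N b \<beta> \<alpha> m"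

definition metricity_coeff :: "('p, 'v) pendo \<Rightarrow> ('m, 'p, 'v, 'n, 'k) canon \<Rightarrow> 'k \<Rightarrow> 'k \<Rightarrow> 'p \<Rightarrow> real" where
  "metricity_coeff N b \<alpha> \<beta> m = lie_deriv_fun S (gc b \<alpha> \<beta>) m + conn_lowered N b \<alpha> \<beta> m + spray_deriv_lowered b \<alpha> \<beta> m + conn_lowered N b \<beta> \<alpha> m + spray_deriv_lowered b \<beta> \<alpha> m"

lemma gc_smooth:
  assumes "canonical K b"
  shows "smooth_fun AT (cdom b) (gc b \<alpha> \<beta>)"
  using Om_smooth[OF Xc_smooth[OF assms] VS_PS[OF Vc_smooth[OF assms]]] by (simp add: metric_coeff_def[abs_def])

lemma lie_gc_sym:
  assumes "adapted K S J b" "m \<in> cdom b"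
  shows "lie_deriv_fun S (gc b \<alpha> \<beta>) m = lie_deriv_fun S (gc b \<beta> \<alpha>) m"
  unfolding lie_deriv_fun_def
  by (rule T.tangent_cong[OF snd_TT_tangent[OF PS_TT[OF S_smooth[OF open_UNIV] UNIV_I]]
      canonicalD(3)[OF adapted_canonical[OF assms(1)]] assms(2)]) (rule gc_sym[OF assms(1)])

text \<open>The equivalence holds for each pair of indices together with its exchange: the two
  conditions are the skew and the symmetric part of one equation, as \<omega> is skew and S(g)
  symmetric.\<close>

lemma coefficients_iff:
  assumes "adapted K S J b" "m \<in> cdom b"
  shows "(\<forall>\<alpha> \<beta>. conn_lowered N b \<alpha> \<beta> m = solution_coeff b \<alpha> \<beta> m) \<longleftrightarrow> (\<forall>\<alpha> \<beta>. lagrangian_coeff N b \<alpha> \<beta> m = 0) \<and> (\<forall>\<alpha> \<beta>. metricity_coeff N b \<alpha> \<beta> m = 0)"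
proof -
  have "conn_lowered N b \<alpha> \<beta> m = solution_coeff b \<alpha> \<beta> m \<and> conn_lowered N b \<beta> \<alpha> m = solution_coeff b \<beta> \<alpha> m \<longleftrightarrow>
      lagrangian_coeff N b \<alpha> \<beta> m = 0 \<and> metricity_coeff N b \<alpha> \<beta> m = 0" for \<alpha> \<beta>
    using lie_gc_sym[OF assms, of \<alpha> \<beta>] om_antisym[OF assms, of \<alpha> \<beta>]
    unfolding solution_coeff_def lagrangian_coeff_def metricity_coeff_def by argo
  then show ?thesis by blast
qed

context
  fixes b m N
  assumes ad: "adapted K S J b" and m: "m \<in> cdom b" and N: "nonlinear_connection K N"
begin

lemmas bc = adapted_canonical[OF ad]

lemma hX_TT: "hX N b \<alpha> m \<in> TT K m"
  using hX_horizontal[OF N bc m] by (simp add: horizontal_def)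

lemma Om_hX: "\<Omega> m (hX N b \<alpha> m) (hX N b \<beta> m) = lagrangian_coeff N b \<alpha> \<beta> m"
proof -
  note X = Xc_TT[OF bc m] and V = Vc_TT[OF bc m] and vV = VV_sum_Vc[OF bc m]
  let ?v = "\<lambda>\<alpha>. \<Sum>\<gamma>\<in>UNIV. conn_coeff K N b \<alpha> \<gamma> m *\<^sub>R Vc K (tchart b) \<gamma> m"
  note vT = VV_TT[OF vV]
  have Xv: "\<Omega> m (Xc K b \<alpha> m) (?v \<beta>) = conn_lowered N b \<beta> \<alpha> m" for \<alpha> \<beta>
    unfolding Om_sum2[OF V X] conn_lowered_def metric_coeff_def by (simp add: mult.commute)
  have "\<Omega> m (hX N b \<alpha> m) (hX N b \<beta> m)
      = \<Omega> m (Xc K b \<alpha> m) (Xc K b \<beta> m) - \<Omega> m (Xc K b \<alpha> m) (?v \<beta>) - (\<Omega> m (?v \<alpha>) (Xc K b \<beta> m) - \<Omega> m (?v \<alpha>) (?v \<beta>))"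
    unfolding hX_def[OF N] Om_diff(1)[OF X vT subspace_diff[OF TT_subspace X vT]] Om_diff(2)[OF X vT X] Om_diff(2)[OF X vT vT] ..
  also have "\<Omega> m (?v \<alpha>) (Xc K b \<beta> m) = - \<Omega> m (Xc K b \<beta> m) (?v \<alpha>)" by (rule Om_antisym[OF vT X])
  finally show ?thesis by (simp add: Xv Om_VV[OF vV vV] lagrangian_coeff_def omega_coeff_def)
qed

text \<open>The coefficients express isotropy of the horizontal space; maximality follows. If w is
  orthogonal to that space, so is its vertical part, which is also orthogonal to the Lagrangian
  vertical space, hence to everything, and nondegeneracy makes it 0.\<close>

lemma lagrangian_at:
  "lagrangian_subspace (TT K m) (\<Omega> m) (horizontal K N m) \<longleftrightarrow> (\<forall>\<alpha> \<beta>. lagrangian_coeff N b \<alpha> \<beta> m = 0)"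
proof
  assume "lagrangian_subspace (TT K m) (\<Omega> m) (horizontal K N m)"
  then have "\<forall>w\<in>horizontal K N m. \<forall>u\<in>horizontal K N m. \<Omega> m w u = 0" unfolding lagrangian_subspace_def by blast
  then show "\<forall>\<alpha> \<beta>. lagrangian_coeff N b \<alpha> \<beta> m = 0" using hX_horizontal[OF N bc m] unfolding Om_hX[symmetric] by blast
next
  assume 0: "\<forall>\<alpha> \<beta>. lagrangian_coeff N b \<alpha> \<beta> m = 0"
  have iso: "\<Omega> m w u = 0" if w: "w \<in> horizontal K N m" and u: "u \<in> horizontal K N m" for w u
  proof -
    have "\<Omega> m (\<Sum>\<alpha>\<in>UNIV. base_coeff b m w \<alpha> *\<^sub>R hX N b \<alpha> m) (\<Sum>\<alpha>\<in>UNIV. base_coeff b m u \<alpha> *\<^sub>R hX N b \<alpha> m) = 0"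
      unfolding Om_sum_both[OF hX_TT hX_TT] Om_hX by (simp add: 0)
    then show ?thesis by (simp flip: horizontal_expand[OF N bc m w] horizontal_expand[OF N bc m u])
  qed
  have "w \<in> horizontal K N m" if w: "w \<in> TT K m" and ort: "\<forall>u\<in>horizontal K N m. \<Omega> m w u = 0" for w
  proof -
    have h: "hproj N m t \<in> horizontal K N m" "hproj N m t \<in> TT K m" if "t \<in> TT K m" for t
      using hproj_horizontal[OF N that] by (simp_all add: horizontal_def)
    note v = vproj_VV[OF N]
    have "\<Omega> m (vproj N m w) t = 0" if t: "t \<in> TT K m" for t
    proof -
      have "\<Omega> m (vproj N m w) (hproj N m t) = \<Omega> m w (hproj N m t) - \<Omega> m (hproj N m w) (hproj N m t)"
        using Om_diff(1)[OF w h(2)[OF w] h(2)[OF t]] by (simp add: vproj_eq)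
      also have "\<dots> = 0" using ort h(1)[OF t] iso[OF h(1)[OF w] h(1)[OF t]] by simp
      finally have "\<Omega> m (vproj N m w) (hproj N m t + vproj N m t) = 0"
        unfolding Om_add2[OF h(2)[OF t] VV_TT[OF v[OF t]] VV_TT[OF v[OF w]]] using Om_VV[OF v[OF w] v[OF t]] by simp
      then show ?thesis by (simp add: vproj_eq)
    qed
    then have "vproj N m w = 0" by (rule Om_nondeg[OF VV_TT[OF v[OF w]]])
    then have "hproj N m w = w" by (simp add: vproj_eq)
    then show ?thesis using h(1)[OF w] by simp
  qed
  then show "lagrangian_subspace (TT K m) (\<Omega> m) (horizontal K N m)"
    unfolding lagrangian_subspace_def using iso by (auto simp: horizontal_def)
qed

text \<open>v_N maps X_\<alpha> to N_\<alpha>^\<gamma> V_\<gamma> and fixes each V_\<gamma>; it is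
  applied to [S, V_\<alpha>] as computed in \<open>P_S_Vc_adapted\<close>.\<close>

lemma dyn_Vc:
  "dyn_deriv P S N (Vc K (tchart b) \<alpha>) m =
    - (\<Sum>\<gamma>\<in>UNIV. (conn_coeff K N b \<alpha> \<gamma> m + dS b \<gamma> \<alpha> m) *\<^sub>R Vc K (tchart b) \<gamma> m)"
proof -
  let ?v = "\<Sum>\<gamma>\<in>UNIV. conn_coeff K N b \<alpha> \<gamma> m *\<^sub>R Vc K (tchart b) \<gamma> m"
  let ?d = "\<Sum>\<gamma>\<in>UNIV. dS b \<gamma> \<alpha> m *\<^sub>R Vc K (tchart b) \<gamma> m"
  let ?X = "Xc K b \<alpha> m"
  note X = Xc_TT[OF bc m] and dV = VV_sum_Vc[OF bc m]
  have "N m (- (?X + ?d)) = - (N m ?X + N m ?d)"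
    using nc_scale[OF N subspace_add[OF TT_subspace X VV_TT[OF dV]], of "-1"] nc_add[OF N X VV_TT[OF dV]] by simp
  then have "- (?X + ?d) - N m (- (?X + ?d)) = - (?X + ?d) + (?X - 2 *\<^sub>R ?v - ?d)"
    by (simp add: nc_Xc[OF N bc m] nc_VV[OF N dV])
  also have "\<dots> = 2 *\<^sub>R (- (?v + ?d))"
    by (simp add: scaleR_2)
  finally show ?thesis
    unfolding dyn_deriv_def vproj_def P_S_Vc_adapted[OF ad m] by (simp add: scaleR_add_left sum.distrib)
qed

lemma dyn_Vc_VV: "dyn_deriv P S N (Vc K (tchart b) \<alpha>) m \<in> VV K m"
  unfolding dyn_Vc by (rule subspace_neg[OF VV_subspace VV_sum_Vc[OF bc m]])

text \<open>The dynamical derivation inherits the Leibniz rule of the bracket because v_N is the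
  identity on vertical vectors.\<close>

lemma dyn_local:
  assumes X: "VS U X" and mU: "m \<in> U"
  shows "dyn_deriv P S N X m = (\<Sum>\<alpha>\<in>UNIV. vert_coeff b (X m) \<alpha> *\<^sub>R dyn_deriv P S N (Vc K (tchart b) \<alpha>) m)
    + (\<Sum>\<alpha>\<in>UNIV. snd (S m) (\<lambda>q. vert_coeff b (X q) \<alpha>) *\<^sub>R Vc K (tchart b) \<alpha> m)"
proof -
  let ?V = "U \<inter> cdom b"
  note XP = VS_PS[OF X]
  have oV: "open ?V" using PS_open[OF XP] canonicalD(3)[OF bc] by (rule open_Int)
  have mV: "m \<in> ?V" using mU m by simp
  have Vs: "PS ?V (Vc K (tchart b) \<alpha>)" for \<alpha>
    using PS_subset[OF VS_PS[OF Vc_smooth[OF bc]] oV] by simp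
  have x: "smooth_fun AT ?V (\<lambda>q. vert_coeff b (X q) \<alpha>)" for \<alpha> by (rule PS_vert_coeff[OF XP bc])
  let ?Y = "\<lambda>q. \<Sum>\<alpha>\<in>UNIV. vert_coeff b (X q) \<alpha> *\<^sub>R Vc K (tchart b) \<alpha> q"
  have Y: "PS ?V ?Y" by (intro PS_sum oV PS_scale x Vs)
  have XY: "X q = ?Y q" if "q \<in> ?V" for q
    using VV_expand[OF bc _ VS_VV[OF X]] that by simp
  have "P S X m = P S ?Y m"
    by (rule P_local[OF S_smooth[OF PS_open[OF XP]] XP Y oV Int_lower1 XY mV])
  also have "\<dots> = (\<Sum>\<alpha>\<in>UNIV. vert_coeff b (X m) \<alpha> *\<^sub>R P S (Vc K (tchart b) \<alpha>) m
      + snd (S m) (\<lambda>q. vert_coeff b (X q) \<alpha>) *\<^sub>R Vc K (tchart b) \<alpha> m)"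
    by (rule P_sum[OF S_smooth[OF oV] Vs x mV])
  finally have PX: "P S X m = (\<Sum>\<alpha>\<in>UNIV. vert_coeff b (X m) \<alpha> *\<^sub>R P S (Vc K (tchart b) \<alpha>) m)
      + (\<Sum>\<alpha>\<in>UNIV. snd (S m) (\<lambda>q. vert_coeff b (X q) \<alpha>) *\<^sub>R Vc K (tchart b) \<alpha> m)" (is "_ = ?p + ?q")
    by (simp add: sum.distrib)
  have PT: "P S (Vc K (tchart b) \<alpha>) m \<in> TT K m" for \<alpha>
    by (rule PS_TT[OF P_smooth[OF S_smooth[OF oV] Vs] mV])
  have pT: "?p \<in> TT K m" by (intro subspace_sum[OF TT_subspace] subspace_scale[OF TT_subspace] PT)
  have qV: "?q \<in> VV K m" by (rule VV_sum_Vc[OF bc m])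
  have "N m (?p + ?q) = (\<Sum>\<alpha>\<in>UNIV. vert_coeff b (X m) \<alpha> *\<^sub>R N m (P S (Vc K (tchart b) \<alpha>) m)) - ?q"
    by (simp add: nc_add[OF N pT VV_TT[OF qV]] nc_VV[OF N qV] nc_sum[OF N PT])
  then have "P S X m - N m (P S X m) = (\<Sum>\<alpha>\<in>UNIV. vert_coeff b (X m) \<alpha> *\<^sub>R (P S (Vc K (tchart b) \<alpha>) m - N m (P S (Vc K (tchart b) \<alpha>) m)))
      + 2 *\<^sub>R ?q"
    unfolding PX by (simp add: scaleR_diff_right sum_subtractf scaleR_2)
  then show ?thesis
    by (simp add: dyn_deriv_def vproj_def scaleR_add_right scaleR_sum_right mult.commute)
qed

lemma g_dyn_Vc:
  "g m (dyn_deriv P S N (Vc K (tchart b) \<alpha>) m) (Vc K (tchart b) \<beta> m) = - (conn_lowered N b \<alpha> \<beta> m + spray_deriv_lowered b \<alpha> \<beta> m)"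
  "g m (Vc K (tchart b) \<beta> m) (dyn_deriv P S N (Vc K (tchart b) \<alpha>) m) = - (conn_lowered N b \<alpha> \<beta> m + spray_deriv_lowered b \<alpha> \<beta> m)"
proof -
  note V = Vc_VV[OF bc m] and s = VV_sum_Vc[OF bc m]
  let ?z = "\<Sum>\<gamma>\<in>UNIV. (conn_coeff K N b \<alpha> \<gamma> m + dS b \<gamma> \<alpha> m) *\<^sub>R Vc K (tchart b) \<gamma> m"
  have e: "(\<Sum>\<gamma>\<in>UNIV. (conn_coeff K N b \<alpha> \<gamma> m + dS b \<gamma> \<alpha> m) * gc b \<beta> \<gamma> m) = conn_lowered N b \<alpha> \<beta> m + spray_deriv_lowered b \<alpha> \<beta> m"
    unfolding conn_lowered_def spray_deriv_lowered_def sum.distrib[symmetric] by (intro sum.cong refl) (simp add: algebra_simps)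
  have 1: "g m ?z (Vc K (tchart b) \<beta> m) = conn_lowered N b \<alpha> \<beta> m + spray_deriv_lowered b \<alpha> \<beta> m"
    unfolding g_sum1[OF V V] g_Vc[OF ad m] gc_sym[OF ad m, of _ \<beta>] by (rule e)
  have 2: "g m (Vc K (tchart b) \<beta> m) ?z = conn_lowered N b \<alpha> \<beta> m + spray_deriv_lowered b \<alpha> \<beta> m"
    unfolding g_sum2[OF V V] g_Vc[OF ad m] by (rule e)
  show "g m (dyn_deriv P S N (Vc K (tchart b) \<alpha>) m) (Vc K (tchart b) \<beta> m) = - (conn_lowered N b \<alpha> \<beta> m + spray_deriv_lowered b \<alpha> \<beta> m)"
    unfolding dyn_Vc using g_scale1[OF s V, where r = "-1"] by (simp add: 1)
  show "g m (Vc K (tchart b) \<beta> m) (dyn_deriv P S N (Vc K (tchart b) \<alpha>) m) = - (conn_lowered N b \<alpha> \<beta> m + spray_deriv_lowered b \<alpha> \<beta> m)"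
    unfolding dyn_Vc using g_scale2[OF s V, where r = "-1"] by (simp add: 2)
qed

text \<open>The derivatives of the components of X and X' produced by the product rule cancel
  against those in \<open>dyn_local\<close>. Thus D_N g is a tensor, which makes the description in
  \<open>defect_form\<close> well posed and lets metricity be tested on basis vectors.\<close>

lemma dyn_metric_local:
  assumes X: "VS U X" "VS U X'" and mU: "m \<in> U"
  shows "dyn_deriv_metric P S N g X X' m =
    (\<Sum>\<alpha>\<in>UNIV. \<Sum>\<beta>\<in>UNIV. vert_coeff b (X m) \<alpha> * vert_coeff b (X' m) \<beta> * metricity_coeff N b \<alpha> \<beta> m)"
proof -
  let ?V = "U \<inter> cdom b"
  let ?x = "\<lambda>\<alpha> q. vert_coeff b (X q) \<alpha>" and ?x' = "\<lambda>\<alpha> q. vert_coeff b (X' q) \<alpha>"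
  let ?D = "snd (S m)"
  note XP = VS_PS[OF X(1)] VS_PS[OF X(2)] and V = Vc_VV[OF bc m]
  have oV: "open ?V" using PS_open[OF XP(1)] canonicalD(3)[OF bc] by (rule open_Int)
  have mV: "m \<in> ?V" using mU m by simp
  have St: "?D \<in> tangent_space AT m"
    by (rule snd_TT_tangent[OF PS_TT[OF S_smooth[OF open_UNIV] UNIV_I]])
  have x: "smooth_fun AT ?V (?x \<alpha>)" and x': "smooth_fun AT ?V (?x' \<alpha>)" for \<alpha>
    by (rule PS_vert_coeff[OF XP(1) bc]) (rule PS_vert_coeff[OF XP(2) bc])
  have gs: "smooth_fun AT ?V (gc b \<alpha> \<beta>)" for \<alpha> \<beta>
    by (rule T.smooth_fun_subset[OF gc_smooth[OF bc] oV]) simp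
  have Xe: "X q = (\<Sum>\<alpha>\<in>UNIV. ?x \<alpha> q *\<^sub>R Vc K (tchart b) \<alpha> q)" "X' q = (\<Sum>\<alpha>\<in>UNIV. ?x' \<alpha> q *\<^sub>R Vc K (tchart b) \<alpha> q)"
    if "q \<in> ?V" for q
    using VV_expand[OF bc _ VS_VV[OF X(1)]] VV_expand[OF bc _ VS_VV[OF X(2)]] that by simp_all
  have gX: "g q (X q) (X' q) = (\<Sum>\<alpha>\<in>UNIV. \<Sum>\<beta>\<in>UNIV. ?x \<alpha> q * ?x' \<beta> q * gc b \<alpha> \<beta> q)" if q: "q \<in> ?V" for q
  proof -
    have qb: "q \<in> cdom b" using q by simp
    have "g q (\<Sum>\<alpha>\<in>UNIV. ?x \<alpha> q *\<^sub>R Vc K (tchart b) \<alpha> q) (\<Sum>\<alpha>\<in>UNIV. ?x' \<alpha> q *\<^sub>R Vc K (tchart b) \<alpha> q) =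
       (\<Sum>\<alpha>\<in>UNIV. \<Sum>\<beta>\<in>UNIV. ?x \<alpha> q * ?x' \<beta> q * gc b \<alpha> \<beta> q)"
      unfolding g_sum_both[OF Vc_VV[OF bc qb] Vc_VV[OF bc qb]] g_Vc[OF ad qb] ..
    then show ?thesis by (simp flip: Xe[OF q])
  qed
  have "?D (\<lambda>q. g q (X q) (X' q)) = ?D (\<lambda>q. \<Sum>\<alpha>\<in>UNIV. \<Sum>\<beta>\<in>UNIV. ?x \<alpha> q * ?x' \<beta> q * gc b \<alpha> \<beta> q)"
    by (rule T.tangent_cong[OF St oV mV gX])
  also have "\<dots> = (\<Sum>\<alpha>\<in>UNIV. ?D (\<lambda>q. \<Sum>\<beta>\<in>UNIV. ?x \<alpha> q * ?x' \<beta> q * gc b \<alpha> \<beta> q))"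
    by (rule T.tangent_sum[OF St oV mV]) (intro T.smooth_fun_sum[OF oV] T.smooth_fun_mult x x' gs)
  also have "\<dots> = (\<Sum>\<alpha>\<in>UNIV. \<Sum>\<beta>\<in>UNIV. ?D (\<lambda>q. ?x \<alpha> q * ?x' \<beta> q * gc b \<alpha> \<beta> q))"
    by (rule sum.cong[OF refl], rule T.tangent_sum[OF St oV mV]) (intro T.smooth_fun_mult x x' gs)
  also have "\<dots> = (\<Sum>\<alpha>\<in>UNIV. \<Sum>\<beta>\<in>UNIV. ?x \<alpha> m * ?x' \<beta> m * ?D (gc b \<alpha> \<beta>)
      + (?x \<alpha> m * ?D (?x' \<beta>) + ?D (?x \<alpha>) * ?x' \<beta> m) * gc b \<alpha> \<beta> m)"
    unfolding T.tangent_mult[OF St T.smooth_fun_mult[OF x x'] gs mV] T.tangent_mult[OF St x x' mV] ..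
  finally have lie: "lie_deriv_fun S (\<lambda>q. g q (X q) (X' q)) m = \<dots>" by (simp add: lie_deriv_fun_def)
  note d = dyn_Vc_VV
  let ?p = "\<Sum>\<alpha>\<in>UNIV. ?x \<alpha> m *\<^sub>R dyn_deriv P S N (Vc K (tchart b) \<alpha>) m" and ?q = "\<Sum>\<alpha>\<in>UNIV. ?D (?x \<alpha>) *\<^sub>R Vc K (tchart b) \<alpha> m"
  let ?p' = "\<Sum>\<alpha>\<in>UNIV. ?x' \<alpha> m *\<^sub>R dyn_deriv P S N (Vc K (tchart b) \<alpha>) m" and ?q' = "\<Sum>\<alpha>\<in>UNIV. ?D (?x' \<alpha>) *\<^sub>R Vc K (tchart b) \<alpha> m"
  let ?X = "\<Sum>\<alpha>\<in>UNIV. ?x \<alpha> m *\<^sub>R Vc K (tchart b) \<alpha> m" and ?X' = "\<Sum>\<alpha>\<in>UNIV. ?x' \<alpha> m *\<^sub>R Vc K (tchart b) \<alpha> m"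
  have sV: "(\<Sum>\<alpha>\<in>UNIV. z \<alpha> *\<^sub>R w \<alpha>) \<in> VV K m" if "\<And>\<alpha>. w \<alpha> \<in> VV K m" for z :: "'k \<Rightarrow> real" and w
    by (intro subspace_sum[OF VV_subspace] subspace_scale[OF VV_subspace] that)
  have 1: "g m (dyn_deriv P S N X m) (X' m) = (\<Sum>\<alpha>\<in>UNIV. \<Sum>\<beta>\<in>UNIV. ?x \<alpha> m * ?x' \<beta> m * - (conn_lowered N b \<alpha> \<beta> m + spray_deriv_lowered b \<alpha> \<beta> m))
      + (\<Sum>\<alpha>\<in>UNIV. \<Sum>\<beta>\<in>UNIV. ?D (?x \<alpha>) * ?x' \<beta> m * gc b \<alpha> \<beta> m)"
  proof -
    have "g m (?p + ?q) ?X' = (\<Sum>\<alpha>\<in>UNIV. \<Sum>\<beta>\<in>UNIV. ?x \<alpha> m * ?x' \<beta> m * - (conn_lowered N b \<alpha> \<beta> m + spray_deriv_lowered b \<alpha> \<beta> m))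
      + (\<Sum>\<alpha>\<in>UNIV. \<Sum>\<beta>\<in>UNIV. ?D (?x \<alpha>) * ?x' \<beta> m * gc b \<alpha> \<beta> m)"
      unfolding g_add1[OF sV[OF d] sV[OF V] sV[OF V]] g_sum_both[OF d V] g_sum_both[OF V V] g_dyn_Vc g_Vc[OF ad m] ..
    then show ?thesis unfolding dyn_local[OF X(1) mU] Xe(2)[OF mV, symmetric] .
  qed
  have 2: "g m (X m) (dyn_deriv P S N X' m) = (\<Sum>\<alpha>\<in>UNIV. \<Sum>\<beta>\<in>UNIV. ?x \<alpha> m * ?x' \<beta> m * - (conn_lowered N b \<beta> \<alpha> m + spray_deriv_lowered b \<beta> \<alpha> m))
      + (\<Sum>\<alpha>\<in>UNIV. \<Sum>\<beta>\<in>UNIV. ?x \<alpha> m * ?D (?x' \<beta>) * gc b \<alpha> \<beta> m)"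
  proof -
    have "g m ?X (?p' + ?q') = (\<Sum>\<alpha>\<in>UNIV. \<Sum>\<beta>\<in>UNIV. ?x \<alpha> m * ?x' \<beta> m * - (conn_lowered N b \<beta> \<alpha> m + spray_deriv_lowered b \<beta> \<alpha> m))
      + (\<Sum>\<alpha>\<in>UNIV. \<Sum>\<beta>\<in>UNIV. ?x \<alpha> m * ?D (?x' \<beta>) * gc b \<alpha> \<beta> m)"
      unfolding g_add2[OF sV[OF d] sV[OF V] sV[OF V]] g_sum_both[OF V d] g_sum_both[OF V V] g_dyn_Vc g_Vc[OF ad m] ..
    then show ?thesis unfolding dyn_local[OF X(2) mU] Xe(1)[OF mV, symmetric] .
  qed
  show ?thesis
    unfolding dyn_deriv_metric_def lie 1 2 sum.distrib[symmetric] sum_subtractf[symmetric]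
    by (intro sum.cong refl) (simp add: metricity_coeff_def lie_deriv_fun_def algebra_simps)
qed

end

end

section \<open>The Lagrangian metric connection\<close>

context cotangent_spray
begin

abbreviation "LM N \<equiv> lagrangian_connection K \<Omega> N \<and> metric_connection K P S g N"

lemma VS_const_comb:
  assumes "canonical K b"
  shows "VS (cdom b) (\<lambda>q. \<Sum>\<alpha>\<in>UNIV. u \<alpha> *\<^sub>R Vc K (tchart b) \<alpha> q)"
  unfolding VS_iff
proof
  show "PS (cdom b) (\<lambda>q. \<Sum>\<alpha>\<in>UNIV. u \<alpha> *\<^sub>R Vc K (tchart b) \<alpha> q)"
    by (intro PS_sum PS_scale T.smooth_fun_const VS_PS[OF Vc_smooth[OF assms]] canonicalD(3)[OF assms])
qed (use VV_sum_Vc[OF assms] in blast)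

lemma LM_coefficients:
  assumes N: "nonlinear_connection K N" and LM: "LM N" and b: "adapted K S J b" "m \<in> cdom b"
  shows "conn_lowered N b \<alpha> \<beta> m = solution_coeff b \<alpha> \<beta> m"
proof -
  have bc: "canonical K b" by (rule adapted_canonical[OF b(1)])
  have l: "\<forall>\<alpha> \<beta>. lagrangian_coeff N b \<alpha> \<beta> m = 0"
    using LM unfolding lagrangian_connection_def lagrangian_at[OF b N, symmetric] by blast
  have "metricity_coeff N b \<alpha> \<beta> m = 0" for \<alpha> \<beta>
  proof -
    note V = Vc_smooth[OF bc]
    have vc: "vert_coeff b (Vc K (tchart b) \<alpha> m) \<gamma> = (if \<gamma> = \<alpha> then 1 else 0)" for \<alpha> \<gamma>
      by (simp add: vert_coeff_def snd_Vc_ycoord[OF bc b(2)])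
    have "0 = dyn_deriv_metric P S N g (Vc K (tchart b) \<alpha>) (Vc K (tchart b) \<beta>) m"
      using LM V b(2) unfolding metric_connection_def by metis
    also have "\<dots> = metricity_coeff N b \<alpha> \<beta> m"
      unfolding dyn_metric_local[OF b N V V b(2)] vc
      by (simp add: if_distrib[of "\<lambda>r. r * _"] if_distrib[of "\<lambda>r. _ * r"] cong: if_cong)
    finally show ?thesis by simp
  qed
  then show ?thesis using coefficients_iff[OF b, of N] l by blast
qed

text \<open>One adapted basis at each point suffices here, while \<open>LM_coefficients\<close>
  covers all of them; together they give both criteria in \<open>LM_iff\<close>.\<close>

lemma LM_I:
  assumes N: "nonlinear_connection K N"
    and G: "\<And>m. \<exists>b. adapted K S J b \<and> m \<in> cdom b \<and> (\<forall>\<alpha> \<beta>. conn_lowered N b \<alpha> \<beta> m = solution_coeff b \<alpha> \<beta> m)"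
  shows "LM N"
proof
  show "lagrangian_connection K \<Omega> N"
    unfolding lagrangian_connection_def
  proof
    fix m
    obtain b where b: "adapted K S J b" "m \<in> cdom b" "\<forall>\<alpha> \<beta>. conn_lowered N b \<alpha> \<beta> m = solution_coeff b \<alpha> \<beta> m" using G by blast
    show "lagrangian_subspace (TT K m) (\<Omega> m) (horizontal K N m)"
      unfolding lagrangian_at[OF b(1,2) N] using b(3) coefficients_iff[OF b(1,2), of N] by blast
  qed
  show "metric_connection K P S g N"
    unfolding metric_connection_def
  proof (intro allI impI ballI)
    fix U X X' m assume X: "VS U X \<and> VS U X'" and m: "m \<in> U"
    obtain b where b: "adapted K S J b" "m \<in> cdom b" "\<forall>\<alpha> \<beta>. conn_lowered N b \<alpha> \<beta> m = solution_coeff b \<alpha> \<beta> m" using G by blast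
    have "metricity_coeff N b \<alpha> \<beta> m = 0" for \<alpha> \<beta> using b(3) coefficients_iff[OF b(1,2), of N] by blast
    then show "dyn_deriv_metric P S N g X X' m = 0"
      unfolding dyn_metric_local[OF b(1,2) N conjunct1[OF X] conjunct2[OF X] m] by simp
  qed
qed

text \<open>From \<open>nc_Xc\<close>, as X_\<alpha> annihilates the fibre coordinates. It transfers
  formulas and smoothness from the endomorphism to its coefficients.\<close>

lemma conn_coeff_eq:
  assumes N: "nonlinear_connection K N" and b: "canonical K b" "m \<in> cdom b"
  shows "conn_coeff K N b \<alpha> \<gamma> m = - (1/2) * vert_coeff b (N m (Xc K b \<alpha> m)) \<gamma>"
proof -
  let ?v = "\<Sum>\<gamma>\<in>UNIV. conn_coeff K N b \<alpha> \<gamma> m *\<^sub>R Vc K (tchart b) \<gamma> m"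
  have "vert_coeff b (Xc K b \<alpha> m + (-2) *\<^sub>R ?v) \<gamma> = -2 * conn_coeff K N b \<alpha> \<gamma> m"
    unfolding vert_coeff_add vert_coeff_scale vert_coeff_sum_Vc[OF b]
    by (simp add: vert_coeff_def snd_Xc_ycoord[OF b])
  moreover have "N m (Xc K b \<alpha> m) = Xc K b \<alpha> m + (-2) *\<^sub>R ?v" by (simp add: nc_Xc[OF N b])
  ultimately show ?thesis by simp
qed

lemma NS_Xc:
  assumes b: "adapted K S J b" "m \<in> cdom b"
  shows "vert_coeff b (NS m (Xc K b \<alpha> m)) \<gamma> = dS b \<gamma> \<alpha> m - yC b \<alpha> \<gamma> m"
proof -
  note bc = adapted_canonical[OF b(1)]
  have "base_coeff b m (Xc K b \<alpha> m) = (\<lambda>\<delta>. if \<delta> = \<alpha> then 1 else 0)"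
    unfolding comb_unit(1) by (rule ext) (rule base_coeff_comb[OF bc b(2)])
  moreover have "vert_coeff b (Xc K b \<alpha> m) = (\<lambda>_. 0)"
    unfolding comb_unit(1) by (rule ext) (rule vert_coeff_comb[OF bc b(2)])
  ultimately show ?thesis
    unfolding canonical_connection_local[OF b Xc_TT[OF bc b(2)]] vert_coeff_comb[OF bc b(2)]
    by (simp add: if_distrib[of "\<lambda>r. r * _"] cong: if_cong)
qed

lemma conn_lowered_NS:
  assumes b: "adapted K S J b" "m \<in> cdom b"
  shows "2 * conn_lowered NS b \<alpha> \<beta> m = (\<Sum>\<gamma>\<in>UNIV. gc b \<beta> \<gamma> m * yC b \<alpha> \<gamma> m) - spray_deriv_lowered b \<alpha> \<beta> m"
  unfolding conn_lowered_def spray_deriv_lowered_def conn_coeff_eq[OF NS_nonlinear adapted_canonical[OF b(1)] b(2)] NS_Xc[OF b]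
    sum_distrib_left sum_subtractf[symmetric]
  by (intro sum.cong refl) (simp add: algebra_simps)

text \<open>J maps h X_\<alpha> to V_\<alpha>, and it is injective on horizontal vectors because its
  kernel, the vertical space, meets them only in 0.\<close>

lemma horizontal_lift_local:
  assumes b: "adapted K S J b" "m \<in> cdom b" and u: "u \<in> VV K m"
  shows "horizontal_lift K P S J m u = (\<Sum>\<alpha>\<in>UNIV. vert_coeff b u \<alpha> *\<^sub>R hX NS b \<alpha> m)" (is "_ = ?h")
proof -
  note bc = adapted_canonical[OF b(1)] and H = horizontal_subspace[OF NS_nonlinear]
  note hh = hX_horizontal[OF NS_nonlinear bc b(2)]
  have hT: "hX NS b \<alpha> m \<in> TT K m" for \<alpha> by (rule hX_TT[OF b NS_nonlinear])
  have hH: "?h \<in> horizontal K NS m" by (intro subspace_sum[OF H] subspace_scale[OF H] hh)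
  have "J m (hX NS b \<alpha> m) = Vc K (tchart b) \<alpha> m" for \<alpha>
    unfolding hX_def[OF NS_nonlinear] J_diff[OF Xc_TT[OF bc b(2)] VV_TT[OF VV_sum_Vc[OF bc b(2)]]]
    by (simp add: J_Xc[OF b] J_zero[OF VV_sum_Vc[OF bc b(2)]])
  then have Jh: "J m ?h = u" unfolding J_sum[OF hT] by (simp add: VV_expand[OF bc b(2) u])
  have inj: "inj_on (J m) (horizontal K NS m)"
  proof (rule inj_onI)
    fix w w' assume w: "w \<in> horizontal K NS m" "w' \<in> horizontal K NS m" "J m w = J m w'"
    then have T: "w \<in> TT K m" "w' \<in> TT K m" by (simp_all add: horizontal_def)
    have "w - w' \<in> VV K m"
      by (rule J_kerD[OF subspace_diff[OF TT_subspace T]]) (simp add: J_diff[OF T] w(3))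
    then have "w - w' = 0" by (rule horizontal_VV[OF NS_nonlinear subspace_diff[OF H w(1,2)]])
    then show "w = w'" by simp
  qed
  show ?thesis unfolding horizontal_lift_def by (rule the_inv_into_f_eq[OF inj Jh hH])
qed

section \<open>The defect form and the correction of the canonical connection\<close>

abbreviation "defect \<equiv> defect_form K P S J \<Omega>"

text \<open>Both summands depend only on the values of the sections at \<open>m\<close>, by
  \<open>dyn_metric_local\<close> and \<open>horizontal_lift_local\<close>; sections with constant
  coefficients supply existence.\<close>

lemma defect_local:
  assumes b: "adapted K S J b" "m \<in> cdom b" and u: "u \<in> VV K m" "u' \<in> VV K m"
  shows "defect m u u' = (\<Sum>\<alpha>\<in>UNIV. \<Sum>\<beta>\<in>UNIV. vert_coeff b u \<alpha> * vert_coeff b u' \<beta> * (lagrangian_coeff NS b \<alpha> \<beta> m + metricity_coeff NS b \<alpha> \<beta> m))"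
    (is "_ = ?r")
proof -
  note bc = adapted_canonical[OF b(1)]
  let ?D = "\<lambda>X X' m. dyn_deriv_metric P S NS g X X' m
          + \<Omega> m (horizontal_lift K P S J m (X m)) (horizontal_lift K P S J m (X' m))"
  have loc: "?D X X' m = ?r" if X: "VS U X" "VS U X'" "m \<in> U" "X m = u" "X' m = u'" for U X X'
  proof -
    have hT: "hX NS b \<alpha> m \<in> TT K m" for \<alpha> by (rule hX_TT[OF b NS_nonlinear])
    have "\<Omega> m (horizontal_lift K P S J m u) (horizontal_lift K P S J m u')
      = (\<Sum>\<alpha>\<in>UNIV. \<Sum>\<beta>\<in>UNIV. vert_coeff b u \<alpha> * vert_coeff b u' \<beta> * lagrangian_coeff NS b \<alpha> \<beta> m)"
      unfolding horizontal_lift_local[OF b u(1)] horizontal_lift_local[OF b u(2)] Om_sum_both[OF hT hT] Om_hX[OF b NS_nonlinear] ..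
    then show ?thesis
      unfolding dyn_metric_local[OF b NS_nonlinear X(1-3)] X(4,5)
      by (simp add: distrib_left sum.distrib)
  qed
  have "(THE r. \<exists>U X X'. m \<in> U \<and> VS U X \<and> VS U X' \<and> X m = u \<and> X' m = u' \<and> r = ?D X X' m) = ?r"
  proof (rule the_equality)
    let ?X = "\<lambda>u q. \<Sum>\<alpha>\<in>UNIV. vert_coeff b u \<alpha> *\<^sub>R Vc K (tchart b) \<alpha> q"
    note s = VS_const_comb[OF bc]
    have e: "?X u m = u" "?X u' m = u'" using VV_expand[OF bc b(2)] u by simp_all
    show "\<exists>U X X'. m \<in> U \<and> VS U X \<and> VS U X' \<and> X m = u \<and> X' m = u' \<and> ?r = ?D X X' m"
      by (rule exI[of _ "cdom b"], rule exI[of _ "?X u"], rule exI[of _ "?X u'"])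
        (intro conjI s b(2) e loc[OF s s b(2) e, symmetric])
    show "r = ?r" if "\<exists>U X X'. m \<in> U \<and> VS U X \<and> VS U X' \<and> X m = u \<and> X' m = u' \<and> r = ?D X X' m" for r
      using that loc by blast
  qed
  then show ?thesis using u by (simp add: defect_form_def form_of_operator_def)
qed

text \<open>By the Leibniz rule X(f) V = [X, f V] - f [X, V] for a basis section V, and the
  right-hand side is a smooth section; its component along V is X(f). Any index \<beta> serves for
  V.\<close>

lemma deriv_smooth:
  assumes b: "canonical K b" and X: "PS (cdom b) X" and f: "smooth_fun AT (cdom b) f"
  shows "smooth_fun AT (cdom b) (\<lambda>m. snd (X m) f)"
proof -
  fix \<beta> :: 'k
  let ?V = "Vc K (tchart b) \<beta>"
  note V = VS_PS[OF Vc_smooth[OF b, of \<beta>]]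
  note fm = T.smooth_fun_mult[OF T.smooth_fun_const[OF canonicalD(3)[OF b], of "-1"] f]
  have "PS (cdom b) (\<lambda>m. P X (\<lambda>q. f q *\<^sub>R ?V q) m + (-1 * f m) *\<^sub>R P X ?V m)"
    by (rule PS_add[OF P_smooth[OF X PS_scale[OF f V]] PS_scale[OF fm P_smooth[OF X V]]])
  then have "PS (cdom b) (\<lambda>m. snd (X m) f *\<^sub>R ?V m)"
    by (rule PS_cong) (simp add: P_leibniz[OF X V f])
  from PS_vert_coeff[OF this b, of \<beta>] show ?thesis
    unfolding vert_coeff_scale Int_absorb
    by (rule T.smooth_fun_cong) (simp add: vert_coeff_def snd_Vc_ycoord[OF b])
qed

text \<open>Prepares the right-hand side of the linear system for the correction. The coefficients
  of N_S are smooth because N_S X_\<alpha> is a smooth section.\<close>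

lemma defect_smooth:
  assumes b: "adapted K S J b"
  shows "smooth_fun AT (cdom b) (\<lambda>m. lagrangian_coeff NS b \<alpha> \<beta> m + metricity_coeff NS b \<alpha> \<beta> m)"
proof -
  note bc = adapted_canonical[OF b] and o = canonicalD(3)[OF adapted_canonical[OF b]]
  note V = VS_PS[OF Vc_smooth[OF bc]] and SS = S_smooth[OF o]
  have spray: "smooth_fun AT (cdom b) (spray_coeff K S b \<gamma>)" for \<gamma>
    using PS_vert_coeff[OF SS bc, of \<gamma>] unfolding Int_absorb
    by (rule T.smooth_fun_cong) (simp add: spray_coeff_eq[OF b])
  have dS: "smooth_fun AT (cdom b) (dS b \<gamma> \<alpha>)" for \<gamma> \<alpha>
    using deriv_smooth[OF bc V spray] by (simp add: dS_def[abs_def])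
  have cc: "smooth_fun AT (cdom b) (conn_coeff K NS b \<alpha> \<gamma>)" for \<alpha> \<gamma>
  proof -
    have "smooth_fun AT (cdom b) (\<lambda>m. - (1/2) * vert_coeff b (NS m (Xc K b \<alpha> m)) \<gamma>)"
      using T.smooth_fun_mult[OF T.smooth_fun_const[OF o] PS_vert_coeff[OF endo_smooth[OF NS_endo Xc_smooth[OF bc]] bc, unfolded Int_absorb]] .
    then show ?thesis by (rule T.smooth_fun_cong) (simp add: conn_coeff_eq[OF NS_nonlinear bc])
  qed
  note gs = gc_smooth[OF bc]
  have G: "smooth_fun AT (cdom b) (conn_lowered NS b \<alpha> \<beta>)" and D: "smooth_fun AT (cdom b) (spray_deriv_lowered b \<alpha> \<beta>)" for \<alpha> \<beta>
    unfolding conn_lowered_def[abs_def] spray_deriv_lowered_def[abs_def] by (intro T.smooth_fun_sum[OF o] T.smooth_fun_mult gs cc dS)+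
  have O: "smooth_fun AT (cdom b) (om b \<alpha> \<beta>)"
    using Om_smooth[OF Xc_smooth[OF bc] Xc_smooth[OF bc]] by (simp add: omega_coeff_def[abs_def])
  have L: "smooth_fun AT (cdom b) (lie_deriv_fun S (gc b \<alpha> \<beta>))"
    using deriv_smooth[OF bc SS gs] by (simp add: lie_deriv_fun_def[abs_def])
  show ?thesis
    unfolding lagrangian_coeff_def metricity_coeff_def diff_conv_add_uminus
    by (intro T.smooth_fun_add T.smooth_fun_minus G D O L)
qed

text \<open>A choice made point by point; nondegeneracy leaves only one candidate, so Cramer's rule
  can prove smoothness afterwards.\<close>

definition correction_coeff :: "('m, 'p, 'v, 'n, 'k) canon \<Rightarrow> 'p \<Rightarrow> 'k \<Rightarrow> 'k \<Rightarrow> real" where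
  "correction_coeff b m \<alpha> = (SOME c. \<forall>\<beta>. (\<Sum>\<gamma>\<in>UNIV. gc b \<beta> \<gamma> m * c \<gamma>) = lagrangian_coeff NS b \<alpha> \<beta> m + metricity_coeff NS b \<alpha> \<beta> m)"

lemma correction_coeff:
  assumes "adapted K S J b" "m \<in> cdom b"
  shows "(\<Sum>\<gamma>\<in>UNIV. gc b \<beta> \<gamma> m * correction_coeff b m \<alpha> \<gamma>) = lagrangian_coeff NS b \<alpha> \<beta> m + metricity_coeff NS b \<alpha> \<beta> m"
  using someI_ex[OF gc_solve[OF assms, of "\<lambda>\<beta>. lagrangian_coeff NS b \<alpha> \<beta> m + metricity_coeff NS b \<alpha> \<beta> m"]] unfolding correction_coeff_def by blast

text \<open>Fibrewise Riesz representation of the defect form by g. It refers to no basis, hence is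
  global from the start, and the restriction makes it extensional as \<open>endomorphisms\<close>
  demands.\<close>

definition correction :: "('p, 'v) pendo" where
  "correction m = (\<lambda>u\<in>VV K m. THE z. z \<in> VV K m \<and> (\<forall>y\<in>VV K m. g m z y = defect m u y))"

definition correction_frame :: "('m, 'p, 'v, 'n, 'k) canon \<Rightarrow> 'k \<Rightarrow> ('p, 'v) psection" where
  "correction_frame b \<alpha> m = (\<Sum>\<gamma>\<in>UNIV. correction_coeff b m \<alpha> \<gamma> *\<^sub>R Vc K (tchart b) \<gamma> m)"

text \<open>The formula in the adapted basis provides a representing vector; nondegeneracy of g
  excludes a second one.\<close>

lemma correction_local:
  assumes b: "adapted K S J b" "m \<in> cdom b" and u: "u \<in> VV K m"
  shows "correction m u = (\<Sum>\<alpha>\<in>UNIV. vert_coeff b u \<alpha> *\<^sub>R correction_frame b \<alpha> m)" (is "_ = ?z")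
    and "correction m u \<in> VV K m" and "y \<in> VV K m \<Longrightarrow> g m (correction m u) y = defect m u y"
proof -
  note bc = adapted_canonical[OF b(1)]
  note V = Vc_VV[OF bc b(2)]
  have sV: "correction_frame b \<alpha> m \<in> VV K m" for \<alpha> unfolding correction_frame_def by (rule VV_sum_Vc[OF bc b(2)])
  have zV: "?z \<in> VV K m" by (intro subspace_sum[OF VV_subspace] subspace_scale[OF VV_subspace] sV)
  have gs: "g m (correction_frame b \<alpha> m) (Vc K (tchart b) \<beta> m) = lagrangian_coeff NS b \<alpha> \<beta> m + metricity_coeff NS b \<alpha> \<beta> m" for \<alpha> \<beta>
    unfolding correction_frame_def g_sum1[OF V V] g_Vc[OF b] gc_sym[OF b, of _ \<beta>] correction_coeff[OF b, symmetric]
    by (simp add: mult.commute)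
  have gz: "g m ?z y = defect m u y" if y: "y \<in> VV K m" for y
  proof -
    have "g m ?z (\<Sum>\<beta>\<in>UNIV. vert_coeff b y \<beta> *\<^sub>R Vc K (tchart b) \<beta> m) = defect m u y"
      unfolding g_sum_both[OF sV V] gs defect_local[OF b u y] ..
    then show ?thesis unfolding VV_expand[OF bc b(2) y] .
  qed
  have "(THE z. z \<in> VV K m \<and> (\<forall>y\<in>VV K m. g m z y = defect m u y)) = ?z"
  proof (rule the_equality)
    show "?z \<in> VV K m \<and> (\<forall>y\<in>VV K m. g m ?z y = defect m u y)" using zV gz by blast
    fix z assume z: "z \<in> VV K m \<and> (\<forall>y\<in>VV K m. g m z y = defect m u y)"
    have "z + (-1) *\<^sub>R ?z = 0"
    proof (rule g_nondeg)
      show "z + (-1) *\<^sub>R ?z \<in> VV K m"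
        using z zV by (intro subspace_add[OF VV_subspace] subspace_scale[OF VV_subspace]) auto
      fix y assume y: "y \<in> VV K m"
      show "g m (z + (-1) *\<^sub>R ?z) y = 0"
        unfolding g_add1[OF conjunct1[OF z] subspace_scale[OF VV_subspace zV] y] g_scale1[OF zV y] gz[OF y]
        using z y by simp
    qed
    then show "z = ?z" by simp
  qed
  then show e: "correction m u = ?z" using u by (simp add: correction_def)
  show "correction m u \<in> VV K m" unfolding e by (rule zV)
  show "y \<in> VV K m \<Longrightarrow> g m (correction m u) y = defect m u y" unfolding e by (rule gz)
qed

lemma correction_frame_smooth:
  assumes b: "adapted K S J b"
  shows "PS (cdom b) (correction_frame b \<alpha>)"
proof -
  note bc = adapted_canonical[OF b] and o = canonicalD(3)[OF adapted_canonical[OF b]]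
  have "smooth_fun AT (cdom b) (\<lambda>m. correction_coeff b m \<alpha> \<gamma>)" for \<gamma>
  proof (rule T.smooth_fun_linear_system[OF o, of "gc b" "\<lambda>\<beta> m. lagrangian_coeff NS b \<alpha> \<beta> m + metricity_coeff NS b \<alpha> \<beta> m"])
    show "smooth_fun AT (cdom b) (gc b i j)" for i j by (rule gc_smooth[OF bc])
    show "smooth_fun AT (cdom b) (\<lambda>m. lagrangian_coeff NS b \<alpha> \<beta> m + metricity_coeff NS b \<alpha> \<beta> m)" for \<beta> by (rule defect_smooth[OF b])
    show "\<forall>j. v j = 0" if "x \<in> cdom b" "\<And>i. (\<Sum>j\<in>UNIV. gc b i j x * v j) = 0" for x v
      by (rule gc_ker[OF b that])
  qed (rule correction_coeff[OF b])
  then show ?thesis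
    unfolding correction_frame_def[abs_def] by (intro PS_sum o PS_scale VS_PS[OF Vc_smooth[OF bc]])
qed

text \<open>Smoothness is a local matter, so it is checked in an adapted basis around each point and
  assembled by \<open>PS_local\<close>.\<close>

lemma correction_endo: "correction \<in> endomorphisms AT (vert K)"
proof -
  have lin: "correction m u \<in> VV K m \<and> (\<forall>u'\<in>VV K m. correction m (u + u') = correction m u + correction m u') \<and> (\<forall>r. correction m (r *\<^sub>R u) = r *\<^sub>R correction m u)"
    if u: "u \<in> VV K m" for m u
  proof -
    obtain b where b: "adapted K S J b" "m \<in> cdom b" using adapted_ex by blast
    have "correction m (u + u') = correction m u + correction m u'" if u': "u' \<in> VV K m" for u'
      unfolding correction_local(1)[OF b u] correction_local(1)[OF b u'] correction_local(1)[OF b subspace_add[OF VV_subspace u u']] vert_coeff_add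
      by (simp add: scaleR_add_left sum.distrib)
    moreover have "correction m (r *\<^sub>R u) = r *\<^sub>R correction m u" for r
      unfolding correction_local(1)[OF b u] correction_local(1)[OF b subspace_scale[OF VV_subspace u]] vert_coeff_scale
      by (simp add: scaleR_sum_right)
    ultimately show ?thesis using correction_local(2)[OF b u] by blast
  qed
  have "VS U (\<lambda>m. correction m (s m))" if s: "VS U s" for U s
  proof -
    have "PS U (\<lambda>m. correction m (s m))"
    proof (rule PS_local[OF PS_open[OF VS_PS[OF s]]])
      fix m assume m: "m \<in> U"
      obtain b where b: "adapted K S J b" "m \<in> cdom b" using adapted_ex by blast
      note bc = adapted_canonical[OF b(1)]
      have o: "open (U \<inter> cdom b)" using PS_open[OF VS_PS[OF s]] canonicalD(3)[OF bc] by (rule open_Int)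
      have "PS (U \<inter> cdom b) (\<lambda>m. \<Sum>\<alpha>\<in>UNIV. vert_coeff b (s m) \<alpha> *\<^sub>R correction_frame b \<alpha> m)"
        by (intro PS_sum[OF o] PS_scale PS_vert_coeff[OF VS_PS[OF s] bc] PS_subset[OF correction_frame_smooth[OF b(1)] o]) simp
      then have "PS (U \<inter> cdom b) (\<lambda>m. correction m (s m))"
        by (rule PS_cong) (simp add: correction_local(1)[OF b(1)] VS_VV[OF s])
      then show "\<exists>V. m \<in> V \<and> PS V (\<lambda>m. correction m (s m))" using m b(2) by blast
    qed
    then show ?thesis unfolding VS_iff using lin VS_VV[OF s] by blast
  qed
  moreover have "correction m \<in> extensional (VV K m)" for m by (simp add: correction_def)
  ultimately show ?thesis using lin unfolding endomorphisms_def bundle_morphism_def by blast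
qed

text \<open>\<open>g2_inv\<close> inverts on smooth endomorphisms only, so membership of the
  correction has to come first. Injectivity of \<open>g2\<close> holds by nondegeneracy on the
  fibres and by extensionality elsewhere.\<close>

lemma g2_inv_defect: "g2_inv K g defect = correction"
  unfolding g2_inv_def
proof (rule the_inv_into_f_eq[OF _ _ correction_endo])
  show "inj_on (g2 K g) (endomorphisms AT (vert K))"
  proof (rule inj_onI)
    fix D D' assume D: "D \<in> endomorphisms AT (vert K)" "D' \<in> endomorphisms AT (vert K)" and e: "g2 K g D = g2 K g D'"
    have "D m u = D' m u" if u: "u \<in> VV K m" for m u
    proof -
      note Du = endo_in[OF D(1) u] and Du' = endo_in[OF D(2) u]
      have "D m u + (-1) *\<^sub>R D' m u = 0"
      proof (rule g_nondeg)
        show "D m u + (-1) *\<^sub>R D' m u \<in> VV K m"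
          by (intro subspace_add[OF VV_subspace] subspace_scale[OF VV_subspace] Du Du')
        fix y assume y: "y \<in> VV K m"
        have "g2 K g D m u y = g2 K g D' m u y" by (simp add: e)
        then have "g m (D m u) y = g m (D' m u) y" using u y by (simp add: g2_def)
        then show "g m (D m u + (-1) *\<^sub>R D' m u) y = 0"
          unfolding g_add1[OF Du subspace_scale[OF VV_subspace Du'] y] g_scale1[OF Du' y] by simp
      qed
      then show ?thesis by simp
    qed
    then have "D m = D' m" for m
      by (intro extensionalityI[OF endo_ext[OF D(1)] endo_ext[OF D(2)]])
    then show "D = D'" by (rule ext)
  qed
  show "g2 K g correction = defect"
  proof (intro ext)
    fix m u y
    obtain b where b: "adapted K S J b" "m \<in> cdom b" using adapted_ex by blast
    show "g2 K g correction m u y = defect m u y"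
    proof (cases "u \<in> VV K m \<and> y \<in> VV K m")
      case True
      then show ?thesis using correction_local(3)[OF b] by (simp add: g2_def)
    next
      \<comment> \<open>\<open>g2\<close> and \<open>form_of_operator\<close> restrict their two
        arguments in the same way, so both sides are the same default value here.\<close>
      case False
      then show ?thesis by (auto simp: g2_def defect_form_def form_of_operator_def restrict_def)
    qed
  qed
qed

section \<open>The solution and its uniqueness\<close>

definition lm_connection :: "('p, 'v) pendo" where
  "lm_connection m = (\<lambda>w\<in>TT K m. NS m w + correction m (J m w))"

text \<open>Put E = \<open>correction\<close> o J. Then N_S E = -E since E has vertical values, E
  N_S = E since w - N_S w is vertical and J kills it, and E E = 0. Hence (N_S + E) squares to the
  identity. As J is unchanged by N_S + E, w + (N_S + E) w = 0 forces J w = 0.\<close>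

lemma lm_connection_nonlinear: "nonlinear_connection K lm_connection"
proof -
  have correctionV: "correction m u \<in> VV K m" if "u \<in> VV K m" for m u using endo_in[OF correction_endo that] .
  have correction0: "correction m 0 = 0" for m using endo_scale[OF correction_endo subspace_0[OF VV_subspace], of m 0] by simp
  have app: "lm_connection m w = NS m w + correction m (J m w)" if "w \<in> TT K m" for m w using that by (simp add: lm_connection_def)
  note NSn = nc_in[OF NS_nonlinear] and JV = J_VV
  have inT: "lm_connection m w \<in> TT K m" if "w \<in> TT K m" for m w
    unfolding app[OF that] by (intro subspace_add[OF TT_subspace NSn[OF that]] VV_TT correctionV JV that)
  have "lm_connection m (w + w') = lm_connection m w + lm_connection m w'" if w: "w \<in> TT K m" "w' \<in> TT K m" for m w w'
    unfolding app[OF w(1)] app[OF w(2)] app[OF subspace_add[OF TT_subspace w]] J_add[OF w]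
      endo_add[OF correction_endo JV[OF w(1)] JV[OF w(2)]] nc_add[OF NS_nonlinear w] by (simp add: algebra_simps)
  moreover have "lm_connection m (r *\<^sub>R w) = r *\<^sub>R lm_connection m w" if w: "w \<in> TT K m" for m r w
    unfolding app[OF w] app[OF subspace_scale[OF TT_subspace w]] J_scale[OF w]
      endo_scale[OF correction_endo JV[OF w]] nc_scale[OF NS_nonlinear w] by (simp add: scaleR_add_right)
  moreover have "PS U (\<lambda>m. lm_connection m (s m))" if s: "PS U s" for U s
  proof -
    have "VS U (\<lambda>m. J m (s m))" unfolding VS_iff using J_smooth[OF s] JV PS_TT[OF s] by blast
    from PS_add[OF endo_smooth[OF NS_endo s] VS_PS[OF endo_smooth[OF correction_endo this]]]
    show ?thesis by (rule PS_cong) (simp add: app PS_TT[OF s])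
  qed
  moreover have "lm_connection m \<in> extensional (TT K m)" for m by (simp add: lm_connection_def)
  ultimately have endo: "lm_connection \<in> endomorphisms AT (prol K)"
    using inT unfolding endomorphisms_def bundle_morphism_def by blast
  have "lm_connection m (lm_connection m w) = w \<and> (w + lm_connection m w = 0 \<longleftrightarrow> w \<in> VV K m)" if w: "w \<in> TT K m" for m w
  proof -
    let ?d = "correction m (J m w)"
    note Nw = NSn[OF w] and dV = correctionV[OF JV[OF w]]
    have dif: "w - NS m w \<in> VV K m" by (rule nc_diff_VV[OF NS_nonlinear w])
    then have "J m (w - NS m w) = 0" by (rule J_zero)
    then have JN: "J m (NS m w) = J m w" by (simp add: J_diff[OF w Nw])
    have J0: "J m (lm_connection m w) = J m w" unfolding app[OF w] J_add[OF Nw VV_TT[OF dV]] JN by (simp add: J_zero[OF dV])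
    have "lm_connection m (lm_connection m w) = NS m (NS m w + ?d) + ?d" unfolding app[OF inT[OF w]] J0 unfolding app[OF w] ..
    also have "\<dots> = w"
      unfolding nc_add[OF NS_nonlinear Nw VV_TT[OF dV]] nc_square[OF NS_nonlinear w] nc_VV[OF NS_nonlinear dV] by simp
    finally have sq: "lm_connection m (lm_connection m w) = w" .
    have "w \<in> VV K m" if z: "w + lm_connection m w = 0"
    proof (rule J_kerD[OF w])
      have "J m w + J m w = J m (w + lm_connection m w)" by (simp add: J_add[OF w inT[OF w]] J0)
      also have "\<dots> = 0" unfolding z by (rule J_zero[OF subspace_0[OF VV_subspace]])
      finally have "2 *\<^sub>R J m w = 0" by (simp add: scaleR_2)
      then show "J m w = 0" by (simp only: scaleR_eq_0_iff) simp
    qed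
    moreover have "w + lm_connection m w = 0" if "w \<in> VV K m"
      by (simp add: app[OF w] nc_VV[OF NS_nonlinear that] J_zero[OF that] correction0)
    ultimately show ?thesis using sq by blast
  qed
  then show ?thesis using endo VV_TT unfolding nonlinear_connection_def by blast
qed

lemma lm_connection_LM: "LM lm_connection"
proof (rule LM_I[OF lm_connection_nonlinear])
  fix m
  obtain b where b: "adapted K S J b" "m \<in> cdom b" using adapted_ex by blast
  note bc = adapted_canonical[OF b(1)]
  have "conn_lowered lm_connection b \<alpha> \<beta> m = solution_coeff b \<alpha> \<beta> m" for \<alpha> \<beta>
  proof -
    note X = Xc_TT[OF bc b(2)] and V = Vc_VV[OF bc b(2)]
    have "vert_coeff b (Vc K (tchart b) \<alpha> m) = (\<lambda>\<gamma>. if \<gamma> = \<alpha> then 1 else 0)"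
      by (rule ext) (simp add: vert_coeff_def snd_Vc_ycoord[OF bc b(2)])
    then have "correction m (Vc K (tchart b) \<alpha> m) = correction_frame b \<alpha> m"
      unfolding correction_local(1)[OF b V] by (simp add: if_distrib[of "\<lambda>r. r *\<^sub>R _"] cong: if_cong)
    then have "lm_connection m (Xc K b \<alpha> m) = NS m (Xc K b \<alpha> m) + correction_frame b \<alpha> m"
      using X by (simp add: lm_connection_def J_Xc[OF b])
    then have cN: "conn_coeff K lm_connection b \<alpha> \<gamma> m = conn_coeff K NS b \<alpha> \<gamma> m + - (1/2) * correction_coeff b m \<alpha> \<gamma>" for \<gamma>
      unfolding conn_coeff_eq[OF lm_connection_nonlinear bc b(2)] conn_coeff_eq[OF NS_nonlinear bc b(2)]
      by (simp add: vert_coeff_add correction_frame_def vert_coeff_sum_Vc[OF bc b(2)] add_divide_distrib)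
    have "conn_lowered lm_connection b \<alpha> \<beta> m = conn_lowered NS b \<alpha> \<beta> m + - (1/2) * (\<Sum>\<gamma>\<in>UNIV. gc b \<beta> \<gamma> m * correction_coeff b m \<alpha> \<gamma>)"
      unfolding conn_lowered_def sum_distrib_left sum.distrib[symmetric] cN by (intro sum.cong refl) (simp add: algebra_simps)
    \<comment> \<open>The lowered correction is
      \<open>2 * (conn_lowered NS - solution_coeff)\<close>, and half of it is subtracted.\<close>
    then show ?thesis unfolding correction_coeff[OF b] lagrangian_coeff_def metricity_coeff_def solution_coeff_def by argo
  qed
  then show "\<exists>b. adapted K S J b \<and> m \<in> cdom b \<and> (\<forall>\<alpha> \<beta>. conn_lowered lm_connection b \<alpha> \<beta> m = solution_coeff b \<alpha> \<beta> m)" using b by blast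
qed

lemma metric_coeff_inject:
  assumes b: "adapted K S J b" "m \<in> cdom b"
    and eq: "\<And>\<beta>. (\<Sum>\<gamma>\<in>UNIV. gc b \<beta> \<gamma> m * c \<gamma>) = (\<Sum>\<gamma>\<in>UNIV. gc b \<beta> \<gamma> m * d \<gamma>)"
  shows "c = d"
proof -
  have "\<forall>\<gamma>. c \<gamma> - d \<gamma> = 0"
    by (rule gc_ker[OF b]) (simp add: right_diff_distrib sum_subtractf eq)
  then show ?thesis by (simp add: fun_eq_iff)
qed

text \<open>A nonlinear connection is -1 on vertical vectors and is fixed on the X_\<alpha> by its
  coefficients, which can be recovered from their lowered form. Extensionality turns agreement on
  the fibres into equality.\<close>

lemma LM_unique:
  assumes N: "nonlinear_connection K N" "LM N" and N': "nonlinear_connection K N'" "LM N'"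
  shows "N = N'"
proof
  fix m
  obtain b where b: "adapted K S J b" "m \<in> cdom b" using adapted_ex by blast
  note bc = adapted_canonical[OF b(1)] and X = Xc_TT[OF adapted_canonical[OF b(1)] b(2)]
  have "(\<lambda>\<gamma>. conn_coeff K N b \<alpha> \<gamma> m) = (\<lambda>\<gamma>. conn_coeff K N' b \<alpha> \<gamma> m)" for \<alpha>
    using LM_coefficients[OF N b] LM_coefficients[OF N' b] by (intro metric_coeff_inject[OF b]) (simp add: conn_lowered_def)
  then have c: "conn_coeff K N b \<alpha> \<gamma> m = conn_coeff K N' b \<alpha> \<gamma> m" for \<alpha> \<gamma> by (rule fun_cong)
  have NX: "N m (Xc K b \<alpha> m) = N' m (Xc K b \<alpha> m)" for \<alpha>
    unfolding nc_Xc[OF N(1) bc b(2)] nc_Xc[OF N'(1) bc b(2)] c ..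
  have "N m w = N' m w" if w: "w \<in> TT K m" for w
  proof -
    let ?x = "\<Sum>\<alpha>\<in>UNIV. base_coeff b m w \<alpha> *\<^sub>R Xc K b \<alpha> m" and ?v = "\<Sum>\<beta>\<in>UNIV. vert_coeff b w \<beta> *\<^sub>R Vc K (tchart b) \<beta> m"
    have xT: "?x \<in> TT K m" by (intro subspace_sum[OF TT_subspace] subspace_scale[OF TT_subspace] X)
    have vV: "?v \<in> VV K m" by (rule VV_sum_Vc[OF bc b(2)])
    have "N m (?x + ?v) = N' m (?x + ?v)"
      unfolding nc_add[OF N(1) xT VV_TT[OF vV]] nc_add[OF N'(1) xT VV_TT[OF vV]] nc_VV[OF N(1) vV] nc_VV[OF N'(1) vV]
        nc_sum[OF N(1) X] nc_sum[OF N'(1) X] NX ..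
    then show ?thesis using TT_expand[OF bc b(2) w] by (simp add: comb_def)
  qed
  then show "N m = N' m"
    by (intro extensionalityI[OF endo_ext[OF nc_endo[OF N(1)]] endo_ext[OF nc_endo[OF N'(1)]]])
qed

definition canonical_coeff :: "('m, 'p, 'v, 'n, 'k) canon \<Rightarrow> 'k \<Rightarrow> 'k \<Rightarrow> 'p \<Rightarrow> real" where
  "canonical_coeff b \<alpha> \<beta> m = om b \<alpha> \<beta> m + lie_deriv_fun S (gc b \<alpha> \<beta>) m + spray_deriv_lowered b \<beta> \<alpha> m
     + (\<Sum>\<gamma>\<in>UNIV. gc b \<beta> \<gamma> m * yC b \<alpha> \<gamma> m)"

text \<open>The terms g_\<beta>\<gamma> times the derivative of S^\<gamma> along y^\<alpha> occur on
  both sides and cancel. This explains why the criterion for N_S contains only one derivative of the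
  spray coefficients and is not symmetric in shape.\<close>

lemma conn_lowered_NS_iff:
  assumes "adapted K S J b" "m \<in> cdom b"
  shows "conn_lowered NS b \<alpha> \<beta> m = solution_coeff b \<alpha> \<beta> m \<longleftrightarrow> canonical_coeff b \<alpha> \<beta> m = 0"
  using conn_lowered_NS[OF assms, of \<alpha> \<beta>] unfolding solution_coeff_def canonical_coeff_def by argo

text \<open>Serves both readings of a condition "in an adapted canonical basis": in all of them, or
  in one around each point.\<close>

lemma LM_iff:
  assumes N: "nonlinear_connection K N"
  shows "LM N \<longleftrightarrow> (\<forall>b. adapted K S J b \<longrightarrow> (\<forall>m\<in>cdom b. \<forall>\<alpha> \<beta>. conn_lowered N b \<alpha> \<beta> m = solution_coeff b \<alpha> \<beta> m))"
    and "LM N \<longleftrightarrow> (\<forall>m. \<exists>b. adapted K S J b \<and> m \<in> cdom b \<and> (\<forall>m\<in>cdom b. \<forall>\<alpha> \<beta>. conn_lowered N b \<alpha> \<beta> m = solution_coeff b \<alpha> \<beta> m))"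
proof -
  have 1: "\<forall>b. adapted K S J b \<longrightarrow> (\<forall>m\<in>cdom b. \<forall>\<alpha> \<beta>. conn_lowered N b \<alpha> \<beta> m = solution_coeff b \<alpha> \<beta> m)" if "LM N"
    using LM_coefficients[OF N that] by blast
  have 2: "LM N" if "\<forall>m. \<exists>b. adapted K S J b \<and> m \<in> cdom b \<and> (\<forall>m\<in>cdom b. \<forall>\<alpha> \<beta>. conn_lowered N b \<alpha> \<beta> m = solution_coeff b \<alpha> \<beta> m)"
    by (rule LM_I[OF N]) (use that in blast)
  have 3: "\<forall>m. \<exists>b. adapted K S J b \<and> m \<in> cdom b \<and> (\<forall>m\<in>cdom b. \<forall>\<alpha> \<beta>. conn_lowered N b \<alpha> \<beta> m = solution_coeff b \<alpha> \<beta> m)"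
    if "\<forall>b. adapted K S J b \<longrightarrow> (\<forall>m\<in>cdom b. \<forall>\<alpha> \<beta>. conn_lowered N b \<alpha> \<beta> m = solution_coeff b \<alpha> \<beta> m)"
  proof
    fix m
    obtain b where b: "adapted K S J b" "m \<in> cdom b" using adapted_ex by blast
    then show "\<exists>b. adapted K S J b \<and> m \<in> cdom b \<and> (\<forall>m\<in>cdom b. \<forall>\<alpha> \<beta>. conn_lowered N b \<alpha> \<beta> m = solution_coeff b \<alpha> \<beta> m)"
      using that by blast
  qed
  show "LM N \<longleftrightarrow> (\<forall>b. adapted K S J b \<longrightarrow> (\<forall>m\<in>cdom b. \<forall>\<alpha> \<beta>. conn_lowered N b \<alpha> \<beta> m = solution_coeff b \<alpha> \<beta> m))"
    by (rule iffI[OF 1 2[OF 3]])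
  show "LM N \<longleftrightarrow> (\<forall>m. \<exists>b. adapted K S J b \<and> m \<in> cdom b \<and> (\<forall>m\<in>cdom b. \<forall>\<alpha> \<beta>. conn_lowered N b \<alpha> \<beta> m = solution_coeff b \<alpha> \<beta> m))"
    by (rule iffI[OF 3[OF 1] 2])
qed

lemma nonlinear_LM_iff: "nonlinear_connection K N \<and> LM N \<longleftrightarrow> N = lm_connection"
  using LM_unique[OF _ _ lm_connection_nonlinear lm_connection_LM] lm_connection_nonlinear lm_connection_LM by blast

end

text \<open>"Characterized by" is rendered twice for the coefficients: as a criterion on nonlinear
  connections, and as unique solvability at each point of the relation read as a linear system. The
  criterion for N_S is likewise given for all bases and for one basis around each point.\<close>

theorem theorem6p2p1:
  fixes K :: "('m::t2_space, 'p::t2_space, 'v::real_vector, 'n::finite, 'k::finite) fibred_algebroid"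
    and AF :: "('f::t2_space, real^'k) chart set"
    and P :: "('p, 'v) pbracket"
    and S :: "('p, 'v) psection"
    and J :: "('p, 'v) pendo"
    and \<Omega> :: "('p, 'v) pform"
  assumes "fibred_pre_lie_algebroid K AF"
    and "prolongation_bracket K P"
    and "semispray K P S"
    and "associated_tangent K P S J"
    and "almost_cotangent K \<Omega>"
    and "compatible K J \<Omega>"
  defines "g \<equiv> vertical_metric K J \<Omega>"
    and "N\<^sub>S \<equiv> canonical_connection K P S J"
    and "LM \<equiv> \<lambda>N. lagrangian_connection K \<Omega> N \<and> metric_connection K P S (vertical_metric K J \<Omega>) N"
    and "dS \<equiv> \<lambda>b \<gamma> \<beta>. lie_deriv_fun (Vc K (tchart b) \<beta>) (spray_coeff K S b \<gamma>)"
  defines "R \<equiv> \<lambda>b \<alpha> \<beta> m.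
      - (1/2) * (omega_coeff K \<Omega> b \<alpha> \<beta> m
         + lie_deriv_fun S (metric_coeff K \<Omega> b \<alpha> \<beta>) m
         + (\<Sum>\<gamma>\<in>UNIV. metric_coeff K \<Omega> b \<alpha> \<gamma> m * dS b \<gamma> \<beta> m)
         + (\<Sum>\<gamma>\<in>UNIV. metric_coeff K \<Omega> b \<beta> \<gamma> m * dS b \<gamma> \<alpha> m))"
    and "Q \<equiv> \<lambda>b \<alpha> \<beta> m.
      omega_coeff K \<Omega> b \<alpha> \<beta> m
         + lie_deriv_fun S (metric_coeff K \<Omega> b \<alpha> \<beta>) m
         + (\<Sum>\<delta>\<in>UNIV. metric_coeff K \<Omega> b \<alpha> \<delta> m * dS b \<delta> \<beta> m)
         + (\<Sum>\<delta>\<in>UNIV. \<Sum>\<mu>\<in>UNIV. metric_coeff K \<Omega> b \<beta> \<delta> m *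
              struct_coeff K b \<alpha> \<mu> \<delta> (proj K m) * ycoord (tchart b) \<mu> m)"
    and "adapted_llf \<equiv> \<lambda>b. adapted K S J b \<and>
      tchart b \<in> linear_fibration_atlas K (\<lambda>m. J m (S m))"
  shows
    "((\<exists>!N. nonlinear_connection K N \<and> LM N) \<and>
      (\<forall>N. nonlinear_connection K N \<and> LM N \<longleftrightarrow>
         N = (\<lambda>m. \<lambda>w\<in>TT K m. N\<^sub>S m w + g2_inv K g (defect_form K P S J \<Omega>) m (J m w))) \<and>
      (\<forall>N. nonlinear_connection K N \<longrightarrow>
         (LM N \<longleftrightarrow>
          (\<forall>b. adapted K S J b \<longrightarrow> (\<forall>m\<in>cdom b. \<forall>\<alpha> \<beta>.
             (\<Sum>\<gamma>\<in>UNIV. metric_coeff K \<Omega> b \<beta> \<gamma> m * conn_coeff K N b \<alpha> \<gamma> m) = R b \<alpha> \<beta> m)))) \<and>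
      (\<forall>N. nonlinear_connection K N \<and> LM N \<longrightarrow>
         (\<forall>b. adapted K S J b \<longrightarrow> (\<forall>m\<in>cdom b. \<forall>c.
            (\<forall>\<alpha> \<beta>. (\<Sum>\<gamma>\<in>UNIV. metric_coeff K \<Omega> b \<beta> \<gamma> m * c \<alpha> \<gamma>) = R b \<alpha> \<beta> m) \<longleftrightarrow>
            (\<forall>\<alpha> \<beta>. c \<alpha> \<beta> = conn_coeff K N b \<alpha> \<beta> m))))) \<and>
     ((LM N\<^sub>S \<longleftrightarrow> (\<forall>b. adapted_llf b \<longrightarrow> (\<forall>m\<in>cdom b. \<forall>\<alpha> \<beta>. Q b \<alpha> \<beta> m = 0))) \<and>
      (LM N\<^sub>S \<longleftrightarrow> (\<forall>m\<^sub>0. \<exists>b. adapted_llf b \<and> m\<^sub>0 \<in> cdom b \<and>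
                         (\<forall>m\<in>cdom b. \<forall>\<alpha> \<beta>. Q b \<alpha> \<beta> m = 0))) \<and>
      (LM N\<^sub>S \<longrightarrow> (\<forall>N. nonlinear_connection K N \<and> LM N \<longleftrightarrow> N = N\<^sub>S)))"
proof -
  interpret C: cotangent_spray K AF P S J \<Omega>
    by standard fact+
  have g': "vertical_metric K J \<Omega> = C.g" ..
  have R: "R b \<alpha> \<beta> m = C.solution_coeff b \<alpha> \<beta> m" for b \<alpha> \<beta> m
    by (simp add: R_def C.solution_coeff_def C.spray_deriv_lowered_def C.dS_def dS_def lie_deriv_fun_def)
  have Q: "Q b \<alpha> \<beta> m = C.canonical_coeff b \<alpha> \<beta> m" for b \<alpha> \<beta> m
    by (simp add: Q_def C.canonical_coeff_def C.spray_deriv_lowered_def C.dS_def C.yC_def dS_def lie_deriv_fun_def sum_distrib_left mult_ac)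
  have llf: "adapted_llf b \<longleftrightarrow> adapted K S J b" for b
    using C.adapted_linear_fibration by (auto simp: adapted_llf_def)
  have N0: "(\<lambda>m. \<lambda>w\<in>TT K m. N\<^sub>S m w + g2_inv K g (defect_form K P S J \<Omega>) m (J m w)) = C.lm_connection"
    unfolding C.lm_connection_def[abs_def] g_def C.g2_inv_defect N\<^sub>S_def ..
  have LM: "LM N \<longleftrightarrow> lagrangian_connection K \<Omega> N \<and> metric_connection K P S (vertical_metric K J \<Omega>) N" for N
    by (simp add: LM_def)
  have formula: "nonlinear_connection K N \<and> LM N \<longleftrightarrow> N = C.lm_connection" for N
    unfolding LM by (rule C.nonlinear_LM_iff)
  have coeffs: "LM N \<longleftrightarrow> (\<forall>b. adapted K S J b \<longrightarrow> (\<forall>m\<in>cdom b. \<forall>\<alpha> \<beta>.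
             (\<Sum>\<gamma>\<in>UNIV. metric_coeff K \<Omega> b \<beta> \<gamma> m * conn_coeff K N b \<alpha> \<gamma> m) = R b \<alpha> \<beta> m))"
    if "nonlinear_connection K N" for N
    unfolding LM C.LM_iff(1)[OF that] C.conn_lowered_def R ..
  \<comment> \<open>The coefficients of N solve the system by \<open>LM_coefficients\<close>;
    nondegeneracy of g admits no other solution.\<close>
  have solve: "(\<forall>\<alpha> \<beta>. (\<Sum>\<gamma>\<in>UNIV. metric_coeff K \<Omega> b \<beta> \<gamma> m * c \<alpha> \<gamma>) = R b \<alpha> \<beta> m) \<longleftrightarrow>
            (\<forall>\<alpha> \<beta>. c \<alpha> \<beta> = conn_coeff K N b \<alpha> \<beta> m)"
    if N: "nonlinear_connection K N \<and> LM N" and b: "adapted K S J b" "m \<in> cdom b" for N b m c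
  proof -
    have G: "(\<Sum>\<gamma>\<in>UNIV. metric_coeff K \<Omega> b \<beta> \<gamma> m * conn_coeff K N b \<alpha> \<gamma> m) = R b \<alpha> \<beta> m" for \<alpha> \<beta>
      using C.LM_coefficients[OF conjunct1[OF N] _ b] N unfolding LM R C.conn_lowered_def by blast
    have "c \<alpha> = (\<lambda>\<gamma>. conn_coeff K N b \<alpha> \<gamma> m)"
      if "\<forall>\<alpha> \<beta>. (\<Sum>\<gamma>\<in>UNIV. metric_coeff K \<Omega> b \<beta> \<gamma> m * c \<alpha> \<gamma>) = R b \<alpha> \<beta> m" for \<alpha>
      by (rule C.metric_coeff_inject[OF b]) (simp add: G that)
    then show ?thesis using G by auto
  qed
  have NS1: "LM N\<^sub>S \<longleftrightarrow> (\<forall>b. adapted_llf b \<longrightarrow> (\<forall>m\<in>cdom b. \<forall>\<alpha> \<beta>. Q b \<alpha> \<beta> m = 0))"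
    unfolding LM N\<^sub>S_def C.LM_iff(1)[OF C.NS_nonlinear] llf Q using C.conn_lowered_NS_iff by blast
  have NS2: "LM N\<^sub>S \<longleftrightarrow> (\<forall>m\<^sub>0. \<exists>b. adapted_llf b \<and> m\<^sub>0 \<in> cdom b \<and> (\<forall>m\<in>cdom b. \<forall>\<alpha> \<beta>. Q b \<alpha> \<beta> m = 0))"
    unfolding LM N\<^sub>S_def C.LM_iff(2)[OF C.NS_nonlinear] llf Q
    by (intro iff_allI iff_exI conj_cong refl ball_cong) (simp add: C.conn_lowered_NS_iff)
  have NS3: "nonlinear_connection K N \<and> LM N \<longleftrightarrow> N = N\<^sub>S" if "LM N\<^sub>S" for N
  proof -
    have "N\<^sub>S = C.lm_connection" using formula[of "N\<^sub>S"] that C.NS_nonlinear by (simp add: N\<^sub>S_def)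
    then show ?thesis using formula by simp
  qed
  have ex1: "\<exists>!N. nonlinear_connection K N \<and> LM N" unfolding formula by blast
  show ?thesis
    unfolding N0
    by (intro conjI allI impI ballI ex1 formula coeffs solve NS1 NS2 NS3) blast+
qed

end
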